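(* Let $\Omega\subset\mathbb{R}^N$ ($N\ge 2$) be a bounded domain with smooth boundary, let $p,q,s\in C(\overline\Omega)$ satisfy $$1<p(x),\,q(x)<N<s(x)\quad\text{and}\quad s'(x)q(x)=\frac{s(x)q(x)}{s(x)-1}<p^*(x)\qquad\text{for all }x\in\overline\Omega,$$ and let $V\in L^{s(x)}(\Omega)$ with $V>0$. Suppose $q^+<p^-$ and let $\alpha>0$. Let $(\lambda,u_\lambda)$ be the eigenpair given by the Lagrange multiplier method on $M_\alpha$, with $\lambda$ the smallest eigenvalue on the sphere $M_\alpha$ (see context), and let $(u_{1,\alpha},\mu_{1,\alpha})$ be the first Ljusternik–Schnirelman eigenpair (see context). Then $$I_\lambda(u_{1,\alpha})=\inf_{u\in M_\alpha}I_\lambda(u)=I_\lambda(u_\lambda),$$ that is, $u_{1,\alpha}$ is an eigenfunction of the problem $-\Delta_{p(x)}u=\lambda V(x)|u|^{q(x)-2}u$ in $\Omega$, $u=0$ on $\partial\Omega$, associated with the eigenvalue $\lambda$; and hence $\lambda=\lambda_{1,\alpha}=\frac1{\mu_{1,\alpha}}$.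
   Context: For $h\in C(\overline\Omega)$ put $h^-=\min_{\overline\Omega}h$, $h^+=\max_{\overline\Omega}h$. $p^*(x)=\frac{Np(x)}{N-p(x)}$ when $p(x)<N$. $L^{s(x)}(\Omega)$ is the variable exponent Lebesgue space (Luxemburg norm $\|\cdot\|_{s(x)}$). $X=W_0^{1,p(x)}(\Omega)$ is the closure of $C_0^\infty(\Omega)$ in the variable exponent Sobolev space $W^{1,p(x)}(\Omega)$, with norm $\|u\|=\|\nabla u\|_{p(x)}$. $\Delta_{p(x)}u=\mathrm{div}(|\nabla u|^{p(x)-2}\nabla u)$. For $u\in X$: $F(u)=\int_\Omega\frac{V(x)}{q(x)}|u|^{q(x)}dx$, $G(u)=\int_\Omega\frac{1}{p(x)}|\nabla u|^{p(x)}dx$, $I_\lambda(u)=G(u)-\lambda F(u)$, $\phi(u)=\int_\Omega V(x)|u|^{q(x)}dx$, $\psi(u)=\int_\Omega|\nabla u|^{p(x)}dx$; $F,G\in C^1(X,\mathbb{R})$. $M_\alpha=\{u\in X:G(u)=\alpha\}$. A pair $(\lambda,u)\in\mathbb{R}\times X$ with $u\neq0$ is an eigenpair ($\lambda$ an eigenvalue, $u$ an associated eigenfunction) if $G'(u)=\lambda F'(u)$, i.e. $\int_\Omega|\nabla u|^{p(x)-2}\nabla u\cdot\nabla v\,dx=\lambda\int_\Omega V|u|^{q(x)-2}uv\,dx$ for all $v\in X$. Lagrange multiplier eigenpair: $u_\lambda\in M_\alpha$ satisfies $F(u_\lambda)=\sup_{u\in M_\alpha}F(u)$ (equivalently $I_\lambda(u_\lambda)=\inf_{M_\alpha}I_\lambda$),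 $\lambda=\frac{\psi(u_\lambda)}{\phi(u_\lambda)}$, $(\lambda,u_\lambda)$ is an eigenpair, and $\lambda$ is the smallest eigenvalue having an eigenfunction in $M_\alpha$. Ljusternik–Schnirelman eigenpairs: for $n\ge1$ let $\Sigma_{(n,\alpha)}$ be the family of compact sets $H\subset M_\alpha$ with $-H=H$ and $\gamma(H)\ge n$, where the genus $\gamma(H)$ is the least $k\in\mathbb{N}$ for which there is a continuous odd map $H\to\mathbb{R}^k\setminus\{0\}$. Put $a_{(n,\alpha)}=\sup_{H\in\Sigma_{(n,\alpha)}}\inf_{u\in H}F(u)$. The Ljusternik–Schnirelman principle provides pairs $(u_{n,\alpha},\mu_{n,\alpha})$ with $u_{n,\alpha}\in M_\alpha$, $F(u_{n,\alpha})=a_{(n,\alpha)}$, $\mu_{n,\alpha}\neq0$ and $F'(u_{n,\alpha})=\mu_{n,\alpha}G'(u_{n,\alpha})$; put $\lambda_{n,\alpha}=1/\mu_{n,\alpha}$. *)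

theory Defs
  imports "HOL-Analysis.Analysis"
begin

section \<open>Smooth functions and domains\<close>

text \<open>Meant for open \<open>S\<close>.\<close>

primrec Ck_on :: "nat \<Rightarrow> ('a::euclidean_space \<Rightarrow> real) \<Rightarrow> 'a set \<Rightarrow> bool" where
  "Ck_on 0 f S \<longleftrightarrow> continuous_on S f"
| "Ck_on (Suc k) f S \<longleftrightarrow>
     (\<forall>x\<in>S. f differentiable (at x)) \<and>
     (\<forall>b\<in>Basis. Ck_on k (\<lambda>x. frechet_derivative f (at x) b) S)"

definition smooth_on :: "('a::euclidean_space \<Rightarrow> real) \<Rightarrow> 'a set \<Rightarrow> bool" where
  "smooth_on f S \<longleftrightarrow> (\<forall>k. Ck_on k f S)"

text \<open>Near each boundary point, \<open>\<Omega>\<close> is, in suitable orthonormal coordinates, the region above the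
  graph of a smooth function \<open>g\<close>. Here \<open>e\<close> is the vertical direction and
  \<open>y - (y \<bullet> e) *\<^sub>R e\<close> are the horizontal coordinates of \<open>y\<close>.\<close>

definition smooth_boundary :: "'a::euclidean_space set \<Rightarrow> bool" where
  "smooth_boundary \<Omega> \<longleftrightarrow>
     (\<forall>x\<in>frontier \<Omega>. \<exists>r>0. \<exists>e g. norm e = 1 \<and> smooth_on g UNIV \<and>
        \<Omega> \<inter> ball x r = {y \<in> ball x r. g (y - (y \<bullet> e) *\<^sub>R e) < y \<bullet> e})"

definition bounded_smooth_domain :: "'a::euclidean_space set \<Rightarrow> bool" where
  "bounded_smooth_domain \<Omega> \<longleftrightarrow>
     open \<Omega> \<and> connected \<Omega> \<and> \<Omega> \<noteq> {} \<and> bounded \<Omega> \<and> smooth_boundary \<Omega>"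

definition test_functions :: "'a::euclidean_space set \<Rightarrow> ('a \<Rightarrow> real) set" where
  "test_functions \<Omega> =
     {f. smooth_on f UNIV \<and> compact (closure {x. f x \<noteq> 0}) \<and> closure {x. f x \<noteq> 0} \<subseteq> \<Omega>}"

section \<open>Exponents\<close>

text \<open>For a continuous function on a nonempty compact set these are the minimum and the maximum.\<close>

definition lower_exp :: "'a::euclidean_space set \<Rightarrow> ('a \<Rightarrow> real) \<Rightarrow> real" where
  "lower_exp \<Omega> h = (INF x\<in>closure \<Omega>. h x)"

definition upper_exp :: "'a::euclidean_space set \<Rightarrow> ('a \<Rightarrow> real) \<Rightarrow> real" where
  "upper_exp \<Omega> h = (SUP x\<in>closure \<Omega>. h x)"

definition critical_exp :: "('a::euclidean_space \<Rightarrow> real) \<Rightarrow> 'a \<Rightarrow> real" where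
  "critical_exp p x = real DIM('a) * p x / (real DIM('a) - p x)"

section \<open>Variable exponent Lebesgue and Sobolev spaces\<close>

text \<open>Elements of these spaces are represented by functions on the whole space, of which only the
  restriction to \<open>\<Omega>\<close>, up to null sets, is relevant; functions that agree almost everywhere in
  \<open>\<Omega>\<close> are not identified.\<close>

definition modular ::
    "'a::euclidean_space set \<Rightarrow> ('a \<Rightarrow> real) \<Rightarrow> ('a \<Rightarrow> 'b::euclidean_space) \<Rightarrow> ennreal" where
  "modular \<Omega> r f = (\<integral>\<^sup>+ x. ennreal (norm (f x) powr r x) \<partial>lebesgue_on \<Omega>)"

definition var_Lebesgue ::
    "'a::euclidean_space set \<Rightarrow> ('a \<Rightarrow> real) \<Rightarrow> ('a \<Rightarrow> 'b::euclidean_space) set" where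
  "var_Lebesgue \<Omega> r = {f \<in> borel_measurable (lebesgue_on \<Omega>). modular \<Omega> r f < \<infinity>}"

definition luxemburg_norm ::
    "'a::euclidean_space set \<Rightarrow> ('a \<Rightarrow> real) \<Rightarrow> ('a \<Rightarrow> 'b::euclidean_space) \<Rightarrow> real" where
  "luxemburg_norm \<Omega> r f = Inf {c. 0 < c \<and> modular \<Omega> r (\<lambda>x. f x /\<^sub>R c) \<le> 1}"

definition locally_integrable ::
    "'a::euclidean_space set \<Rightarrow> ('a \<Rightarrow> 'b::euclidean_space) \<Rightarrow> bool" where
  "locally_integrable \<Omega> f \<longleftrightarrow> (\<forall>K. compact K \<and> K \<subseteq> \<Omega> \<longrightarrow> integrable (lebesgue_on K) f)"

definition has_weak_gradient ::
    "'a::euclidean_space set \<Rightarrow> ('a \<Rightarrow> real) \<Rightarrow> ('a \<Rightarrow> 'a) \<Rightarrow> bool" where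
  "has_weak_gradient \<Omega> u g \<longleftrightarrow>
     locally_integrable \<Omega> u \<and> locally_integrable \<Omega> g \<and>
     (\<forall>f\<in>test_functions \<Omega>. \<forall>b\<in>Basis.
        (LINT x|lebesgue_on \<Omega>. u x * frechet_derivative f (at x) b) =
        - (LINT x|lebesgue_on \<Omega>. (g x \<bullet> b) * f x))"

text \<open>The weak gradient is unique only up to null sets; some version of it is chosen.\<close>

definition weak_gradient ::
    "'a::euclidean_space set \<Rightarrow> ('a \<Rightarrow> real) \<Rightarrow> 'a \<Rightarrow> 'a" where
  "weak_gradient \<Omega> u = (SOME g. has_weak_gradient \<Omega> u g)"

definition var_Sobolev ::
    "'a::euclidean_space set \<Rightarrow> ('a \<Rightarrow> real) \<Rightarrow> ('a \<Rightarrow> real) set" where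
  "var_Sobolev \<Omega> p =
     {u \<in> var_Lebesgue \<Omega> p. \<exists>g \<in> var_Lebesgue \<Omega> p. has_weak_gradient \<Omega> u g}"

definition Sobolev_norm ::
    "'a::euclidean_space set \<Rightarrow> ('a \<Rightarrow> real) \<Rightarrow> ('a \<Rightarrow> real) \<Rightarrow> real" where
  "Sobolev_norm \<Omega> p u = luxemburg_norm \<Omega> p u + luxemburg_norm \<Omega> p (weak_gradient \<Omega> u)"

definition var_Sobolev0 ::
    "'a::euclidean_space set \<Rightarrow> ('a \<Rightarrow> real) \<Rightarrow> ('a \<Rightarrow> real) set" where
  "var_Sobolev0 \<Omega> p =
     {u \<in> var_Sobolev \<Omega> p.
        \<forall>e>0. \<exists>f\<in>test_functions \<Omega>. Sobolev_norm \<Omega> p (\<lambda>x. u x - f x) < e}"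

definition Sobolev0_norm ::
    "'a::euclidean_space set \<Rightarrow> ('a \<Rightarrow> real) \<Rightarrow> ('a \<Rightarrow> real) \<Rightarrow> real" where
  "Sobolev0_norm \<Omega> p u = luxemburg_norm \<Omega> p (weak_gradient \<Omega> u)"

text \<open>The norm topology. Because representatives are not identified it is only pseudometrizable,
  but a continuous map into a Hausdorff space takes the same value on all representatives of an
  element.\<close>

definition Sobolev0_topology ::
    "'a::euclidean_space set \<Rightarrow> ('a \<Rightarrow> real) \<Rightarrow> ('a \<Rightarrow> real) topology" where
  "Sobolev0_topology \<Omega> p = topology (\<lambda>U. U \<subseteq> var_Sobolev0 \<Omega> p \<and>
     (\<forall>u\<in>U. \<exists>e>0. \<forall>v\<in>var_Sobolev0 \<Omega> p. Sobolev0_norm \<Omega> p (\<lambda>x. v x - u x) < e \<longrightarrow> v \<in> U))"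

lemma openin_Sobolev0_topology:
  "openin (Sobolev0_topology \<Omega> p) U \<longleftrightarrow> U \<subseteq> var_Sobolev0 \<Omega> p \<and>
     (\<forall>u\<in>U. \<exists>e>0. \<forall>v\<in>var_Sobolev0 \<Omega> p. Sobolev0_norm \<Omega> p (\<lambda>x. v x - u x) < e \<longrightarrow> v \<in> U)"
proof -
  let ?P = "\<lambda>U. U \<subseteq> var_Sobolev0 \<Omega> p \<and>
     (\<forall>u\<in>U. \<exists>e>0. \<forall>v\<in>var_Sobolev0 \<Omega> p. Sobolev0_norm \<Omega> p (\<lambda>x. v x - u x) < e \<longrightarrow> v \<in> U)"
  have inter: "?P (S \<inter> T)" if S: "?P S" and T: "?P T" for S T
  proof (intro conjI ballI)
    show "S \<inter> T \<subseteq> var_Sobolev0 \<Omega> p"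
      using S by blast
    fix u assume "u \<in> S \<inter> T"
    then have "u \<in> S" "u \<in> T"
      by auto
    obtain d where "0 < d"
      and "\<forall>v\<in>var_Sobolev0 \<Omega> p. Sobolev0_norm \<Omega> p (\<lambda>x. v x - u x) < d \<longrightarrow> v \<in> S"
      using S \<open>u \<in> S\<close> by blast
    moreover obtain e where "0 < e"
      and "\<forall>v\<in>var_Sobolev0 \<Omega> p. Sobolev0_norm \<Omega> p (\<lambda>x. v x - u x) < e \<longrightarrow> v \<in> T"
      using T \<open>u \<in> T\<close> by blast
    ultimately show "\<exists>e>0. \<forall>v\<in>var_Sobolev0 \<Omega> p.
        Sobolev0_norm \<Omega> p (\<lambda>x. v x - u x) < e \<longrightarrow> v \<in> S \<inter> T"
      by (intro exI[of _ "min d e"]) auto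
  qed
  have union: "?P (\<Union>K)" if K: "\<forall>S\<in>K. ?P S" for K
  proof (intro conjI ballI)
    show "\<Union>K \<subseteq> var_Sobolev0 \<Omega> p"
      using K by blast
    fix u assume "u \<in> \<Union>K"
    then obtain S where "S \<in> K" "u \<in> S"
      by blast
    obtain e where "0 < e"
      and "\<forall>v\<in>var_Sobolev0 \<Omega> p. Sobolev0_norm \<Omega> p (\<lambda>x. v x - u x) < e \<longrightarrow> v \<in> S"
      using bspec[OF K \<open>S \<in> K\<close>] \<open>u \<in> S\<close> by blast
    then show "\<exists>e>0. \<forall>v\<in>var_Sobolev0 \<Omega> p.
        Sobolev0_norm \<Omega> p (\<lambda>x. v x - u x) < e \<longrightarrow> v \<in> \<Union>K"
      using \<open>S \<in> K\<close> by (intro exI[of _ e]) blast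
  qed
  have "istopology ?P"
    unfolding istopology_def using inter union by simp
  then show ?thesis
    unfolding Sobolev0_topology_def by (simp add: topology_inverse')
qed

lemma topspace_Sobolev0_topology: "topspace (Sobolev0_topology \<Omega> p) = var_Sobolev0 \<Omega> p"
proof
  show "topspace (Sobolev0_topology \<Omega> p) \<subseteq> var_Sobolev0 \<Omega> p"
    using openin_Sobolev0_topology[of \<Omega> p "topspace (Sobolev0_topology \<Omega> p)"] by simp
  have "openin (Sobolev0_topology \<Omega> p) (var_Sobolev0 \<Omega> p)"
    unfolding openin_Sobolev0_topology using zero_less_one by blast
  then show "var_Sobolev0 \<Omega> p \<subseteq> topspace (Sobolev0_topology \<Omega> p)"
    by (rule openin_subset)
qed

section \<open>The functionals\<close>

definition F_fun ::
    "'a::euclidean_space set \<Rightarrow> ('a \<Rightarrow> real) \<Rightarrow> ('a \<Rightarrow> real) \<Rightarrow> ('a \<Rightarrow> real) \<Rightarrow> real" where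
  "F_fun \<Omega> q V u = (LINT x|lebesgue_on \<Omega>. V x / q x * \<bar>u x\<bar> powr q x)"

definition G_fun ::
    "'a::euclidean_space set \<Rightarrow> ('a \<Rightarrow> real) \<Rightarrow> ('a \<Rightarrow> real) \<Rightarrow> real" where
  "G_fun \<Omega> p u = (LINT x|lebesgue_on \<Omega>. 1 / p x * norm (weak_gradient \<Omega> u x) powr p x)"

definition I_fun ::
    "'a::euclidean_space set \<Rightarrow> ('a \<Rightarrow> real) \<Rightarrow> ('a \<Rightarrow> real) \<Rightarrow> ('a \<Rightarrow> real) \<Rightarrow> real
      \<Rightarrow> ('a \<Rightarrow> real) \<Rightarrow> real" where
  "I_fun \<Omega> p q V lam u = G_fun \<Omega> p u - lam * F_fun \<Omega> q V u"

definition phi_fun ::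
    "'a::euclidean_space set \<Rightarrow> ('a \<Rightarrow> real) \<Rightarrow> ('a \<Rightarrow> real) \<Rightarrow> ('a \<Rightarrow> real) \<Rightarrow> real" where
  "phi_fun \<Omega> q V u = (LINT x|lebesgue_on \<Omega>. V x * \<bar>u x\<bar> powr q x)"

definition psi_fun ::
    "'a::euclidean_space set \<Rightarrow> ('a \<Rightarrow> real) \<Rightarrow> ('a \<Rightarrow> real) \<Rightarrow> real" where
  "psi_fun \<Omega> p u = (LINT x|lebesgue_on \<Omega>. norm (weak_gradient \<Omega> u x) powr p x)"

text \<open>The derivatives \<open>F'(u)\<close> and \<open>G'(u)\<close> applied to the direction \<open>v\<close>, in integral form.\<close>

definition F_deriv ::
    "'a::euclidean_space set \<Rightarrow> ('a \<Rightarrow> real) \<Rightarrow> ('a \<Rightarrow> real) \<Rightarrow> ('a \<Rightarrow> real)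
      \<Rightarrow> ('a \<Rightarrow> real) \<Rightarrow> real" where
  "F_deriv \<Omega> q V u v = (LINT x|lebesgue_on \<Omega>. V x * \<bar>u x\<bar> powr (q x - 2) * u x * v x)"

definition G_deriv ::
    "'a::euclidean_space set \<Rightarrow> ('a \<Rightarrow> real) \<Rightarrow> ('a \<Rightarrow> real) \<Rightarrow> ('a \<Rightarrow> real) \<Rightarrow> real" where
  "G_deriv \<Omega> p u v = (LINT x|lebesgue_on \<Omega>.
     norm (weak_gradient \<Omega> u x) powr (p x - 2) * (weak_gradient \<Omega> u x \<bullet> weak_gradient \<Omega> v x))"

definition sphere_M ::
    "'a::euclidean_space set \<Rightarrow> ('a \<Rightarrow> real) \<Rightarrow> real \<Rightarrow> ('a \<Rightarrow> real) set" where
  "sphere_M \<Omega> p \<alpha> = {u \<in> var_Sobolev0 \<Omega> p. G_fun \<Omega> p u = \<alpha>}"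

section \<open>Eigenpairs\<close>

definition eigenpair ::
    "'a::euclidean_space set \<Rightarrow> ('a \<Rightarrow> real) \<Rightarrow> ('a \<Rightarrow> real) \<Rightarrow> ('a \<Rightarrow> real) \<Rightarrow> real
      \<Rightarrow> ('a \<Rightarrow> real) \<Rightarrow> bool" where
  "eigenpair \<Omega> p q V lam u \<longleftrightarrow>
     u \<in> var_Sobolev0 \<Omega> p \<and> \<not> (AE x in lebesgue_on \<Omega>. u x = 0) \<and>
     (\<forall>v\<in>var_Sobolev0 \<Omega> p. G_deriv \<Omega> p u v = lam * F_deriv \<Omega> q V u v)"

text \<open>Suprema and infima of functionals are taken in the extended reals, so that they are
  meaningful without boundedness assumptions.\<close>

definition lagrange_eigenpair ::
    "'a::euclidean_space set \<Rightarrow> ('a \<Rightarrow> real) \<Rightarrow> ('a \<Rightarrow> real) \<Rightarrow> ('a \<Rightarrow> real) \<Rightarrow> real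
      \<Rightarrow> real \<Rightarrow> ('a \<Rightarrow> real) \<Rightarrow> bool" where
  "lagrange_eigenpair \<Omega> p q V \<alpha> lam u \<longleftrightarrow>
     u \<in> sphere_M \<Omega> p \<alpha> \<and>
     ereal (F_fun \<Omega> q V u) = (SUP w\<in>sphere_M \<Omega> p \<alpha>. ereal (F_fun \<Omega> q V w)) \<and>
     lam = psi_fun \<Omega> p u / phi_fun \<Omega> q V u \<and>
     eigenpair \<Omega> p q V lam u \<and>
     (\<forall>\<mu> w. eigenpair \<Omega> p q V \<mu> w \<and> w \<in> sphere_M \<Omega> p \<alpha> \<longrightarrow> lam \<le> \<mu>)"

text \<open>The genus is \<open>\<infinity>\<close> if there is no odd map as required. The value \<open>k = 0\<close> is admitted; since
  there is no map from a nonempty set to the empty set, it only arises for the empty set.\<close>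

definition genus ::
    "'a::euclidean_space set \<Rightarrow> ('a \<Rightarrow> real) \<Rightarrow> ('a \<Rightarrow> real) set \<Rightarrow> enat" where
  "genus \<Omega> p H = Inf {enat k | k. \<exists>h.
     continuous_map (subtopology (Sobolev0_topology \<Omega> p) H)
       (subtopology (Euclidean_space k) (- {\<lambda>i. 0})) h \<and>
     (\<forall>u\<in>H. h (\<lambda>x. - u x) = (\<lambda>i. - h u i))}"

definition LS_family ::
    "'a::euclidean_space set \<Rightarrow> ('a \<Rightarrow> real) \<Rightarrow> nat \<Rightarrow> real \<Rightarrow> ('a \<Rightarrow> real) set set" where
  "LS_family \<Omega> p n \<alpha> =
     {H. compactin (Sobolev0_topology \<Omega> p) H \<and> H \<subseteq> sphere_M \<Omega> p \<alpha> \<and>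
         (\<lambda>u x. - u x) ` H = H \<and> enat n \<le> genus \<Omega> p H}"

definition LS_value ::
    "'a::euclidean_space set \<Rightarrow> ('a \<Rightarrow> real) \<Rightarrow> ('a \<Rightarrow> real) \<Rightarrow> ('a \<Rightarrow> real) \<Rightarrow> nat \<Rightarrow> real
      \<Rightarrow> ereal" where
  "LS_value \<Omega> p q V n \<alpha> = (SUP H\<in>LS_family \<Omega> p n \<alpha>. INF u\<in>H. ereal (F_fun \<Omega> q V u))"

definition LS_eigenpair ::
    "'a::euclidean_space set \<Rightarrow> ('a \<Rightarrow> real) \<Rightarrow> ('a \<Rightarrow> real) \<Rightarrow> ('a \<Rightarrow> real) \<Rightarrow> nat \<Rightarrow> real
      \<Rightarrow> ('a \<Rightarrow> real) \<Rightarrow> real \<Rightarrow> bool" where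
  "LS_eigenpair \<Omega> p q V n \<alpha> u \<mu> \<longleftrightarrow>
     u \<in> sphere_M \<Omega> p \<alpha> \<and>
     ereal (F_fun \<Omega> q V u) = LS_value \<Omega> p q V n \<alpha> \<and>
     \<mu> \<noteq> 0 \<and>
     (\<forall>v\<in>var_Sobolev0 \<Omega> p. F_deriv \<Omega> q V u v = \<mu> * G_deriv \<Omega> p u v)"

end

theory Submission
  imports Defs
begin

text \<open>
  Pairs \<open>{v, -v}\<close> show that the first Ljusternik--Schnirelman value is the supremum of \<open>F\<close> on the
  sphere, so \<open>u\<^sub>1\<close> and \<open>u_lam\<close> are both maximizers, and it remains to see that two maximizers have
  the same Lagrange multiplier \<open>psi / phi\<close>; with variable exponents this is not automatic. If the
  multipliers differed, one could enlarge one maximizer and shrink the other so that the mean of \<open>G\<close>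
  falls below \<open>\<alpha>\<close> while the mean of \<open>F\<close> exceeds its maximum. For \<open>q \<le> r \<le> p\<close> the pointwise power mean
  of exponent \<open>r\<close> of the moduli of two functions does not increase the mean of \<open>G\<close> and does not decrease that of \<open>F\<close>
  (hidden convexity); it would give a function with \<open>G\<close> below \<open>\<alpha>\<close> and \<open>F\<close> above the maximum, and
  scaling it up to the sphere is a contradiction. A smoothed power mean of test functions is again
  a test function, so no chain rule or embedding theorem for the variable exponent Sobolev space is needed:
  a.e. convergence of approximating test functions and Fatou's lemma for \<open>F\<close> suffice.
\<close>

section \<open>Smooth functions\<close>

text \<open>For constant exponents \<open>psi\<close> is p times \<open>G\<close> and
  \<open>phi\<close> is q times \<open>F\<close>, so all maximizers share one multiplier. For
  variable exponents \<open>phi\<close> and \<open>psi\<close> are not functions of \<open>F\<close>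
  and \<open>G\<close>, but they still are the slopes of \<open>F\<close> and \<open>G\<close> along
  rays. Scaling \<open>u\<close> by \<open>1 + h\<close> and \<open>w\<close> by
  \<open>1 - c h\<close> changes the sum of the \<open>G\<close> values by
  \<open>h (psi u - c psi w)\<close> and that of the \<open>F\<close> values by
  \<open>h (phi u - c phi w)\<close> to first order. If
  \<open>psi u / psi w < phi u / phi w\<close>, any \<open>c\<close> strictly between makes the
  first change negative and the second positive.

  The exponent \<open>r\<close> will be \<open>lower_exp \<Omega> p\<close>, which separates
  \<open>q\<close> from \<open>p\<close> because q^+ < p^-. As functions of |u|^r, the integrand of
  \<open>F\<close> is concave since q <= r, and that of \<open>G\<close> is convex since r <= p.

  Gradients are computed for test functions only. Since \<open>weak_gradient\<close> is a choice,
  even this requires uniqueness of weak gradients, hence the fundamental lemma of the calculus of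
  variations, hence explicit smooth bumps; the first two sections serve this.\<close>

lemma Ck_on_SucI:
  assumes "\<And>x. (f has_derivative D x) (at x)" "\<And>b. b \<in> Basis \<Longrightarrow> Ck_on k (\<lambda>x. D x b) UNIV"
  shows "Ck_on (Suc k) f UNIV"
proof -
  have "frechet_derivative f (at x) = D x" for x
    using assms(1) by (metis frechet_derivative_at)
  then show ?thesis
    using assms by (auto simp: differentiable_def)
qed

lemma Ck_on_SucD:
  assumes "Ck_on (Suc k) f UNIV"
  shows "(f has_derivative frechet_derivative f (at x)) (at x)"
    "b \<in> Basis \<Longrightarrow> Ck_on k (\<lambda>x. frechet_derivative f (at x) b) UNIV"
  using assms by (auto simp: frechet_derivative_works[symmetric])

lemma Ck_on_Suc_imp: "Ck_on (Suc k) f UNIV \<Longrightarrow> Ck_on k f UNIV"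
proof (induction k arbitrary: f)
  case 0
  then show ?case
    by (auto simp: continuous_on_eq_continuous_within differentiable_imp_continuous_within)
next
  case (Suc k)
  have "\<forall>x. f differentiable (at x)"
    using Suc.prems by simp
  moreover have "Ck_on k (\<lambda>x. frechet_derivative f (at x) b) UNIV" if "b \<in> Basis" for b
    using Suc.IH Suc.prems that by (metis Ck_on_SucD(2))
  ultimately show ?case by simp
qed

lemma Ck_on_const: "Ck_on k (\<lambda>x. c) UNIV"
proof (induction k arbitrary: c)
  case (Suc k)
  show ?case by (rule Ck_on_SucI[where D = "\<lambda>x v. 0"]) (auto intro: Suc)
qed simp

lemma Ck_on_inner: "Ck_on k (\<lambda>x. x \<bullet> c) UNIV"
proof (cases k)
  case (Suc m)
  show ?thesis unfolding Suc
    by (rule Ck_on_SucI[where D = "\<lambda>x v. v \<bullet> c"]) (auto intro!: Ck_on_const derivative_eq_intros)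
qed (auto intro!: continuous_intros)

lemma Ck_on_add: "Ck_on k f UNIV \<Longrightarrow> Ck_on k g UNIV \<Longrightarrow> Ck_on k (\<lambda>x. f x + g x) UNIV"
proof (induction k arbitrary: f g)
  case 0 then show ?case by (auto intro: continuous_intros)
next
  case (Suc k)
  show ?case
    by (rule Ck_on_SucI[OF has_derivative_add[OF Ck_on_SucD(1)[OF Suc.prems(1)] Ck_on_SucD(1)[OF Suc.prems(2)]]])
      (intro Suc.IH Ck_on_SucD(2) Suc.prems)
qed

text \<open>The product rule multiplies the derivative of one factor by the other factor itself,
  which is given one order higher; \<open>Ck_on_Suc_imp\<close> brings both to order
  \<open>k\<close>.\<close>

lemma Ck_on_mult: "Ck_on k f UNIV \<Longrightarrow> Ck_on k g UNIV \<Longrightarrow> Ck_on k (\<lambda>x. f x * g x) UNIV"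
proof (induction k arbitrary: f g)
  case 0 then show ?case by (auto intro: continuous_intros)
next
  case (Suc k)
  show ?case
    by (rule Ck_on_SucI[OF has_derivative_mult[OF Ck_on_SucD(1)[OF Suc.prems(1)] Ck_on_SucD(1)[OF Suc.prems(2)]]])
      (intro Ck_on_add Suc.IH Ck_on_SucD(2) Suc.prems Ck_on_Suc_imp)
qed

text \<open>The induction generalizes \<open>r\<close>, since each derivative lowers the exponent by
  1; positivity of \<open>f\<close> keeps all these powers differentiable.\<close>

lemma Ck_on_powr:
  assumes "Ck_on k f UNIV" "\<And>x. f x > 0"
  shows "Ck_on k (\<lambda>x. f x powr r) UNIV"
  using assms(1)
proof (induction k arbitrary: r)
  case 0 then show ?case using assms(2) by (auto intro!: continuous_intros simp: less_imp_neq[symmetric])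
next
  case (Suc k)
  note d = Ck_on_SucD[OF Suc.prems]
  have "((\<lambda>x. f x powr r) has_derivative (\<lambda>v. r * f x powr (r - 1) * frechet_derivative f (at x) v)) (at x)" for x
  proof -
    have "((\<lambda>t. t powr r) has_real_derivative r * f x powr (r - 1)) (at (f x))"
      using assms(2) by (intro has_real_derivative_powr) auto
    then show ?thesis
      using has_derivative_compose[OF d(1)] unfolding has_field_derivative_def by blast
  qed
  then show ?case
    by (rule Ck_on_SucI) (intro Ck_on_mult Ck_on_const d(2) Suc.IH Ck_on_Suc_imp[OF Suc.prems])
qed

section \<open>Flat functions\<close>

text \<open>\<open>flat_exp 0\<close> is the classical smooth function that is flat at 0. Dividing
  by \<open>t ^ j\<close> makes the family closed under differentiation up to linear combinations,
  so smoothness follows by induction for all members at once.\<close>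

definition flat_exp :: "nat \<Rightarrow> real \<Rightarrow> real" where
  "flat_exp j t = (if t > 0 then exp (- 1 / t) / t ^ j else 0)"

lemma flat_exp_tendsto_0: "(flat_exp j \<longlongrightarrow> 0) (at 0)"
proof -
  have "((\<lambda>y. y ^ j / exp y) \<longlongrightarrow> (0::real)) at_top"
    by (rule tendsto_power_div_exp_0)
  then have "((\<lambda>t. (inverse t) ^ j / exp (inverse t)) \<longlongrightarrow> (0::real)) (at_right 0)"
    by (rule filterlim_compose) (rule filterlim_inverse_at_top_right)
  moreover have "\<forall>\<^sub>F t in at_right 0. (inverse t) ^ j / exp (inverse t) = flat_exp j t"
    unfolding eventually_at_filter
    by (auto simp: flat_exp_def exp_minus field_simps)
  ultimately have "(flat_exp j \<longlongrightarrow> 0) (at_right 0)"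
    using tendsto_cong by fast
  moreover have "(flat_exp j \<longlongrightarrow> 0) (at_left 0)"
    by (rule tendsto_eventually) (auto simp: flat_exp_def eventually_at_filter)
  ultimately show ?thesis
    by (simp add: filterlim_split_at)
qed

lemma flat_exp_has_derivative:
  "(flat_exp j has_real_derivative flat_exp (j + 2) t - real j * flat_exp (Suc j) t) (at t)"
proof -
  consider "t > 0" | "t < 0" | "t = 0" by linarith
  then show ?thesis
  proof cases
    case 1
    have "((\<lambda>t. exp (- 1 / t) / t ^ j) has_real_derivative flat_exp (j + 2) t - real j * flat_exp (Suc j) t) (at t)"
    proof (cases j)
      case (Suc m)
      \<comment> \<open>Differentiation leaves the power \<open>t ^ (m - 1)\<close>, which has to be
        expressed through \<open>t ^ m\<close>; for \<open>m = 0\<close> its coefficient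
        vanishes.\<close>
      have "m = 0 \<or> t ^ m = t * t ^ (m - 1)" by (cases m) auto
      then show ?thesis
        using 1 unfolding Suc by (auto intro!: derivative_eq_intros simp: flat_exp_def field_simps power2_eq_square)
    qed (use 1 in \<open>auto intro!: derivative_eq_intros simp: flat_exp_def field_simps power2_eq_square\<close>)
    then show ?thesis
      by (rule has_field_derivative_transform_within_open[where S = "{0<..}"])
        (use 1 in \<open>auto simp: flat_exp_def\<close>)
  next
    case 2
    have "((\<lambda>t. 0) has_real_derivative 0) (at t)" by simp
    then have "(flat_exp j has_real_derivative 0) (at t)"
      by (rule has_field_derivative_transform_within_open[where S = "{..<0}"])
        (use 2 in \<open>auto simp: flat_exp_def\<close>)
    then show ?thesis using 2 by (simp add: flat_exp_def)
  next
    case 3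
    \<comment> \<open>At 0 the difference quotient of one member is the next member of the family,
      which tends to 0.\<close>
    have "(\<lambda>h. (flat_exp j (0 + h) - flat_exp j 0) / h) = flat_exp (Suc j)"
      by (auto simp: flat_exp_def fun_eq_iff)
    then show ?thesis
      using 3 flat_exp_tendsto_0[of "Suc j"] by (simp add: DERIV_def flat_exp_def)
  qed
qed

lemma Ck_on_flat_exp:
  assumes "Ck_on k f UNIV"
  shows "Ck_on k (\<lambda>x. flat_exp j (f x)) UNIV"
  using assms
proof (induction k arbitrary: j)
  case 0
  have "continuous_on UNIV (flat_exp j)"
    using flat_exp_has_derivative DERIV_isCont by (metis continuous_at_imp_continuous_on)
  then show ?case
    using 0 by (auto intro: continuous_on_compose2)
next
  case (Suc k)
  note d = Ck_on_SucD[OF Suc.prems]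
  have "((\<lambda>x. flat_exp j (f x)) has_derivative
      (\<lambda>v. (flat_exp (j + 2) (f x) + (- real j) * flat_exp (Suc j) (f x)) * frechet_derivative f (at x) v)) (at x)" for x
    using has_derivative_compose[OF d(1)] flat_exp_has_derivative[of j "f x"]
    unfolding has_field_derivative_def by fastforce
  then show ?case
    by (rule Ck_on_SucI) (intro Ck_on_mult Ck_on_add Ck_on_const d(2) Suc.IH Ck_on_Suc_imp[OF Suc.prems])
qed

lemma
  shows smooth_const: "smooth_on (\<lambda>x. c) UNIV"
    and smooth_inner: "smooth_on (\<lambda>x. x \<bullet> d) UNIV"
    and smooth_add: "smooth_on f UNIV \<Longrightarrow> smooth_on g UNIV \<Longrightarrow> smooth_on (\<lambda>x. f x + g x) UNIV"
    and smooth_mult: "smooth_on f UNIV \<Longrightarrow> smooth_on g UNIV \<Longrightarrow> smooth_on (\<lambda>x. f x * g x) UNIV"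
    and smooth_powr: "smooth_on f UNIV \<Longrightarrow> (\<And>x. f x > 0) \<Longrightarrow> smooth_on (\<lambda>x. f x powr r) UNIV"
    and smooth_flat_exp: "smooth_on f UNIV \<Longrightarrow> smooth_on (\<lambda>x. flat_exp j (f x)) UNIV"
  unfolding smooth_on_def
  by (blast intro: Ck_on_const Ck_on_inner Ck_on_add Ck_on_mult Ck_on_powr Ck_on_flat_exp)+

lemma smooth_prod:
  assumes "finite A" "\<And>i. i \<in> A \<Longrightarrow> smooth_on (f i) UNIV"
  shows "smooth_on (\<lambda>x. \<Prod>i\<in>A. f i x) UNIV"
  using assms by (induction A) (auto intro: smooth_const smooth_mult)

lemma smooth_diff:
  assumes "smooth_on f UNIV" "smooth_on g UNIV"
  shows "smooth_on (\<lambda>x. f x - g x) UNIV"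
  using smooth_add[OF assms(1) smooth_mult[OF smooth_const[of "- 1"] assms(2)]] by simp

section \<open>Gradients and test functions\<close>

definition grad :: "('a::euclidean_space \<Rightarrow> real) \<Rightarrow> 'a \<Rightarrow> 'a" where
  "grad f x = (\<Sum>b\<in>Basis. frechet_derivative f (at x) b *\<^sub>R b)"

lemma smooth_continuous: "smooth_on f UNIV \<Longrightarrow> continuous_on UNIV f"
  unfolding smooth_on_def by (metis Ck_on.simps(1))

lemma smooth_has_derivative:
  assumes "smooth_on f UNIV"
  shows "(f has_derivative (\<lambda>v. grad f x \<bullet> v)) (at x)"
proof -
  have d: "(f has_derivative frechet_derivative f (at x)) (at x)"
    using assms Ck_on_SucD(1) unfolding smooth_on_def by blast
  interpret bounded_linear "frechet_derivative f (at x)"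
    using d by (rule has_derivative_bounded_linear)
  have "frechet_derivative f (at x) v = grad f x \<bullet> v" for v
  proof -
    have "frechet_derivative f (at x) v = frechet_derivative f (at x) (\<Sum>b\<in>Basis. (v \<bullet> b) *\<^sub>R b)"
      by (simp add: euclidean_representation)
    then show ?thesis
      by (simp add: sum scaleR grad_def inner_sum_left inner_sum_right inner_commute mult.commute)
  qed
  then show ?thesis using d by presburger
qed

lemma grad_unique:
  assumes "(f has_derivative (\<lambda>v. d \<bullet> v)) (at x)"
  shows "grad f x = d"
proof -
  have "frechet_derivative f (at x) = (\<lambda>v. d \<bullet> v)"
    using assms frechet_derivative_at by metis
  then show ?thesis
    by (simp add: grad_def euclidean_representation)
qed

lemma frechet_derivative_eq_grad:
  "smooth_on f UNIV \<Longrightarrow> frechet_derivative f (at x) b = grad f x \<bullet> b"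
  using smooth_has_derivative frechet_derivative_at by metis

lemma continuous_on_grad:
  assumes "smooth_on f UNIV"
  shows "continuous_on UNIV (grad f)"
  unfolding grad_def using Ck_on_SucD(2)[of 0 f] assms
  by (intro continuous_intros) (auto simp: smooth_on_def simp del: Ck_on.simps(2))

lemma test_functionsI:
  assumes "smooth_on f UNIV" "compact K" "K \<subseteq> \<Omega>" "\<And>x. x \<notin> K \<Longrightarrow> f x = 0"
  shows "f \<in> test_functions \<Omega>"
proof -
  have "closure {x. f x \<noteq> 0} \<subseteq> K"
    using assms by (intro closure_minimal) (auto simp: compact_imp_closed)
  then show ?thesis
    using assms compact_Int_closed[OF assms(2) closed_closure, of "{x. f x \<noteq> 0}"]
    by (auto simp: test_functions_def Int_absorb1)
qed

lemma test_functionsE: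
  assumes "f \<in> test_functions \<Omega>"
  obtains K where "smooth_on f UNIV" "compact K" "K \<subseteq> \<Omega>" "\<And>x. x \<notin> K \<Longrightarrow> f x = 0" "\<And>x. x \<notin> K \<Longrightarrow> grad f x = 0"
proof
  let ?K = "closure {x. f x \<noteq> 0}"
  show "smooth_on f UNIV" "compact ?K" "?K \<subseteq> \<Omega>"
    using assms by (auto simp: test_functions_def)
  show *: "f x = 0" if "x \<notin> ?K" for x
    using that closure_subset[of "{x. f x \<noteq> 0}"] by blast
  show "grad f x = 0" if "x \<notin> ?K" for x
  proof (rule grad_unique)
    have "((\<lambda>x. 0) has_derivative (\<lambda>v. 0 \<bullet> v)) (at x)" by simp
    moreover have "open (- ?K)" by (rule open_Compl) (rule closed_closure)
    moreover have "x \<in> - ?K" using that unfolding Compl_iff .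
    moreover have "0 = f y" if "y \<in> - ?K" for y
      using *[OF that[unfolded Compl_iff]] by (rule sym)
    ultimately show "(f has_derivative (\<lambda>v. 0 \<bullet> v)) (at x)"
      by (rule has_derivative_transform_within_open)
  qed
qed

section \<open>Weak gradients\<close>

lemma
  fixes h :: "'a::euclidean_space \<Rightarrow> 'b::euclidean_space"
  assumes "K \<subseteq> T" "K \<in> sets lebesgue" "T \<in> sets lebesgue" "\<And>x. x \<notin> K \<Longrightarrow> h x = 0"
  shows integrable_lebesgue_on_support: "integrable (lebesgue_on T) h \<longleftrightarrow> integrable (lebesgue_on K) h"
    and integral_lebesgue_on_support: "integral\<^sup>L (lebesgue_on T) h = integral\<^sup>L (lebesgue_on K) h"
proof -
  have "(\<lambda>x. indicator T x *\<^sub>R h x) = (\<lambda>x. indicator K x *\<^sub>R h x)"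
    using assms by (auto simp: indicator_def fun_eq_iff)
  then show "integrable (lebesgue_on T) h \<longleftrightarrow> integrable (lebesgue_on K) h"
    "integral\<^sup>L (lebesgue_on T) h = integral\<^sup>L (lebesgue_on K) h"
    using assms by (auto simp: integrable_restrict_space integral_restrict_space)
qed

lemma continuous_compact_support_bounded:
  fixes f :: "'a::euclidean_space \<Rightarrow> 'b::real_normed_vector"
  assumes "continuous_on UNIV f" "compact K" "\<And>x. x \<notin> K \<Longrightarrow> f x = 0"
  obtains B where "B > 0" "\<And>x. norm (f x) \<le> B"
proof -
  have "bounded (f ` K)"
    using assms by (intro compact_imp_bounded compact_continuous_image) (auto intro: continuous_on_subset)
  then obtain B where "B > 0" "\<forall>y\<in>f ` K. norm y \<le> B"
    using bounded_pos by blast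
  moreover have "norm (f x) \<le> B" for x
    using assms(3)[of x] calculation by (cases "x \<in> K") auto
  ultimately show thesis using that by blast
qed

lemma continuous_borel: "continuous_on UNIV f \<Longrightarrow> f \<in> borel_measurable borel"
  by (rule borel_measurable_continuous_onI)

lemma continuous_measurable_lebesgue_on:
  fixes f :: "'a::euclidean_space \<Rightarrow> 'b::euclidean_space"
  assumes "continuous_on UNIV f"
  shows "f \<in> borel_measurable (lebesgue_on T)"
  using continuous_borel[OF assms] by (auto intro!: measurable_restrict_space1 measurable_completion)

lemma integrable_compact_support:
  fixes f :: "'a::euclidean_space \<Rightarrow> 'b::euclidean_space"
  assumes "continuous_on UNIV f" "compact K" "\<And>x. x \<notin> K \<Longrightarrow> f x = 0"
  shows "integrable lborel f"
proof -
  have "integrable lborel (\<lambda>x. indicator K x *\<^sub>R f x)"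
    using assms by (intro borel_integrable_compact) (auto intro: continuous_on_subset)
  moreover have "(\<lambda>x. indicator K x *\<^sub>R f x) = f"
    using assms by (auto simp: indicator_def fun_eq_iff)
  ultimately show ?thesis by simp
qed

lemma integral_lebesgue_on_compact_support:
  fixes f :: "'a::euclidean_space \<Rightarrow> 'b::euclidean_space"
  assumes "continuous_on UNIV f" "compact K" "\<And>x. x \<notin> K \<Longrightarrow> f x = 0" "K \<subseteq> \<Omega>" "\<Omega> \<in> sets lebesgue"
  shows "integral\<^sup>L (lebesgue_on \<Omega>) f = integral\<^sup>L lborel f"
proof -
  have m: "f \<in> borel_measurable lborel" using continuous_borel[OF assms(1)] by simp
  have [simp]: "indicator \<Omega> x *\<^sub>R f x = f x" for x
    using assms(3,4) by (auto simp: indicator_def)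
  show ?thesis
    using assms(5) m by (simp add: integral_restrict_space integral_completion)
qed

lemma lborel_integral_translation:
  fixes f :: "'a::euclidean_space \<Rightarrow> real"
  assumes "f \<in> borel_measurable borel"
  shows "(LINT x|lborel. f (x + c)) = (LINT x|lborel. f x)"
proof -
  have "(LINT x|lborel. f x) = (LINT x|distr lborel borel ((+) c). f x)"
    by (simp add: lborel_distr_plus)
  also have "\<dots> = (LINT x|lborel. f (c + x))"
    by (rule integral_distr) (use assms in auto)
  finally show ?thesis by (simp add: add.commute)
qed

text \<open>By translation invariance the difference quotients have integral 0.\<close>

lemma integral_grad_eq_0:
  assumes "f \<in> test_functions UNIV"
  shows "(LINT x|lborel. grad f x \<bullet> b) = 0"
proof -
  obtain K where K: "smooth_on f UNIV" "compact K" "\<And>x. x \<notin> K \<Longrightarrow> f x = 0" "\<And>x. x \<notin> K \<Longrightarrow> grad f x = 0"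
    using assms by (rule test_functionsE) blast
  have cf: "continuous_on UNIV f" and cg: "continuous_on UNIV (grad f)"
    using K smooth_continuous continuous_on_grad by auto
  obtain B where B: "B > 0" "\<And>x. norm (grad f x) \<le> B"
    using continuous_compact_support_bounded[OF cg K(2) K(4)] by blast
  \<comment> \<open>The Lipschitz bound dominates the difference quotients uniformly in the step
    size.\<close>
  have lip: "\<bar>f x - f y\<bar> \<le> B * norm (x - y)" for x y
  proof -
    have "norm (f x - f y) \<le> B * norm (x - y)"
    proof (rule differentiable_bound[of UNIV f "\<lambda>x v. grad f x \<bullet> v"])
      show "onorm ((\<bullet>) (grad f x)) \<le> B" for x
      proof (rule onorm_le)
        show "norm (grad f x \<bullet> y) \<le> B * norm y" for y
          using mult_right_mono[OF B(2)[of x], of "norm y"] Cauchy_Schwarz_ineq2[of "grad f x" y] by simp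
      qed
    qed (auto intro: smooth_has_derivative[OF K(1)])
    then show ?thesis by simp
  qed
  define t where "t n = inverse (real (Suc n))" for n
  have t: "0 < t n" "t n \<le> 1" for n by (auto simp: t_def field_simps)
  have t0: "t \<longlonglongrightarrow> 0" unfolding t_def by (rule LIMSEQ_inverse_real_of_nat)
  define D where "D n x = (f (x + t n *\<^sub>R b) - f x) / t n" for n x
  \<comment> \<open>All steps \<open>t n\<close> are at most 1, so \<open>K'\<close> contains the
    supports of all quotients \<open>D n\<close>.\<close>
  define K' where "K' = {x + y |x y. x \<in> K \<and> y \<in> cball 0 (norm b)}"
  have K': "compact K'" unfolding K'_def by (rule compact_sums) (use K in auto)
  have i: "integrable lborel (\<lambda>x. f (x + c))" for c
  proof (rule integrable_compact_support)
    show "continuous_on UNIV (\<lambda>x. f (x + c))"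
      by (rule continuous_on_compose2[OF cf]) (auto intro!: continuous_intros)
    show "compact {x + y |x y. x \<in> K \<and> y \<in> {- c}}" by (rule compact_sums) (use K in auto)
    fix x assume x: "x \<notin> {x + y |x y. x \<in> K \<and> y \<in> {- c}}"
    then have "x + c \<notin> K" by force
    then show "f (x + c) = 0" using K by simp
  qed
  have D0: "(LINT x|lborel. D n x) = 0" for n
  proof -
    have "(LINT x|lborel. D n x) = ((LINT x|lborel. f (x + t n *\<^sub>R b)) - (LINT x|lborel. f x)) / t n"
      unfolding D_def using i[of "t n *\<^sub>R b"] i[of 0] by simp
    then show ?thesis
      using lborel_integral_translation[of f "t n *\<^sub>R b"] continuous_borel[OF cf] by simp
  qed
  have "(\<lambda>n. LINT x|lborel. D n x) \<longlonglongrightarrow> (LINT x|lborel. grad f x \<bullet> b)"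
  proof (rule integral_dominated_convergence[where w = "\<lambda>x. indicator K' x *\<^sub>R (B * norm b)"])
    show "(\<lambda>x. grad f x \<bullet> b) \<in> borel_measurable lborel"
      using continuous_borel[OF cg] by simp
    show "D n \<in> borel_measurable lborel" for n
      unfolding D_def using continuous_borel[OF cf] by simp
    show "integrable lborel (\<lambda>x. indicator K' x *\<^sub>R (B * norm b))"
      using K' by (intro borel_integrable_compact) auto
    have "norm (D n x) \<le> indicator K' x *\<^sub>R (B * norm b)" for n x
    proof (cases "x \<in> K'")
      case True
      have "\<bar>f (x + t n *\<^sub>R b) - f x\<bar> \<le> B * (t n * norm b)"
        using lip[of "x + t n *\<^sub>R b" x] t[of n] by simp
      then show ?thesis
        using True t[of n] by (simp add: D_def abs_divide field_simps)
    next
      case False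
      have "x \<notin> K"
        using False by (force simp: K'_def)
      moreover have "x + t n *\<^sub>R b \<notin> K"
      proof
        assume "x + t n *\<^sub>R b \<in> K"
        moreover have "- (t n *\<^sub>R b) \<in> cball 0 (norm b)"
          using t[of n] mult_right_mono[of "t n" 1 "norm b"] by simp
        ultimately have "(x + t n *\<^sub>R b) + - (t n *\<^sub>R b) \<in> K'"
          unfolding K'_def by blast
        then show False using False by simp
      qed
      ultimately show ?thesis using False K(3) by (simp add: D_def)
    qed
    then show "AE x in lborel. norm (D n x) \<le> indicator K' x *\<^sub>R (B * norm b)" for n
      by simp
    have "(\<lambda>n. D n x) \<longlonglongrightarrow> grad f x \<bullet> b" for x
    proof -
      have "((\<lambda>s. x + s *\<^sub>R b) has_derivative (\<lambda>s. s *\<^sub>R b)) (at 0)"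
        by (auto intro!: derivative_eq_intros)
      then have "((\<lambda>s. f (x + s *\<^sub>R b)) has_derivative (\<lambda>s. grad f x \<bullet> (s *\<^sub>R b))) (at 0)"
        by (rule has_derivative_compose) (use smooth_has_derivative[OF K(1)] in simp)
      moreover have "(\<lambda>s. grad f x \<bullet> (s *\<^sub>R b)) = (*) (grad f x \<bullet> b)"
        by (simp add: fun_eq_iff)
      ultimately have "((\<lambda>s. f (x + s *\<^sub>R b)) has_real_derivative grad f x \<bullet> b) (at 0)"
        unfolding has_field_derivative_def by simp
      then have "((\<lambda>s. (f (x + s *\<^sub>R b) - f x) / s) \<longlongrightarrow> grad f x \<bullet> b) (at 0)"
        by (simp add: DERIV_def)
      moreover have "filterlim t (at 0) sequentially"
        using t0 t by (auto simp: filterlim_at intro!: always_eventually less_imp_neq[symmetric])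
      ultimately show ?thesis
        unfolding D_def by (rule filterlim_compose)
    qed
    then show "AE x in lborel. (\<lambda>n. D n x) \<longlonglongrightarrow> grad f x \<bullet> b" by simp
  qed
  then show ?thesis by (simp add: D0 LIMSEQ_const_iff)
qed

lemma grad_mult:
  assumes "smooth_on f UNIV" "smooth_on g UNIV"
  shows "grad (\<lambda>x. f x * g x) x = f x *\<^sub>R grad g x + g x *\<^sub>R grad f x"
  by (rule grad_unique)
    (use has_derivative_mult[OF smooth_has_derivative[OF assms(1)] smooth_has_derivative[OF assms(2)]]
      in \<open>simp add: inner_add_left mult.commute\<close>)

text \<open>Integration by parts: the product of \<open>f\<close> with a test function has a
  gradient of integral 0, and the product rule splits this integral into the two required
  ones.\<close>

lemma has_weak_gradient_grad:
  assumes f: "f \<in> test_functions \<Omega>" and "open \<Omega>"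
  shows "has_weak_gradient \<Omega> f (grad f)"
proof -
  have \<Omega>: "\<Omega> \<in> sets lebesgue" using \<open>open \<Omega>\<close> by auto
  obtain K where K: "smooth_on f UNIV" "compact K" "K \<subseteq> \<Omega>" "\<And>x. x \<notin> K \<Longrightarrow> f x = 0" "\<And>x. x \<notin> K \<Longrightarrow> grad f x = 0"
    using f by (rule test_functionsE) blast
  have cf: "continuous_on UNIV f" and cg: "continuous_on UNIV (grad f)"
    using K smooth_continuous continuous_on_grad by auto
  have loc: "locally_integrable \<Omega> h" if h: "continuous_on UNIV h" for h :: "'a \<Rightarrow> 'c::euclidean_space"
    unfolding locally_integrable_def
  proof (intro allI impI)
    fix L assume L: "compact L \<and> L \<subseteq> \<Omega>"
    have "integrable lborel (\<lambda>x. indicator L x *\<^sub>R h x)"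
      using L h by (intro borel_integrable_compact) (auto intro: continuous_on_subset)
    then have "integrable lebesgue (\<lambda>x. indicator L x *\<^sub>R h x)"
      using integrable_completion borel_measurable_integrable by blast
    then show "integrable (lebesgue_on L) h"
      using L by (subst integrable_restrict_space) (auto intro: fmeasurableD[OF lmeasurable_compact])
  qed
  have "(LINT x|lebesgue_on \<Omega>. f x * frechet_derivative v (at x) b) = - (LINT x|lebesgue_on \<Omega>. (grad f x \<bullet> b) * v x)"
    if v: "v \<in> test_functions \<Omega>" for v b
  proof -
    have sv: "smooth_on v UNIV" using v by (simp add: test_functions_def)
    have cv: "continuous_on UNIV v" and cgv: "continuous_on UNIV (grad v)"
      using sv smooth_continuous continuous_on_grad by auto
    have "(\<lambda>x. f x * v x) \<in> test_functions UNIV"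
      by (rule test_functionsI[where K = K]) (use K sv in \<open>auto intro: smooth_mult\<close>)
    then have "0 = (LINT x|lborel. grad (\<lambda>x. f x * v x) x \<bullet> b)"
      by (simp add: integral_grad_eq_0)
    also have "\<dots> = (LINT x|lborel. f x * (grad v x \<bullet> b) + (grad f x \<bullet> b) * v x)"
      by (simp add: grad_mult[OF K(1) sv] inner_add_left mult.commute)
    also have "\<dots> = (LINT x|lborel. f x * (grad v x \<bullet> b)) + (LINT x|lborel. (grad f x \<bullet> b) * v x)"
      by (intro Bochner_Integration.integral_add integrable_compact_support[where K = K])
        (use K cf cg cv cgv in \<open>auto intro!: continuous_intros\<close>)
    also have "(LINT x|lborel. f x * (grad v x \<bullet> b)) = (LINT x|lebesgue_on \<Omega>. f x * (grad v x \<bullet> b))"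
      by (intro integral_lebesgue_on_compact_support[where K = K, symmetric])
        (use K cf cg cv cgv \<Omega> in \<open>auto intro!: continuous_intros\<close>)
    also have "(LINT x|lborel. (grad f x \<bullet> b) * v x) = (LINT x|lebesgue_on \<Omega>. (grad f x \<bullet> b) * v x)"
      by (intro integral_lebesgue_on_compact_support[where K = K, symmetric])
        (use K cf cg cv cgv \<Omega> in \<open>auto intro!: continuous_intros\<close>)
    finally show ?thesis
      using frechet_derivative_eq_grad[OF sv] by simp
  qed
  then show ?thesis
    unfolding has_weak_gradient_def using loc[OF cf] loc[OF cg] by blast
qed

lemma integrable_locally_integrable_mult:
  fixes h :: "'a::euclidean_space \<Rightarrow> real"
  assumes h: "locally_integrable \<Omega> h" and \<Omega>: "\<Omega> \<in> sets lebesgue"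
    and f: "continuous_on UNIV f" "compact K" "K \<subseteq> \<Omega>" "\<And>x. x \<notin> K \<Longrightarrow> f x = 0"
  shows "integrable (lebesgue_on \<Omega>) (\<lambda>x. h x * f x)"
proof -
  obtain B where B: "B > 0" "\<And>x. norm (f x) \<le> B"
    using continuous_compact_support_bounded[OF f(1,2,4)] by blast
  have i: "integrable (lebesgue_on K) h"
    using h f by (simp add: locally_integrable_def)
  have "integrable (lebesgue_on K) (\<lambda>x. h x * f x)"
  proof (rule Bochner_Integration.integrable_bound[where f = "\<lambda>x. B * h x"])
    show "(\<lambda>x. h x * f x) \<in> borel_measurable (lebesgue_on K)"
      using borel_measurable_integrable[OF i] continuous_measurable_lebesgue_on[OF f(1)] by simp
    show "AE x in lebesgue_on K. norm (h x * f x) \<le> norm (B * h x)"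
      using B by (intro AE_I2) (simp add: abs_mult, metis abs_ge_zero mult.commute mult_left_mono)
  qed (use i in simp)
  then show ?thesis
    using f \<Omega> by (subst integrable_lebesgue_on_support[of K]) (auto intro: lmeasurable_compact fmeasurableD)
qed

section \<open>The fundamental lemma of the calculus of variations\<close>

text \<open>The dilation by \<open>Suc n\<close> drives the exponents -1/t to 0 inside the box while
  the zero set stays the same, so the bumps tend to the indicator of the open box.\<close>

definition box_bump :: "nat \<Rightarrow> 'a::euclidean_space \<Rightarrow> 'a \<Rightarrow> 'a \<Rightarrow> real" where
  "box_bump n c d x = (\<Prod>b\<in>Basis. flat_exp 0 (real (Suc n) * (x \<bullet> b - c \<bullet> b)) *
     flat_exp 0 (real (Suc n) * (d \<bullet> b - x \<bullet> b)))"

lemma box_bump_eq_0: "x \<notin> box c d \<Longrightarrow> box_bump n c d x = 0"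
  by (force simp: box_bump_def mem_box flat_exp_def zero_less_mult_iff not_less intro!: prod_zero)

lemma box_bump_pos: "x \<in> box c d \<Longrightarrow> box_bump n c d x > 0"
  by (auto simp: box_bump_def mem_box flat_exp_def intro!: prod_pos)

lemma box_bump_le_1: "0 \<le> box_bump n c d x" "box_bump n c d x \<le> 1"
proof -
  have *: "0 \<le> flat_exp 0 t \<and> flat_exp 0 t \<le> 1" for t by (simp add: flat_exp_def)
  show "0 \<le> box_bump n c d x" "box_bump n c d x \<le> 1"
    unfolding box_bump_def using * by (auto intro!: prod_nonneg prod_le_1 mult_nonneg_nonneg mult_le_one)
qed

lemma box_bump_tendsto: "(\<lambda>n. box_bump n c d x) \<longlonglongrightarrow> indicator (box c d) x"
proof (cases "x \<in> box c d")
  case True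
  have *: "(\<lambda>n. flat_exp 0 (real (Suc n) * t)) \<longlonglongrightarrow> 1" if "t > 0" for t
  proof -
    have "(\<lambda>n. exp (- (inverse (real (Suc n)) * inverse t))) \<longlonglongrightarrow> exp (- (0 * inverse t))"
      by (intro tendsto_intros LIMSEQ_inverse_real_of_nat)
    moreover have "flat_exp 0 (real (Suc n) * t) = exp (- (inverse (real (Suc n)) * inverse t))" for n
      using that by (simp add: flat_exp_def divide_inverse)
    ultimately show ?thesis by simp
  qed
  have "(\<lambda>n. box_bump n c d x) \<longlonglongrightarrow> (\<Prod>b\<in>(Basis::'a set). 1 * 1)"
    unfolding box_bump_def using True by (intro tendsto_prod tendsto_mult *) (auto simp: mem_box)
  then show ?thesis using True by simp
next
  case False
  then show ?thesis by (simp add: box_bump_eq_0)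
qed

lemma smooth_box_bump: "smooth_on (box_bump n c d) UNIV"
proof -
  have 1: "smooth_on (\<lambda>x. real (Suc n) * (x \<bullet> b - c \<bullet> b)) UNIV" for b
    by (intro smooth_mult smooth_diff smooth_const smooth_inner)
  have 2: "smooth_on (\<lambda>x. real (Suc n) * (d \<bullet> b - x \<bullet> b)) UNIV" for b
    by (intro smooth_mult smooth_diff smooth_const smooth_inner)
  show ?thesis
    unfolding box_bump_def by (intro smooth_prod smooth_mult smooth_flat_exp 1 2 finite_Basis)
qed

lemma box_bump_test: "cbox c d \<subseteq> \<Omega> \<Longrightarrow> box_bump n c d \<in> test_functions \<Omega>"
  using box_subset_cbox[of c d]
  by (intro test_functionsI[where K = "cbox c d"] smooth_box_bump box_bump_eq_0) auto

text \<open>Open boxes form an intersection-stable generator of the Borel sets, so Dynkin's argument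
  carries the vanishing of the integrals over to all Borel sets.\<close>

lemma AE_eq_0_if_box_integrals_eq_0:
  fixes h :: "'a::euclidean_space \<Rightarrow> real"
  assumes h: "integrable lborel h" and 0: "\<And>x. x \<notin> box c d \<Longrightarrow> h x = 0"
    and box: "\<And>a b. (LINT x|lborel. indicator (box a b) x * h x) = 0"
  shows "AE x in lborel. h x = 0"
proof (rule sigma_finite_measure.density_zero[OF sigma_finite_lborel h])
  fix A :: "'a set" assume "A \<in> sets lborel"
  then have A: "A \<in> sigma_sets UNIV (range (\<lambda>(a, b). box a b))"
    using borel_eq_box by (metis sets_lborel sets_measure_of subset_UNIV top_greatest sets_measure_of_conv Pow_UNIV)
  have meas: "A \<in> sets borel" if "A \<in> sigma_sets UNIV (range (\<lambda>(a, b). box a b))" for A :: "'a set"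
    using that borel_eq_box by (metis sets_measure_of Pow_UNIV top_greatest)
  have int: "integrable lborel (\<lambda>x. indicator A x * h x)" if "A \<in> sets borel" for A
    using integrable_mult_indicator[of A lborel h] that h by simp
  have "Int_stable (range (\<lambda>(a, b). box a b :: 'a set))"
    by (auto simp: Int_stable_def box_Int_box)
  moreover have "range (\<lambda>(a, b). box a b :: 'a set) \<subseteq> Pow UNIV" by auto
  ultimately have "(LINT x|lborel. indicator A x * h x) = 0"
    using A
  proof (induction rule: sigma_sets_induct_disjoint)
    case (basic A) then show ?case using box by auto
  next
    case empty then show ?case by simp
  next
    case (compl A)
    \<comment> \<open>The whole space is not a box; since \<open>h\<close> vanishes outside
      \<open>box c d\<close>, this box takes its place when passing to complements.\<close>
    have "indicator (UNIV - A) x * h x = indicator (box c d) x * h x - indicator A x * h x" for x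
      using 0 by (auto simp: indicator_def)
    then have "(LINT x|lborel. indicator (UNIV - A) x * h x) =
        (LINT x|lborel. indicator (box c d) x * h x) - (LINT x|lborel. indicator A x * h x)"
      using int[OF meas[OF compl(1)]] int[of "box c d"] by simp
    then show ?case using box compl by simp
  next
    case (union A)
    then have A: "A i \<in> sets borel" for i using meas by auto
    have "(\<Sum>i. LINT x:A i|lborel. h x) = (LINT x:(\<Union>i. A i)|lborel. h x)"
      by (rule lebesgue_integral_countable_add[symmetric])
        (use A union h in \<open>auto simp: disjoint_family_on_def set_integrable_def
          intro!: integrable_mult_indicator[where 'b = real, simplified] int\<close>)
    then show ?case using union by (simp add: set_lebesgue_integral_def)
  qed
  then show "set_lebesgue_integral lborel A h = 0" by (simp add: set_lebesgue_integral_def)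
qed

text \<open>Bumps approximate indicators of boxes, so dominated convergence gives vanishing
  integrals over all boxes whose closed box lies in \<open>\<Omega>\<close>. This settles the matter
  on each closed box, and countably many of them cover \<open>\<Omega>\<close>.\<close>

lemma AE_eq_0_if_test_integrals_eq_0:
  fixes h :: "'a::euclidean_space \<Rightarrow> real"
  assumes h: "locally_integrable \<Omega> h" and "open \<Omega>"
    and test: "\<And>f. f \<in> test_functions \<Omega> \<Longrightarrow> (LINT x|lebesgue_on \<Omega>. h x * f x) = 0"
  shows "AE x in lebesgue_on \<Omega>. h x = 0"
proof -
  have \<Omega>: "\<Omega> \<in> sets lebesgue" using \<open>open \<Omega>\<close> by auto
  have box0: "(LINT x|lebesgue. indicator (box c d) x * h x) = 0" if cd: "cbox c d \<subseteq> \<Omega>" for c d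
  proof -
    have i: "integrable (lebesgue_on (cbox c d)) h"
      using h cd by (simp add: locally_integrable_def)
    have "(LINT x|lebesgue_on (cbox c d). h x * box_bump n c d x) = 0" for n
    proof -
      have "h x * box_bump n c d x = 0" if "x \<notin> cbox c d" for x
        using that box_bump_eq_0[of x c d n] box_subset_cbox[of c d] by auto
      then show ?thesis
        using test[OF box_bump_test[OF cd, of n]] cd \<Omega>
          integral_lebesgue_on_support[of "cbox c d" \<Omega> "\<lambda>x. h x * box_bump n c d x"] by simp
    qed
    moreover have "(\<lambda>n. LINT x|lebesgue_on (cbox c d). h x * box_bump n c d x) \<longlonglongrightarrow>
        (LINT x|lebesgue_on (cbox c d). h x * indicator (box c d) x)"
    proof (rule integral_dominated_convergence[where w = "\<lambda>x. norm (h x)"])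
      show "(\<lambda>x. h x * indicator (box c d) x) \<in> borel_measurable (lebesgue_on (cbox c d))"
        using borel_measurable_integrable[OF i]
        by (rule borel_measurable_times) (intro measurable_restrict_space1 borel_measurable_indicator, simp)
      show "(\<lambda>x. h x * box_bump n c d x) \<in> borel_measurable (lebesgue_on (cbox c d))" for n
        by (intro borel_measurable_times borel_measurable_integrable[OF i]
          continuous_measurable_lebesgue_on smooth_continuous smooth_box_bump)
      show "AE x in lebesgue_on (cbox c d). norm (h x * box_bump n c d x) \<le> norm (h x)" for n
        using box_bump_le_1[of n c d] by (auto simp: abs_mult intro!: mult_left_le)
    qed (use i in \<open>auto intro!: tendsto_intros box_bump_tendsto\<close>)
    ultimately have "(LINT x|lebesgue_on (cbox c d). h x * indicator (box c d) x) = 0"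
      by (simp add: LIMSEQ_const_iff)
    moreover have "(\<lambda>x. indicator (cbox c d) x *\<^sub>R (h x * indicator (box c d) x)) = (\<lambda>x. indicator (box c d) x * h x)"
      using box_subset_cbox[of c d] by (auto simp: indicator_def fun_eq_iff)
    ultimately show ?thesis
      using integral_restrict_space[of "cbox c d" lebesgue "\<lambda>x. h x * indicator (box c d) x"] by simp
  qed
  have cb: "AE x in lebesgue. x \<in> cbox c d \<longrightarrow> h x = 0" if cd: "cbox c d \<subseteq> \<Omega>" for c d
  proof -
    have i: "integrable (lebesgue_on (cbox c d)) h"
      using h cd by (simp add: locally_integrable_def)
    define k where "k x = indicator (box c d) x * h x" for x
    have "k = (\<lambda>x. indicator (box c d) x *\<^sub>R (indicator (cbox c d) x *\<^sub>R h x))"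
      using box_subset_cbox[of c d] by (auto simp: k_def indicator_def fun_eq_iff)
    moreover have "integrable lebesgue (\<lambda>x. indicator (cbox c d) x *\<^sub>R h x)"
      using i by (simp add: integrable_restrict_space)
    ultimately have k: "integrable lebesgue k"
      by (simp only: integrable_mult_indicator sets_completionI_sets sets_lborel borel_open open_box)
    \<comment> \<open>The function \<open>h\<close> is only Lebesgue measurable, whereas the Dynkin
      argument runs over Borel sets, so a Borel representative is taken.\<close>
    obtain k' where k': "k' \<in> borel_measurable lborel" "AE x in lborel. k x = k' x"
      using completion_ex_borel_measurable_real[of k lborel] k by blast
    have k'': "AE x in lebesgue. k x = k' x" using k' by (intro AE_completion)
    \<comment> \<open>The representative may be nonzero on a null set outside the box; cutting it
      off again makes it vanish there exactly.\<close>
    define g where "g x = indicator (box c d) x * k' x" for x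
    have g: "g \<in> borel_measurable lborel" unfolding g_def using k' by simp
    have gk: "AE x in lebesgue. g x = k x"
      using k'' by eventually_elim (auto simp: g_def k_def indicator_def)
    have kg: "integrable lebesgue g"
      using k g gk by (subst integrable_cong_AE[of g _ k]) (auto intro: measurable_completion)
    then have "integrable lborel g" using g integrable_completion by blast
    moreover have "(LINT x|lborel. indicator (box a b) x * g x) = 0" for a b
    proof -
      obtain a' b' where ab: "box a b \<inter> box c d = box a' b'" using box_Int_box[of a b c d] by blast
      have "(LINT x|lborel. indicator (box a b) x * g x) = (LINT x|lebesgue. indicator (box a b) x * g x)"
        using g by (intro integral_completion[symmetric]) simp
      also have "\<dots> = (LINT x|lebesgue. indicator (box a' b') x * h x)"
      proof (rule integral_cong_AE)
        have *: "indicator (box a' b') x * h x = indicator (box a b) x * k x" for x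
          using ab by (auto simp: k_def indicator_def)
        show "(\<lambda>x. indicator (box a' b') x * h x) \<in> borel_measurable lebesgue"
          unfolding * using borel_measurable_integrable[OF k] by (intro borel_measurable_times borel_measurable_indicator) auto
        show "AE x in lebesgue. indicator (box a b) x * g x = indicator (box a' b') x * h x"
          unfolding * using gk by eventually_elim simp
        show "(\<lambda>x. indicator (box a b) x * g x) \<in> borel_measurable lebesgue"
          using borel_measurable_integrable[OF kg] by (intro borel_measurable_times borel_measurable_indicator) auto
      qed
      also have "\<dots> = 0"
      \<comment> \<open>Only for a nonempty box is \<open>cbox a' b'\<close> its closure, and hence
        contained in \<open>cbox c d\<close>.\<close>
      proof (cases "box a' b' = {}")
        case False
        have "box a' b' \<subseteq> box c d" using ab by auto
        then have "cbox a' b' \<subseteq> cbox c d"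
          using False by (metis closure_box closure_mono empty_subsetI subset_empty)
        then show ?thesis using box0 cd by blast
      qed simp
      finally show ?thesis .
    qed
    ultimately have "AE x in lborel. g x = 0"
      by (intro AE_eq_0_if_box_integrals_eq_0[of g c d]) (auto simp: g_def)
    then have "AE x in lebesgue. g x = 0" by (rule AE_completion)
    \<comment> \<open>The integrals over boxes only see the open box; its frontier is null.\<close>
    moreover have "AE x in lebesgue. x \<notin> cbox c d - box c d"
      using negligible_frontier_interval[of c d] by (intro AE_not_in) (simp add: negligible_iff_null_sets)
    ultimately show ?thesis
      using gk by eventually_elim (auto simp: k_def)
  qed
  obtain \<D> where D: "countable \<D>" "\<D> \<subseteq> Pow \<Omega>" "\<And>X. X \<in> \<D> \<Longrightarrow> \<exists>a b. X = cbox a b" "\<Union>\<D> = \<Omega>"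
    using open_countable_Union_open_cbox[OF \<open>open \<Omega>\<close>] by metis
  have "AE x in lebesgue. x \<in> X \<longrightarrow> h x = 0" if "X \<in> \<D>" for X
    using D(2) D(3)[OF that] cb that by blast
  then have "AE x in lebesgue. \<forall>X\<in>\<D>. x \<in> X \<longrightarrow> h x = 0"
    using D(1) by (subst AE_ball_countable) auto
  then have "AE x in lebesgue. x \<in> \<Omega> \<longrightarrow> h x = 0"
    by eventually_elim (use D(4) in blast)
  then show ?thesis
    using \<Omega> by (subst AE_restrict_space_iff) auto
qed

section \<open>Linearity and uniqueness of weak gradients\<close>

lemma locally_integrable_linear:
  fixes f g :: "'a::euclidean_space \<Rightarrow> 'b::euclidean_space"
  assumes "locally_integrable \<Omega> f" "locally_integrable \<Omega> g"
  shows "locally_integrable \<Omega> (\<lambda>x. c *\<^sub>R f x + d *\<^sub>R g x)"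
  using assms by (auto simp: locally_integrable_def)

lemma locally_integrable_inner:
  "locally_integrable \<Omega> f \<Longrightarrow> locally_integrable \<Omega> (\<lambda>x. f x \<bullet> b)"
  by (auto simp: locally_integrable_def)

lemma has_weak_gradient_linear:
  assumes u: "has_weak_gradient \<Omega> u g" and v: "has_weak_gradient \<Omega> v h" and "open \<Omega>"
  shows "has_weak_gradient \<Omega> (\<lambda>x. c * u x + d * v x) (\<lambda>x. c *\<^sub>R g x + d *\<^sub>R h x)"
proof -
  have \<Omega>: "\<Omega> \<in> sets lebesgue" using \<open>open \<Omega>\<close> by auto
  have l: "locally_integrable \<Omega> u" "locally_integrable \<Omega> v" "locally_integrable \<Omega> g" "locally_integrable \<Omega> h"
    using u v by (auto simp: has_weak_gradient_def)
  have "(LINT x|lebesgue_on \<Omega>. (c * u x + d * v x) * frechet_derivative f (at x) b) =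
      - (LINT x|lebesgue_on \<Omega>. ((c *\<^sub>R g x + d *\<^sub>R h x) \<bullet> b) * f x)"
    if f: "f \<in> test_functions \<Omega>" and b: "b \<in> Basis" for f b
  proof -
    obtain K where K: "smooth_on f UNIV" "compact K" "K \<subseteq> \<Omega>" "\<And>x. x \<notin> K \<Longrightarrow> f x = 0" "\<And>x. x \<notin> K \<Longrightarrow> grad f x = 0"
      using f by (rule test_functionsE) blast
    have cf: "continuous_on UNIV f" and cg: "continuous_on UNIV (\<lambda>x. grad f x \<bullet> b)"
      using K smooth_continuous continuous_on_grad by (auto intro!: continuous_intros)
    have fr: "frechet_derivative f (at x) b = grad f x \<bullet> b" for x
      using frechet_derivative_eq_grad[OF K(1)] .
    have i: "integrable (lebesgue_on \<Omega>) (\<lambda>x. w x * (grad f x \<bullet> b))"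
      "integrable (lebesgue_on \<Omega>) (\<lambda>x. w x * f x)" if "locally_integrable \<Omega> w" for w
      using integrable_locally_integrable_mult[OF that \<Omega> cf K(2,3,4)]
        integrable_locally_integrable_mult[OF that \<Omega> cg K(2,3)] K(5) by auto
    have eq: "(LINT x|lebesgue_on \<Omega>. u x * (grad f x \<bullet> b)) = - (LINT x|lebesgue_on \<Omega>. (g x \<bullet> b) * f x)"
      "(LINT x|lebesgue_on \<Omega>. v x * (grad f x \<bullet> b)) = - (LINT x|lebesgue_on \<Omega>. (h x \<bullet> b) * f x)"
      using u v f b unfolding has_weak_gradient_def fr[symmetric] by blast+
    have "(LINT x|lebesgue_on \<Omega>. (c * u x + d * v x) * (grad f x \<bullet> b)) =
        (LINT x|lebesgue_on \<Omega>. c * (u x * (grad f x \<bullet> b)) + d * (v x * (grad f x \<bullet> b)))"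
      by (simp add: algebra_simps)
    also have "\<dots> = - (c * (LINT x|lebesgue_on \<Omega>. (g x \<bullet> b) * f x) + d * (LINT x|lebesgue_on \<Omega>. (h x \<bullet> b) * f x))"
      using i(1)[OF l(1)] i(1)[OF l(2)] eq by simp
    also have "\<dots> = - (LINT x|lebesgue_on \<Omega>. c * ((g x \<bullet> b) * f x) + d * ((h x \<bullet> b) * f x))"
      using i(2)[OF locally_integrable_inner[OF l(3)]] i(2)[OF locally_integrable_inner[OF l(4)]] by simp
    finally show ?thesis
      by (simp add: fr algebra_simps)
  qed
  moreover have "locally_integrable \<Omega> (\<lambda>x. c * u x + d * v x)"
    using locally_integrable_linear[OF l(1,2), of c d] by simp
  ultimately show ?thesis
    using locally_integrable_linear[OF l(3,4), of c d] by (simp add: has_weak_gradient_def)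
qed

text \<open>By linearity \<open>g - h\<close> is a weak gradient of 0, so each coordinate has
  integral 0 against every test function. This is what allows \<open>weak_gradient\<close> to be
  replaced by any known weak gradient.\<close>

lemma has_weak_gradient_unique:
  assumes g: "has_weak_gradient \<Omega> u g" and h: "has_weak_gradient \<Omega> u h" and "open \<Omega>"
  shows "AE x in lebesgue_on \<Omega>. g x = h x"
proof -
  have z: "has_weak_gradient \<Omega> (\<lambda>x. 0) (\<lambda>x. g x - h x)"
    using has_weak_gradient_linear[OF g h \<open>open \<Omega>\<close>, of 1 "- 1"] by simp
  have "AE x in lebesgue_on \<Omega>. (g x - h x) \<bullet> b = 0" if "b \<in> Basis" for b
    by (rule AE_eq_0_if_test_integrals_eq_0) (use z that \<open>open \<Omega>\<close> in \<open>auto simp: has_weak_gradient_def intro: locally_integrable_inner\<close>)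
  then have "AE x in lebesgue_on \<Omega>. \<forall>b\<in>Basis. (g x - h x) \<bullet> b = 0"
    by (simp add: AE_ball_countable countable_finite)
  then show ?thesis
    by eventually_elim (rule euclidean_eqI, simp add: inner_diff_left)
qed

lemma weak_gradient_AE:
  assumes "has_weak_gradient \<Omega> u g" "open \<Omega>"
  shows "AE x in lebesgue_on \<Omega>. weak_gradient \<Omega> u x = g x"
  using assms unfolding weak_gradient_def by (metis has_weak_gradient_unique someI)

section \<open>Modulars and approximation by test functions\<close>

lemma powr_add_le:
  fixes a b p P :: real
  assumes "0 \<le> a" "0 \<le> b" "1 \<le> p" "p \<le> P"
  shows "(a + b) powr p \<le> 2 powr P * (a powr p + b powr p)"
proof -
  have "(a + b) powr p \<le> (2 * max a b) powr p"
    using assms by (intro powr_mono2) auto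
  also have "\<dots> = 2 powr p * max a b powr p"
    using assms by (simp add: powr_mult)
  also have "\<dots> \<le> 2 powr P * (a powr p + b powr p)"
    using assms by (intro mult_mono powr_mono) (auto simp: max_def)
  finally show ?thesis .
qed

locale exponent_domain =
  fixes \<Omega> :: "'a::euclidean_space set" and p :: "'a \<Rightarrow> real" and P :: real
  assumes open_domain: "open \<Omega>" and bounded_domain: "bounded \<Omega>"
    and p_measurable [measurable]: "p \<in> borel_measurable (lebesgue_on \<Omega>)"
    and p_bounds: "\<And>x. x \<in> \<Omega> \<Longrightarrow> 1 \<le> p x \<and> p x \<le> P"
begin

abbreviation "M \<equiv> lebesgue_on \<Omega>"

lemma domain_sets [simp]: "\<Omega> \<in> sets lebesgue"
  using open_domain by auto

lemma finite_measure_M: "finite_measure M"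
  using open_domain bounded_domain
  by (intro finite_measure_lebesgue_on bounded_set_imp_lmeasurable) auto

lemma integrable_bounded:
  fixes f :: "'a \<Rightarrow> real"
  assumes "f \<in> borel_measurable M" "\<And>x. x \<in> \<Omega> \<Longrightarrow> \<bar>f x\<bar> \<le> B"
  shows "integrable M f"
proof -
  interpret finite_measure M by (rule finite_measure_M)
  show ?thesis
    by (rule integrable_const_bound[of _ B]) (use assms in auto)
qed

section \<open>Modulars and the Luxemburg norm\<close>

lemma modular_cong_AE: "AE x in M. norm (f x) = norm (g x) \<Longrightarrow> modular \<Omega> r f = modular \<Omega> r g"
  unfolding modular_def by (rule nn_integral_cong_AE) auto

lemma luxemburg_norm_cong_AE:
  assumes "AE x in M. norm (f x) = norm (g x)"
  shows "luxemburg_norm \<Omega> r f = luxemburg_norm \<Omega> r g"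
proof -
  have "modular \<Omega> r (\<lambda>x. f x /\<^sub>R c) = modular \<Omega> r (\<lambda>x. g x /\<^sub>R c)" for c
    by (rule modular_cong_AE) (use assms in \<open>eventually_elim, simp\<close>)
  then show ?thesis by (simp add: luxemburg_norm_def)
qed

lemma luxemburg_norm_0:
  assumes "AE x in M. f x = 0"
  shows "luxemburg_norm \<Omega> r f = 0"
proof -
  have "modular \<Omega> r (\<lambda>x. f x /\<^sub>R c) = 0" for c
    unfolding modular_def
    by (subst nn_integral_cong_AE[where v = "\<lambda>x. 0"]) (use assms in \<open>auto elim: eventually_mono\<close>)
  then have "luxemburg_norm \<Omega> r f = Inf {0<..}"
    by (simp add: luxemburg_norm_def greaterThan_def)
  then show ?thesis by simp
qed

lemma modular_divide_le:
  fixes f :: "'a \<Rightarrow> 'b::euclidean_space"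
  assumes "1 \<le> c" and [measurable]: "f \<in> borel_measurable M"
  shows "modular \<Omega> p (\<lambda>x. f x /\<^sub>R c) \<le> ennreal (1 / c) * modular \<Omega> p f"
proof -
  have "modular \<Omega> p (\<lambda>x. f x /\<^sub>R c) \<le> (\<integral>\<^sup>+ x. ennreal (1 / c) * ennreal (norm (f x) powr p x) \<partial>M)"
    unfolding modular_def
  proof (rule nn_integral_mono)
    fix x assume "x \<in> space M"
    then have x: "1 \<le> p x" using p_bounds by simp
    have "c powr 1 \<le> c powr p x" using assms x by (intro powr_mono) auto
    then have "c \<le> c powr p x" using assms by simp
    then have "norm (f x) powr p x / c powr p x \<le> norm (f x) powr p x / c"
      using assms by (intro divide_left_mono) auto
    then have "norm (f x /\<^sub>R c) powr p x \<le> 1 / c * norm (f x) powr p x"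
      using assms by (simp add: powr_divide divide_inverse[symmetric] abs_of_pos mult.commute inverse_eq_divide powr_mult)
    then show "ennreal (norm (f x /\<^sub>R c) powr p x) \<le> ennreal (1 / c) * ennreal (norm (f x) powr p x)"
      using assms by (simp add: ennreal_mult[symmetric] ennreal_leI)
  qed
  also have "\<dots> = ennreal (1 / c) * modular \<Omega> p f"
    unfolding modular_def by (rule nn_integral_cmult) measurable
  finally show ?thesis .
qed

text \<open>The norm is a real \<open>Inf\<close>, which carries information only over a nonempty
  set. A divisor \<open>c >= 1\<close> shrinks the modular at least by the factor
  \<open>1 / c\<close> because \<open>p >= 1\<close>.\<close>

lemma luxemburg_set_nonempty:
  fixes f :: "'a \<Rightarrow> 'b::euclidean_space"
  assumes "f \<in> var_Lebesgue \<Omega> p"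
  shows "{c. 0 < c \<and> modular \<Omega> p (\<lambda>x. f x /\<^sub>R c) \<le> 1} \<noteq> {}"
proof -
  have f: "f \<in> borel_measurable M" "modular \<Omega> p f < \<infinity>"
    using assms by (auto simp: var_Lebesgue_def)
  define m where "m = enn2real (modular \<Omega> p f)"
  have m: "modular \<Omega> p f = ennreal m" "m \<ge> 0"
    using f(2) by (auto simp: m_def)
  define c where "c = max 1 m"
  have "modular \<Omega> p (\<lambda>x. f x /\<^sub>R c) \<le> ennreal (1 / c) * ennreal m"
    using modular_divide_le[of c f] f m by (simp add: c_def)
  also have "\<dots> = ennreal (m / c)" using m by (simp add: ennreal_mult[symmetric] c_def)
  also have "m / c \<le> 1" by (simp add: c_def divide_le_eq max_def)
  then have "ennreal (m / c) \<le> 1" by simp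
  finally have "modular \<Omega> p (\<lambda>x. f x /\<^sub>R c) \<le> 1" .
  moreover have "0 < c" by (simp add: c_def)
  ultimately show ?thesis by blast
qed

lemma luxemburg_norm_nonneg:
  fixes f :: "'a \<Rightarrow> 'b::euclidean_space"
  assumes "f \<in> var_Lebesgue \<Omega> p"
  shows "0 \<le> luxemburg_norm \<Omega> p f"
  unfolding luxemburg_norm_def
  by (rule cInf_greatest[OF luxemburg_set_nonempty[OF assms]]) auto

text \<open>An admissible \<open>c < e\<close> is at most 1, so \<open>c powr p x <= c\<close>;
  pulling \<open>c\<close> out of the modular leaves a modular bounded by 1.\<close>

lemma modular_le_luxemburg_norm:
  fixes f :: "'a \<Rightarrow> 'b::euclidean_space"
  assumes f: "f \<in> var_Lebesgue \<Omega> p" and e: "luxemburg_norm \<Omega> p f < e" "e \<le> 1"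
  shows "modular \<Omega> p f \<le> ennreal e"
proof -
  have [measurable]: "f \<in> borel_measurable M"
    using f by (auto simp: var_Lebesgue_def)
  obtain c where c: "0 < c" "modular \<Omega> p (\<lambda>x. f x /\<^sub>R c) \<le> 1" "c < e"
    using cInf_lessD[OF luxemburg_set_nonempty[OF f]] e unfolding luxemburg_norm_def by blast
  have "modular \<Omega> p f \<le> (\<integral>\<^sup>+ x. ennreal c * ennreal (norm (f x /\<^sub>R c) powr p x) \<partial>M)"
    unfolding modular_def
  proof (rule nn_integral_mono)
    fix x assume "x \<in> space M"
    then have x: "1 \<le> p x" using p_bounds by simp
    have "c powr p x \<le> c powr 1" using c e x by (intro powr_mono') auto
    then have "c powr p x \<le> c" using c by simp
    then have "c powr p x * norm (f x /\<^sub>R c) powr p x \<le> c * norm (f x /\<^sub>R c) powr p x"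
      by (rule mult_right_mono) simp
    moreover have "c powr p x * norm (f x /\<^sub>R c) powr p x = norm (f x) powr p x"
      using c by (simp add: powr_mult[symmetric] mult.assoc[symmetric])
    ultimately show "ennreal (norm (f x) powr p x) \<le> ennreal c * ennreal (norm (f x /\<^sub>R c) powr p x)"
      using c by (simp add: ennreal_mult[symmetric] ennreal_leI)
  qed
  also have "\<dots> = ennreal c * modular \<Omega> p (\<lambda>x. f x /\<^sub>R c)"
    unfolding modular_def by (rule nn_integral_cmult) measurable
  also have "\<dots> \<le> ennreal c * 1" by (rule mult_left_mono) (use c in auto)
  also have "\<dots> \<le> ennreal e" using c by (simp add: ennreal_leI)
  finally show ?thesis .
qed

lemma integrable_powr:
  fixes f :: "'a \<Rightarrow> 'b::euclidean_space"
  assumes "f \<in> var_Lebesgue \<Omega> p"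
  shows "integrable M (\<lambda>x. norm (f x) powr p x)"
proof -
  have [measurable]: "f \<in> borel_measurable M" and "modular \<Omega> p f < \<infinity>"
    using assms by (auto simp: var_Lebesgue_def)
  then show ?thesis
    by (intro integrableI_bounded) (auto simp: modular_def)
qed

lemma var_LebesgueI:
  fixes f :: "'a \<Rightarrow> 'b::euclidean_space"
  assumes "f \<in> borel_measurable M" "integrable M (\<lambda>x. norm (f x) powr p x)"
  shows "f \<in> var_Lebesgue \<Omega> p"
  using assms by (auto simp: var_Lebesgue_def modular_def integrable_iff_bounded)

lemma var_Lebesgue_diff:
  fixes f g :: "'a \<Rightarrow> 'b::euclidean_space"
  assumes f: "f \<in> var_Lebesgue \<Omega> p" and g: "g \<in> var_Lebesgue \<Omega> p"
  shows "(\<lambda>x. f x - g x) \<in> var_Lebesgue \<Omega> p"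
proof (rule var_LebesgueI)
  have [measurable]: "f \<in> borel_measurable M" "g \<in> borel_measurable M"
    using f g by (auto simp: var_Lebesgue_def)
  show "(\<lambda>x. f x - g x) \<in> borel_measurable M" by measurable
  show "integrable M (\<lambda>x. norm (f x - g x) powr p x)"
  proof (rule Bochner_Integration.integrable_bound)
    show "integrable M (\<lambda>x. 2 powr P * (norm (f x) powr p x + norm (g x) powr p x))"
      using integrable_powr[OF f] integrable_powr[OF g] by simp
    show "AE x in M. norm (norm (f x - g x) powr p x) \<le> norm (2 powr P * (norm (f x) powr p x + norm (g x) powr p x))"
    proof (rule AE_I2)
      fix x assume "x \<in> space M"
      then have "1 \<le> p x" "p x \<le> P" using p_bounds by auto
      moreover from this have "norm (f x - g x) powr p x \<le> (norm (f x) + norm (g x)) powr p x"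
        by (intro powr_mono2 norm_triangle_ineq4) auto
      ultimately show "norm (norm (f x - g x) powr p x) \<le> norm (2 powr P * (norm (f x) powr p x + norm (g x) powr p x))"
        using powr_add_le[of "norm (f x)" "norm (g x)" "p x" P] by simp
    qed
  qed measurable
qed

lemma var_Lebesgue_bounded:
  fixes f :: "'a \<Rightarrow> 'b::euclidean_space"
  assumes [measurable]: "f \<in> borel_measurable M" and B: "\<And>x. x \<in> \<Omega> \<Longrightarrow> norm (f x) \<le> B"
  shows "f \<in> var_Lebesgue \<Omega> p"
proof (rule var_LebesgueI)
  show "integrable M (\<lambda>x. norm (f x) powr p x)"
  proof (rule integrable_bounded)
    fix x assume x: "x \<in> \<Omega>"
    have "norm (f x) powr p x \<le> (max 1 B) powr p x"
      using B[OF x] p_bounds[OF x] by (intro powr_mono2) auto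
    also have "\<dots> \<le> (max 1 B) powr P"
      using p_bounds[OF x] by (intro powr_mono) auto
    finally show "\<bar>norm (f x) powr p x\<bar> \<le> (max 1 B) powr P" by simp
  qed measurable
qed fact

section \<open>Test functions and Sobolev functions\<close>

lemma test_function_bounded:
  assumes f: "f \<in> test_functions \<Omega>"
  shows "f \<in> borel_measurable M" "grad f \<in> borel_measurable M" "\<exists>B. \<forall>x. \<bar>f x\<bar> \<le> B" "\<exists>B. \<forall>x. norm (grad f x) \<le> B"
proof -
  obtain K where K: "smooth_on f UNIV" "compact K" "\<And>x. x \<notin> K \<Longrightarrow> f x = 0" "\<And>x. x \<notin> K \<Longrightarrow> grad f x = 0"
    using f by (rule test_functionsE) blast
  note c = smooth_continuous[OF K(1)] continuous_on_grad[OF K(1)]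
  show "f \<in> borel_measurable M" "grad f \<in> borel_measurable M"
    using c by (auto intro: continuous_measurable_lebesgue_on)
  show "\<exists>B. \<forall>x. \<bar>f x\<bar> \<le> B" "\<exists>B. \<forall>x. norm (grad f x) \<le> B"
    using continuous_compact_support_bounded[OF c(1) K(2,3)] continuous_compact_support_bounded[OF c(2) K(2,4)]
    by (metis real_norm_def)+
qed

lemma test_function_var_Lebesgue:
  assumes f: "f \<in> test_functions \<Omega>"
  shows "f \<in> var_Lebesgue \<Omega> p" "grad f \<in> var_Lebesgue \<Omega> p"
  using test_function_bounded[OF f] var_Lebesgue_bounded[of f] var_Lebesgue_bounded[of "grad f"] by auto

text \<open>Local integrability gives measurability on each compact subset, and countably many
  closed boxes cover \<open>\<Omega>\<close>.\<close>

lemma locally_integrable_measurable: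
  fixes g :: "'a \<Rightarrow> 'b::euclidean_space"
  assumes "locally_integrable \<Omega> g"
  shows "g \<in> borel_measurable M"
proof -
  obtain \<D> where D: "countable \<D>" "\<D> \<subseteq> Pow \<Omega>" "\<And>X. X \<in> \<D> \<Longrightarrow> \<exists>a b. X = cbox a b" "\<Union>\<D> = \<Omega>"
    using open_countable_Union_open_cbox[OF open_domain] by metis
  show ?thesis
  proof (rule measurable_piecewise_restrict[OF D(1)])
    show "X \<inter> space M \<in> sets M" if "X \<in> \<D>" for X
      using D(2) D(3)[OF that] that by (auto simp: sets_restrict_space intro!: image_eqI[of _ _ X])
    show "space M \<subseteq> \<Union> \<D>" using D by simp
    show "g \<in> borel_measurable (restrict_space M X)" if X: "X \<in> \<D>" for X
    proof -
      have "X \<subseteq> \<Omega>" "compact X" using D(2) D(3)[OF X] X by auto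
      then have "integrable (lebesgue_on X) g"
        using assms by (simp add: locally_integrable_def)
      moreover have "restrict_space M X = lebesgue_on X"
        using \<open>X \<subseteq> \<Omega>\<close> D(3)[OF X] by (subst restrict_restrict_space) (auto simp: Int_absorb1)
      ultimately show ?thesis using borel_measurable_integrable by simp
    qed
  qed
qed

text \<open>The chosen weak gradient need not be \<open>g\<close>: it inherits the modular by a.e.
  equality, and its measurability comes from its own local integrability.\<close>

lemma weak_gradient_var_Lebesgue:
  assumes g: "has_weak_gradient \<Omega> u g" "g \<in> var_Lebesgue \<Omega> p"
  shows "weak_gradient \<Omega> u \<in> var_Lebesgue \<Omega> p"
proof -
  have "has_weak_gradient \<Omega> u (weak_gradient \<Omega> u)"
    using g(1) unfolding weak_gradient_def by (rule someI[of "has_weak_gradient \<Omega> u" g])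
  then have "weak_gradient \<Omega> u \<in> borel_measurable M"
    by (auto simp: has_weak_gradient_def intro: locally_integrable_measurable)
  moreover have "modular \<Omega> p (weak_gradient \<Omega> u) = modular \<Omega> p g"
    by (rule modular_cong_AE) (use weak_gradient_AE[OF g(1) open_domain] in \<open>auto elim: eventually_mono\<close>)
  ultimately show ?thesis using g(2) by (simp add: var_Lebesgue_def)
qed

lemma var_SobolevD:
  assumes "u \<in> var_Sobolev \<Omega> p"
  shows "u \<in> var_Lebesgue \<Omega> p" "has_weak_gradient \<Omega> u (weak_gradient \<Omega> u)" "weak_gradient \<Omega> u \<in> var_Lebesgue \<Omega> p"
proof -
  obtain g where g: "has_weak_gradient \<Omega> u g" "g \<in> var_Lebesgue \<Omega> p"
    using assms by (auto simp: var_Sobolev_def)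
  then show "has_weak_gradient \<Omega> u (weak_gradient \<Omega> u)"
    unfolding weak_gradient_def by (intro someI[of "has_weak_gradient \<Omega> u" g])
  show "weak_gradient \<Omega> u \<in> var_Lebesgue \<Omega> p"
    using g by (rule weak_gradient_var_Lebesgue)
  show "u \<in> var_Lebesgue \<Omega> p" using assms by (simp add: var_Sobolev_def)
qed

lemma test_function_var_Sobolev0:
  assumes f: "f \<in> test_functions \<Omega>"
  shows "f \<in> var_Sobolev0 \<Omega> p" "AE x in M. weak_gradient \<Omega> f x = grad f x"
proof -
  have w: "has_weak_gradient \<Omega> f (grad f)"
    using has_weak_gradient_grad[OF f open_domain] .
  then show "AE x in M. weak_gradient \<Omega> f x = grad f x"
    using weak_gradient_AE open_domain by blast
  \<comment> \<open>The combination with both coefficients 0 yields a weak gradient of the zero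
    function; the chosen one is then 0 almost everywhere.\<close>
  have "has_weak_gradient \<Omega> (\<lambda>x. 0) (\<lambda>x. 0)"
    using has_weak_gradient_linear[OF w w open_domain, of 0 0] by simp
  then have "AE x in M. weak_gradient \<Omega> (\<lambda>x. 0) x = 0"
    using weak_gradient_AE open_domain by blast
  then have "Sobolev_norm \<Omega> p (\<lambda>x. f x - f x) = 0"
    by (simp add: Sobolev_norm_def luxemburg_norm_0)
  then show "f \<in> var_Sobolev0 \<Omega> p"
    using f w test_function_var_Lebesgue[OF f] by (auto simp: var_Sobolev0_def var_Sobolev_def intro!: bexI[of _ f])
qed

lemma var_Sobolev0_uminus:
  assumes u: "u \<in> var_Sobolev0 \<Omega> p"
  shows "(\<lambda>x. - u x) \<in> var_Sobolev0 \<Omega> p" "AE x in M. weak_gradient \<Omega> (\<lambda>x. - u x) x = - weak_gradient \<Omega> u x"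
proof -
  have uS: "u \<in> var_Sobolev \<Omega> p" using u by (simp add: var_Sobolev0_def)
  note uD = var_SobolevD[OF uS]
  have neg: "has_weak_gradient \<Omega> (\<lambda>x. - v x) (\<lambda>x. - g x)" if "has_weak_gradient \<Omega> v g" for v g
    using has_weak_gradient_linear[OF that that open_domain, of "- 1" 0] by simp
  show "AE x in M. weak_gradient \<Omega> (\<lambda>x. - u x) x = - weak_gradient \<Omega> u x"
    using weak_gradient_AE[OF neg[OF uD(2)] open_domain] .
  \<comment> \<open>One copy serves for the values of \<open>u\<close>, the other for those of its
    gradient.\<close>
  have 0: "(\<lambda>x. 0) \<in> var_Lebesgue \<Omega> p" "(\<lambda>x. 0) \<in> var_Lebesgue \<Omega> p"
    by (auto intro!: var_Lebesgue_bounded[where B = 0])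
  have "\<exists>f\<in>test_functions \<Omega>. Sobolev_norm \<Omega> p (\<lambda>x. - u x - f x) < e" if e: "e > 0" for e
  proof -
    obtain f where f: "f \<in> test_functions \<Omega>" "Sobolev_norm \<Omega> p (\<lambda>x. u x - f x) < e"
      using u e unfolding var_Sobolev0_def by blast
    have f': "(\<lambda>x. - f x) \<in> test_functions \<Omega>"
      using f(1) smooth_diff[OF smooth_const[of 0], of f] by (simp add: test_functions_def)
    have w: "has_weak_gradient \<Omega> (\<lambda>x. u x - f x) (\<lambda>x. weak_gradient \<Omega> u x - grad f x)"
      using has_weak_gradient_linear[OF uD(2) has_weak_gradient_grad[OF f(1) open_domain] open_domain, of 1 "- 1"] by simp
    have "AE x in M. weak_gradient \<Omega> (\<lambda>x. - (u x - f x)) x = - weak_gradient \<Omega> (\<lambda>x. u x - f x) x"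
      using weak_gradient_AE[OF w open_domain] weak_gradient_AE[OF neg[OF w] open_domain] by eventually_elim simp
    then have "luxemburg_norm \<Omega> p (weak_gradient \<Omega> (\<lambda>x. - (u x - f x))) = luxemburg_norm \<Omega> p (weak_gradient \<Omega> (\<lambda>x. u x - f x))"
      by (intro luxemburg_norm_cong_AE) (auto elim: eventually_mono)
    moreover have "luxemburg_norm \<Omega> p (\<lambda>x. - (u x - f x)) = luxemburg_norm \<Omega> p (\<lambda>x. u x - f x)"
      by (intro luxemburg_norm_cong_AE AE_I2) (rule norm_minus_cancel)
    ultimately have "Sobolev_norm \<Omega> p (\<lambda>x. - (u x - f x)) < e"
      using f(2) by (simp only: Sobolev_norm_def)
    moreover have "(\<lambda>x. - (u x - f x)) = (\<lambda>x. - u x - - f x)" by auto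
    ultimately show ?thesis using f' by metis
  qed
  moreover have "(\<lambda>x. - u x) \<in> var_Sobolev \<Omega> p"
    using neg[OF uD(2)] var_Lebesgue_diff[OF 0(1) uD(1)] var_Lebesgue_diff[OF 0(2) uD(3)]
    by (auto simp: var_Sobolev_def)
  ultimately show "(\<lambda>x. - u x) \<in> var_Sobolev0 \<Omega> p" by (simp add: var_Sobolev0_def)
qed

text \<open>Density in norm is restated in terms of modulars, which are integrals and can therefore
  be summed along a sequence.\<close>

lemma var_Sobolev0_approx:
  assumes u: "u \<in> var_Sobolev0 \<Omega> p" and e: "0 < e" "e \<le> 1"
  obtains f where "f \<in> test_functions \<Omega>" "modular \<Omega> p (\<lambda>x. f x - u x) \<le> ennreal e"
    "modular \<Omega> p (\<lambda>x. grad f x - weak_gradient \<Omega> u x) \<le> ennreal e"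
proof -
  have uS: "u \<in> var_Sobolev \<Omega> p" using u by (simp add: var_Sobolev0_def)
  note uD = var_SobolevD[OF uS]
  obtain f where f: "f \<in> test_functions \<Omega>" "Sobolev_norm \<Omega> p (\<lambda>x. u x - f x) < e"
    using u e unfolding var_Sobolev0_def by blast
  note fL = test_function_var_Lebesgue[OF f(1)]
  have w: "has_weak_gradient \<Omega> (\<lambda>x. u x - f x) (\<lambda>x. weak_gradient \<Omega> u x - grad f x)"
    using has_weak_gradient_linear[OF uD(2) has_weak_gradient_grad[OF f(1) open_domain] open_domain, of 1 "- 1"] by simp
  have l1: "(\<lambda>x. u x - f x) \<in> var_Lebesgue \<Omega> p" by (rule var_Lebesgue_diff[OF uD(1) fL(1)])
  have l2: "weak_gradient \<Omega> (\<lambda>x. u x - f x) \<in> var_Lebesgue \<Omega> p"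
    by (rule weak_gradient_var_Lebesgue[OF w var_Lebesgue_diff[OF uD(3) fL(2)]])
  have "luxemburg_norm \<Omega> p (\<lambda>x. u x - f x) < e" "luxemburg_norm \<Omega> p (weak_gradient \<Omega> (\<lambda>x. u x - f x)) < e"
    using f(2) luxemburg_norm_nonneg[OF l1] luxemburg_norm_nonneg[OF l2] by (auto simp: Sobolev_norm_def)
  then have m: "modular \<Omega> p (\<lambda>x. u x - f x) \<le> ennreal e" "modular \<Omega> p (weak_gradient \<Omega> (\<lambda>x. u x - f x)) \<le> ennreal e"
    using modular_le_luxemburg_norm l1 l2 e by blast+
  have "modular \<Omega> p (\<lambda>x. f x - u x) = modular \<Omega> p (\<lambda>x. u x - f x)"
    by (rule modular_cong_AE) (simp add: norm_minus_commute)
  moreover have "modular \<Omega> p (\<lambda>x. grad f x - weak_gradient \<Omega> u x) = modular \<Omega> p (weak_gradient \<Omega> (\<lambda>x. u x - f x))"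
    by (rule modular_cong_AE)
      (use weak_gradient_AE[OF w open_domain] in \<open>eventually_elim, simp add: norm_minus_commute\<close>)
  ultimately show thesis using that f(1) m by metis
qed

text \<open>Summability of the modulars gives both a.e. convergence and a majorant.\<close>

lemma modular_summable_dominated:
  fixes h :: "nat \<Rightarrow> 'a \<Rightarrow> 'b::euclidean_space"
  assumes [measurable]: "\<And>n. h n \<in> borel_measurable M"
    and m: "\<And>n. modular \<Omega> p (h n) \<le> ennreal ((1 / 2) ^ n)"
  obtains H :: "'a \<Rightarrow> real" where "integrable M H" "AE x in M. \<forall>n. norm (h n x) powr p x \<le> H x"
    "AE x in M. (\<lambda>n. h n x) \<longlonglongrightarrow> 0"
proof -
  define S where "S x = (\<Sum>n. ennreal (norm (h n x) powr p x))" for x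
  have [measurable]: "S \<in> borel_measurable M" unfolding S_def by measurable
  have "(\<integral>\<^sup>+ x. S x \<partial>M) = (\<Sum>n. modular \<Omega> p (h n))"
    unfolding S_def modular_def by (rule nn_integral_suminf) measurable
  also have "\<dots> \<le> (\<Sum>n. ennreal ((1 / 2) ^ n))"
    by (rule suminf_le) (use m in auto)
  also have "\<dots> = ennreal (\<Sum>n. (1 / 2) ^ n)"
    by (rule suminf_ennreal2) (auto intro: summable_geometric)
  finally have fin: "(\<integral>\<^sup>+ x. S x \<partial>M) < \<infinity>"
    using ennreal_less_top le_less_trans by (metis infinity_ennreal_def)
  have AE: "AE x in M. S x \<noteq> \<infinity>"
    by (rule nn_integral_noteq_infinite) (use fin in auto)
  have le: "norm (h n x) powr p x \<le> enn2real (S x)" if "S x \<noteq> \<infinity>" for n x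
  proof -
    have "(\<Sum>i\<in>{n}. ennreal (norm (h i x) powr p x)) \<le> S x"
      unfolding S_def by (rule sum_le_suminf) (rule summableI, simp, rule zero_le)
    then have "ennreal (norm (h n x) powr p x) \<le> S x"
      by (simp only: sum.insert_remove sum.empty finite.emptyI empty_Diff add_0_right)
    then show ?thesis
      using that enn2real_mono[of "ennreal (norm (h n x) powr p x)" "S x"] by (simp add: top.not_eq_extremum)
  qed
  show thesis
  proof
    show "integrable M (\<lambda>x. enn2real (S x))"
    proof (rule integrableI_bounded)
      have "(\<integral>\<^sup>+ x. ennreal (norm (enn2real (S x))) \<partial>M) \<le> (\<integral>\<^sup>+ x. S x \<partial>M)"
        by (rule nn_integral_mono) (simp add: ennreal_enn2real_if)
      then show "(\<integral>\<^sup>+ x. ennreal (norm (enn2real (S x))) \<partial>M) < \<infinity>" using fin by simp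
    qed measurable
    show "AE x in M. \<forall>n. norm (h n x) powr p x \<le> enn2real (S x)"
      using AE by eventually_elim (use le in blast)
    show "AE x in M. (\<lambda>n. h n x) \<longlonglongrightarrow> 0"
      using AE AE_space
    proof eventually_elim
      fix x assume x: "S x \<noteq> \<infinity>" "x \<in> space M"
      then have px: "1 \<le> p x" using p_bounds by simp
      have "summable (\<lambda>n. norm (h n x) powr p x)"
        by (rule summable_suminf_not_top) (use x in \<open>auto simp: S_def\<close>)
      then have z: "(\<lambda>n. norm (h n x) powr p x) \<longlonglongrightarrow> 0" by (rule summable_LIMSEQ_zero)
      show "(\<lambda>n. h n x) \<longlonglongrightarrow> 0"
      proof (rule LIMSEQ_I)
        fix e :: real assume "e > 0"
        then have "\<forall>\<^sub>F n in sequentially. norm (h n x) powr p x < e powr p x"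
          using z by (intro order_tendstoD) auto
        then obtain N where N: "\<And>n. n \<ge> N \<Longrightarrow> norm (h n x) powr p x < e powr p x"
          by (auto simp: eventually_sequentially)
        have "norm (h n x - 0) < e" if "n \<ge> N" for n
        proof (rule ccontr)
          assume "\<not> norm (h n x - 0) < e"
          then have "e powr p x \<le> norm (h n x) powr p x"
            using px \<open>e > 0\<close> by (intro powr_mono2) auto
          then show False using N[OF that] by simp
        qed
        then show "\<exists>N. \<forall>n\<ge>N. norm (h n x - 0) < e" by blast
      qed
    qed
  qed
qed

text \<open>Errors of size \<open>(1/2) ^ n\<close> are summable, so the whole sequence converges
  a.e. and its gradients have a common majorant. The weight \<open>w\<close> is left free for the
  factors \<open>a powr p x / p x\<close> that arise when \<open>u\<close> is scaled by
  \<open>a\<close> inside \<open>G\<close>.\<close>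

lemma var_Sobolev0_sequence:
  assumes u: "u \<in> var_Sobolev0 \<Omega> p"
  obtains f where "\<And>n. f n \<in> test_functions \<Omega>" "AE x in M. (\<lambda>n. f n x) \<longlonglongrightarrow> u x"
    "\<And>w B. w \<in> borel_measurable M \<Longrightarrow> (\<And>x. x \<in> \<Omega> \<Longrightarrow> \<bar>w x\<bar> \<le> B) \<Longrightarrow>
      (\<lambda>n. LINT x|M. w x * norm (grad (f n) x) powr p x) \<longlonglongrightarrow> (LINT x|M. w x * norm (weak_gradient \<Omega> u x) powr p x)"
proof -
  have uS: "u \<in> var_Sobolev \<Omega> p" using u by (simp add: var_Sobolev0_def)
  note uD = var_SobolevD[OF uS]
  have um [measurable]: "u \<in> borel_measurable M" "weak_gradient \<Omega> u \<in> borel_measurable M"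
    using uD by (auto simp: var_Lebesgue_def)
  have "\<exists>f. f \<in> test_functions \<Omega> \<and> modular \<Omega> p (\<lambda>x. f x - u x) \<le> ennreal ((1/2) ^ n) \<and>
      modular \<Omega> p (\<lambda>x. grad f x - weak_gradient \<Omega> u x) \<le> ennreal ((1/2) ^ n)" for n
    by (rule var_Sobolev0_approx[OF u, of "(1/2) ^ n"]) (auto simp: power_le_one)
  then obtain f where f: "\<And>n. f n \<in> test_functions \<Omega>"
      "\<And>n. modular \<Omega> p (\<lambda>x. f n x - u x) \<le> ennreal ((1/2) ^ n)"
      "\<And>n. modular \<Omega> p (\<lambda>x. grad (f n) x - weak_gradient \<Omega> u x) \<le> ennreal ((1/2) ^ n)"
    by metis
  have fm [measurable]: "f n \<in> borel_measurable M" "grad (f n) \<in> borel_measurable M" for n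
    using test_function_bounded[OF f(1)] by auto
  have dm: "(\<lambda>x. f n x - u x) \<in> borel_measurable M" "(\<lambda>x. grad (f n) x - weak_gradient \<Omega> u x) \<in> borel_measurable M" for n
    by measurable
  have "AE x in M. (\<lambda>n. f n x - u x) \<longlonglongrightarrow> 0"
    by (rule modular_summable_dominated[OF dm(1) f(2)])
  then have lim: "AE x in M. (\<lambda>n. f n x) \<longlonglongrightarrow> u x"
    by eventually_elim (rule LIM_zero_cancel)
  obtain H :: "'a \<Rightarrow> real" where H: "integrable M H"
      "AE x in M. \<forall>n. norm (grad (f n) x - weak_gradient \<Omega> u x) powr p x \<le> H x"
      "AE x in M. (\<lambda>n. grad (f n) x - weak_gradient \<Omega> u x) \<longlonglongrightarrow> 0"
    by (rule modular_summable_dominated[OF dm(2) f(3)])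
  show thesis
  proof (rule that[OF f(1) lim])
    fix w :: "'a \<Rightarrow> real" and B assume [measurable]: "w \<in> borel_measurable M" and B: "\<And>x. x \<in> \<Omega> \<Longrightarrow> \<bar>w x\<bar> \<le> B"
    show "(\<lambda>n. LINT x|M. w x * norm (grad (f n) x) powr p x) \<longlonglongrightarrow> (LINT x|M. w x * norm (weak_gradient \<Omega> u x) powr p x)"
    \<comment> \<open>The majorant results from splitting the gradient of \<open>f n\<close> into
      that of \<open>u\<close> and the error, by \<open>powr_add_le\<close>.\<close>
    proof (rule integral_dominated_convergence[where
          w = "\<lambda>x. \<bar>B\<bar> * (2 powr P * (norm (weak_gradient \<Omega> u x) powr p x + H x))"])
      show "integrable M (\<lambda>x. \<bar>B\<bar> * (2 powr P * (norm (weak_gradient \<Omega> u x) powr p x + H x)))"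
        using H(1) integrable_powr[OF uD(3)] by simp
      show "AE x in M. (\<lambda>n. w x * norm (grad (f n) x) powr p x) \<longlonglongrightarrow> w x * norm (weak_gradient \<Omega> u x) powr p x"
        using H(3) AE_space
      proof eventually_elim
        fix x assume x: "(\<lambda>n. grad (f n) x - weak_gradient \<Omega> u x) \<longlonglongrightarrow> 0" "x \<in> space M"
        have "(\<lambda>n. grad (f n) x) \<longlonglongrightarrow> weak_gradient \<Omega> u x" using x(1) by (rule LIM_zero_cancel)
        then show "(\<lambda>n. w x * norm (grad (f n) x) powr p x) \<longlonglongrightarrow> w x * norm (weak_gradient \<Omega> u x) powr p x"
          using p_bounds[of x] x(2) by (intro tendsto_mult tendsto_const tendsto_powr' tendsto_norm) auto
      qed
      show "AE x in M. norm (w x * norm (grad (f n) x) powr p x) \<le> \<bar>B\<bar> * (2 powr P * (norm (weak_gradient \<Omega> u x) powr p x + H x))" for n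
        using H(2) AE_space
      proof eventually_elim
        fix x assume x: "\<forall>n. norm (grad (f n) x - weak_gradient \<Omega> u x) powr p x \<le> H x" "x \<in> space M"
        then have px: "1 \<le> p x" "p x \<le> P" and xO: "x \<in> \<Omega>" using p_bounds by auto
        have "norm (grad (f n) x) powr p x \<le> (norm (weak_gradient \<Omega> u x) + norm (grad (f n) x - weak_gradient \<Omega> u x)) powr p x"
          using px norm_triangle_sub[of "grad (f n) x" "weak_gradient \<Omega> u x"] by (intro powr_mono2) auto
        also have "\<dots> \<le> 2 powr P * (norm (weak_gradient \<Omega> u x) powr p x + norm (grad (f n) x - weak_gradient \<Omega> u x) powr p x)"
          using px by (intro powr_add_le) auto
        also have "\<dots> \<le> 2 powr P * (norm (weak_gradient \<Omega> u x) powr p x + H x)"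
          using x by (intro mult_left_mono add_left_mono) auto
        finally have "\<bar>w x\<bar> * norm (grad (f n) x) powr p x \<le> \<bar>B\<bar> * (2 powr P * (norm (weak_gradient \<Omega> u x) powr p x + H x))"
          using B[OF xO] by (intro mult_mono) auto
        then show "norm (w x * norm (grad (f n) x) powr p x) \<le> \<bar>B\<bar> * (2 powr P * (norm (weak_gradient \<Omega> u x) powr p x + H x))"
          by (simp add: abs_mult)
      qed
    qed measurable
  qed
qed

end

section \<open>Hidden convexity\<close>

text \<open>Convexity on the open half line covers positive arguments; if one argument is 0, the
  claim reduces to \<open>k powr c <= k\<close> for k in [0,1].\<close>

lemma powr_jensen:
  fixes l m x y c :: real
  assumes "0 \<le> l" "0 \<le> m" "l + m = 1" "0 \<le> x" "0 \<le> y" "1 \<le> c"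
  shows "(l * x + m * y) powr c \<le> l * x powr c + m * y powr c"
proof -
  have small: "(k * z) powr c \<le> k * z powr c" if "0 \<le> k" "k \<le> 1" "0 \<le> z" for k z :: real
  proof -
    have "k powr c \<le> k"
    proof (cases "k = 0")
      case False
      then have "k powr c \<le> k powr 1" using that assms by (intro powr_mono') auto
      then show ?thesis using that by simp
    qed simp
    then show ?thesis using that by (simp add: powr_mult mult_right_mono)
  qed
  show ?thesis
  proof (cases "x = 0 \<or> y = 0")
    case True
    then show ?thesis using small[of l x] small[of m y] assms by auto
  next
    case False
    have l: "l = 1 - m" and "x > 0" "y > 0" using assms False by auto
    then show ?thesis
      using convex_onD[OF powr_convex[OF assms(6)], of m x y] assms(1,2) \<open>x > 0\<close> \<open>y > 0\<close> unfolding l by simp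
  qed
qed

definition power_mean :: "real \<Rightarrow> real \<Rightarrow> real \<Rightarrow> real" where
  "power_mean r a b = (a powr r / 2 + b powr r / 2) powr (1 / r)"

lemma power_mean_powr: "r > 0 \<Longrightarrow> power_mean r a b powr r = a powr r / 2 + b powr r / 2"
  by (simp add: power_mean_def powr_powr)

lemma power_mean_same: "r > 0 \<Longrightarrow> a \<ge> 0 \<Longrightarrow> power_mean r a a = a"
  by (simp add: power_mean_def powr_powr)

text \<open>The half of hidden convexity that concerns \<open>F\<close>: power means increase with
  the exponent, by Jensen with exponent \<open>r / q\<close> applied to the q-th powers.\<close>

lemma power_mean_ge:
  assumes "1 \<le> q" "q \<le> r" "0 \<le> a" "0 \<le> b"
  shows "a powr q / 2 + b powr q / 2 \<le> power_mean r a b powr q"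
proof -
  have "(1 / 2 * a powr q + 1 / 2 * b powr q) powr (r / q) \<le> 1 / 2 * (a powr q) powr (r / q) + 1 / 2 * (b powr q) powr (r / q)"
    using assms by (intro powr_jensen) auto
  then have "(a powr q / 2 + b powr q / 2) powr (r / q) \<le> a powr r / 2 + b powr r / 2"
    using assms by (simp add: powr_powr)
  then have "((a powr q / 2 + b powr q / 2) powr (r / q)) powr (q / r) \<le> (a powr r / 2 + b powr r / 2) powr (q / r)"
    using assms by (intro powr_mono2) auto
  then show ?thesis
    using assms by (simp add: powr_powr power_mean_def)
qed

text \<open>The half that concerns \<open>G\<close>: the left-hand base is the bound for the
  gradient of the power mean t of two positive functions \<open>a\<close>, \<open>b\<close> whose
  gradients have norms \<open>A\<close>, \<open>B\<close>. It is a convex combination of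
  \<open>t A / a\<close> and \<open>t B / b\<close>, so Jensen applies.\<close>

lemma power_mean_gradient_le:
  fixes a b A B r p :: real
  assumes r: "1 \<le> r" "r \<le> p" and pos: "0 < a" "0 < b" "0 \<le> A" "0 \<le> B"
  shows "(power_mean r a b powr (1 - r) * (a powr (r - 1) / 2 * A + b powr (r - 1) / 2 * B)) powr p \<le> A powr p / 2 + B powr p / 2"
proof -
  define t where "t = power_mean r a b"
  have t: "t > 0" 
  proof -
    have "a powr r / 2 + b powr r / 2 > 0" using pos by (intro add_pos_pos) auto
    then show ?thesis by (simp add: t_def power_mean_def)
  qed
  have tr: "t powr r = a powr r / 2 + b powr r / 2" using r by (simp add: t_def power_mean_powr)
  define Y where "Y = t powr (1 - r) * (a powr (r - 1) / 2 * A + b powr (r - 1) / 2 * B)"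
  \<comment> \<open>These weights sum to 1 precisely because \<open>t\<close> is the power mean of
    exponent \<open>r\<close>.\<close>
  define l where "l = a powr r / (2 * t powr r)"
  define m where "m = b powr r / (2 * t powr r)"
  have lm: "0 \<le> l" "0 \<le> m" "l + m = 1"
  proof -
    have "l + m = (a powr r / 2 + b powr r / 2) / t powr r"
      by (simp add: l_def m_def add_divide_distrib)
    then show "l + m = 1" using tr t by (metis divide_self less_irrefl powr_gt_zero)
  qed (auto simp: l_def m_def)
  have Y: "Y = l * (t * A / a) + m * (t * B / b)"
    using pos t by (simp add: Y_def l_def m_def powr_diff add_divide_distrib distrib_left mult.commute mult.left_commute)
  have "Y powr r \<le> l * (t * A / a) powr r + m * (t * B / b) powr r"
    unfolding Y using lm pos t r by (intro powr_jensen) auto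
  \<comment> \<open>The r-th powers of \<open>t / a\<close> and \<open>t / b\<close> cancel the
    weights down to 1/2.\<close>
  also have "\<dots> = A powr r / 2 + B powr r / 2"
    using pos t by (simp add: l_def m_def powr_mult powr_divide field_simps)
  finally have "Y powr r \<le> A powr r / 2 + B powr r / 2" .
  \<comment> \<open>The passage from exponent \<open>r\<close> to \<open>p\<close> is a second use
    of Jensen, with \<open>p / r >= 1\<close>.\<close>
  then have "(Y powr r) powr (p / r) \<le> (A powr r / 2 + B powr r / 2) powr (p / r)"
    using r by (intro powr_mono2) auto
  also have "\<dots> \<le> (A powr r) powr (p / r) / 2 + (B powr r) powr (p / r) / 2"
    using powr_jensen[of "1/2" "1/2" "A powr r" "B powr r" "p / r"] r by simp
  finally show ?thesis
    using r by (simp add: powr_powr Y_def t_def)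
qed

section \<open>Smoothed power means\<close>

lemma grad_add:
  assumes "smooth_on f UNIV" "smooth_on g UNIV"
  shows "grad (\<lambda>x. f x + g x) x = grad f x + grad g x"
  by (rule grad_unique)
    (use has_derivative_add[OF smooth_has_derivative[OF assms(1)] smooth_has_derivative[OF assms(2)]]
      in \<open>simp add: inner_add_left\<close>)

lemma grad_const: "grad (\<lambda>x. c) x = 0"
  by (rule grad_unique) simp

lemma grad_cmult: "smooth_on f UNIV \<Longrightarrow> grad (\<lambda>x. c * f x) x = c *\<^sub>R grad f x"
  by (simp add: grad_mult smooth_const grad_const)

lemma grad_powr:
  assumes "smooth_on f UNIV" "f x > 0"
  shows "grad (\<lambda>x. f x powr c) x = (c * f x powr (c - 1)) *\<^sub>R grad f x"
proof (rule grad_unique)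
  have "((\<lambda>t. t powr c) has_real_derivative c * f x powr (c - 1)) (at (f x))"
    using assms(2) by (rule has_real_derivative_powr)
  then show "((\<lambda>x. f x powr c) has_derivative (\<lambda>v. (c * f x powr (c - 1)) *\<^sub>R grad f x \<bullet> v)) (at x)"
    using has_derivative_compose[OF smooth_has_derivative[OF assms(1)]]
    unfolding has_field_derivative_def by simp
qed

text \<open>The term \<open>e\<close> removes the kink of the modulus and keeps the base positive,
  so that all real powers of the result are smooth. At zeros of \<open>f\<close> the value is
  \<open>e powr (1/2)\<close>.\<close>

definition smooth_abs :: "real \<Rightarrow> ('a \<Rightarrow> real) \<Rightarrow> 'a \<Rightarrow> real" where
  "smooth_abs e f x = (f x * f x + e) powr (1 / 2)"

lemma smooth_abs_pos: "e > 0 \<Longrightarrow> smooth_abs e f x > 0"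
  unfolding smooth_abs_def using add_nonneg_pos[OF zero_le_square[of "f x"], of e] by simp

lemma abs_le_smooth_abs: "e > 0 \<Longrightarrow> \<bar>f x\<bar> \<le> smooth_abs e f x"
  unfolding smooth_abs_def using zero_le_square[of "f x"]
  by (simp add: powr_half_sqrt real_le_rsqrt power2_eq_square)

lemma smooth_smooth_abs:
  assumes "smooth_on f UNIV" "e > 0"
  shows "smooth_on (smooth_abs e f) UNIV"
  unfolding smooth_abs_def using assms
  by (intro smooth_powr smooth_add smooth_mult smooth_const add_nonneg_pos zero_le_square)

text \<open>The chain rule multiplies the gradient of \<open>f\<close> by
  \<open>f / smooth_abs e f\<close>, whose modulus is at most 1.\<close>

lemma norm_grad_smooth_abs_le:
  assumes f: "smooth_on f UNIV" and e: "e > 0"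
  shows "norm (grad (smooth_abs e f) x) \<le> norm (grad f x)"
proof -
  define s where "s = f x * f x + e"
  have s: "s > 0" using e by (simp add: s_def add_nonneg_pos)
  have sm: "smooth_on (\<lambda>x. f x * f x + e) UNIV"
    using f by (intro smooth_add smooth_mult smooth_const)
  have "grad (smooth_abs e f) x = (1 / 2 * s powr (1 / 2 - 1)) *\<^sub>R grad (\<lambda>x. f x * f x + e) x"
    unfolding smooth_abs_def s_def using s[unfolded s_def] by (rule grad_powr[OF sm])
  also have "grad (\<lambda>x. f x * f x + e) x = (2 * f x) *\<^sub>R grad f x"
    using f by (simp add: grad_add smooth_mult smooth_const grad_const grad_mult scaleR_2[symmetric])
  finally have "norm (grad (smooth_abs e f) x) = \<bar>f x\<bar> * s powr (1 / 2 - 1) * norm (grad f x)"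
    by (simp add: abs_mult)
  also have "\<dots> \<le> s powr (1 / 2) * s powr (1 / 2 - 1) * norm (grad f x)"
    using abs_le_smooth_abs[OF e, of f x] by (intro mult_right_mono) (auto simp: smooth_abs_def s_def)
  also have "s powr (1 / 2) * s powr (1 / 2 - 1) = 1"
    using s by (simp add: powr_add[symmetric])
  finally show ?thesis by simp
qed

text \<open>Smooth version of the path that makes \<open>G\<close> convex and \<open>F\<close> concave; subtracting
  \<open>e powr (1/2)\<close> restores the compact support.\<close>

definition smooth_power_mean :: "real \<Rightarrow> real \<Rightarrow> ('a \<Rightarrow> real) \<Rightarrow> ('a \<Rightarrow> real) \<Rightarrow> 'a \<Rightarrow> real" where
  "smooth_power_mean r e f g x = power_mean r (smooth_abs e f x) (smooth_abs e g x) - e powr (1 / 2)"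

lemma
  assumes f: "smooth_on f UNIV" and g: "smooth_on g UNIV" and e: "e > 0" and r: "1 \<le> r"
  shows smooth_smooth_power_mean: "smooth_on (smooth_power_mean r e f g) UNIV"
    and grad_smooth_power_mean: "grad (smooth_power_mean r e f g) x =
      power_mean r (smooth_abs e f x) (smooth_abs e g x) powr (1 - r) *\<^sub>R
       ((smooth_abs e f x powr (r - 1) / 2) *\<^sub>R grad (smooth_abs e f) x + (smooth_abs e g x powr (r - 1) / 2) *\<^sub>R grad (smooth_abs e g) x)"
proof -
  define a where "a = smooth_abs e f"
  define b where "b = smooth_abs e g"
  have a: "smooth_on a UNIV" "a x > 0" and b: "smooth_on b UNIV" "b x > 0" for x
    using smooth_smooth_abs f g e smooth_abs_pos by (auto simp: a_def b_def)
  define S where "S x = 1 / 2 * a x powr r + 1 / 2 * b x powr r" for x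
  have sp: "smooth_on (\<lambda>x. 1 / 2 * a x powr r) UNIV" "smooth_on (\<lambda>x. 1 / 2 * b x powr r) UNIV"
    by (intro smooth_mult smooth_const smooth_powr a b)+
  have S: "smooth_on S UNIV" unfolding S_def by (intro smooth_add sp)
  have Sp: "S x > 0" for x unfolding S_def using a(2)[of x] b(2)[of x] by (intro add_pos_pos mult_pos_pos) auto
  have eq: "smooth_power_mean r e f g = (\<lambda>x. S x powr (1 / r) + - (e powr (1 / 2)))"
    by (simp add: fun_eq_iff smooth_power_mean_def power_mean_def S_def a_def b_def)
  have Sr: "smooth_on (\<lambda>x. S x powr (1 / r)) UNIV" by (intro smooth_powr S Sp)
  show "smooth_on (smooth_power_mean r e f g) UNIV"
    unfolding eq by (intro smooth_add smooth_const Sr)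
  have "grad (smooth_power_mean r e f g) x = (1 / r * S x powr (1 / r - 1)) *\<^sub>R grad S x"
    unfolding eq grad_add[OF Sr smooth_const] by (simp add: grad_const grad_powr[OF S Sp])
  also have "grad S x = (1 / 2 * (r * a x powr (r - 1))) *\<^sub>R grad a x + (1 / 2 * (r * b x powr (r - 1))) *\<^sub>R grad b x"
    unfolding S_def grad_add[OF sp]
    unfolding grad_cmult[OF smooth_powr[OF a]] grad_cmult[OF smooth_powr[OF b]] grad_powr[OF a] grad_powr[OF b]
    by simp
  \<comment> \<open>If t is the power mean, then S is t^r and \<open>1 / r - 1\<close> turns into
    the exponent \<open>1 - r\<close> of t.\<close>
  also have "S x powr (1 / r - 1) = power_mean r (a x) (b x) powr (1 - r)"
    using r by (simp add: power_mean_def S_def powr_powr right_diff_distrib)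
  finally show "grad (smooth_power_mean r e f g) x =
      power_mean r (smooth_abs e f x) (smooth_abs e g x) powr (1 - r) *\<^sub>R
       ((smooth_abs e f x powr (r - 1) / 2) *\<^sub>R grad (smooth_abs e f) x + (smooth_abs e g x powr (r - 1) / 2) *\<^sub>R grad (smooth_abs e g) x)"
    using r by (simp add: a_def[symmetric] b_def[symmetric] scaleR_add_right field_simps)
qed

text \<open>The bound holds for every \<open>e\<close> without error term, so smoothing costs
  nothing in \<open>G\<close>.\<close>

lemma norm_grad_smooth_power_mean_le:
  assumes f: "smooth_on f UNIV" and g: "smooth_on g UNIV" and e: "e > 0" and r: "1 \<le> r" "r \<le> p"
  shows "norm (grad (smooth_power_mean r e f g) x) powr p \<le> norm (grad f x) powr p / 2 + norm (grad g x) powr p / 2"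
proof -
  define a where "a = smooth_abs e f x"
  define b where "b = smooth_abs e g x"
  have ab: "a > 0" "b > 0" using e smooth_abs_pos by (auto simp: a_def b_def)
  have "norm (grad (smooth_power_mean r e f g) x) \<le>
      power_mean r a b powr (1 - r) * (a powr (r - 1) / 2 * norm (grad (smooth_abs e f) x) + b powr (r - 1) / 2 * norm (grad (smooth_abs e g) x))"
    unfolding grad_smooth_power_mean[OF f g e r(1)] a_def[symmetric] b_def[symmetric]
    by (simp, intro mult_left_mono order_trans[OF norm_triangle_ineq]) auto
  also have "\<dots> \<le> power_mean r a b powr (1 - r) * (a powr (r - 1) / 2 * norm (grad f x) + b powr (r - 1) / 2 * norm (grad g x))"
    by (intro mult_left_mono add_mono norm_grad_smooth_abs_le f g e) auto
  finally have "norm (grad (smooth_power_mean r e f g) x) powr p \<le>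
      (power_mean r a b powr (1 - r) * (a powr (r - 1) / 2 * norm (grad f x) + b powr (r - 1) / 2 * norm (grad g x))) powr p"
    using r by (intro powr_mono2) auto
  also have "\<dots> \<le> norm (grad f x) powr p / 2 + norm (grad g x) powr p / 2"
    using power_mean_gradient_le[OF r ab] by simp
  finally show ?thesis .
qed

lemma smooth_power_mean_test:
  assumes f: "f \<in> test_functions \<Omega>" and g: "g \<in> test_functions \<Omega>" and e: "e > 0" and r: "1 \<le> r"
  shows "smooth_power_mean r e f g \<in> test_functions \<Omega>"
proof -
  obtain K where K: "smooth_on f UNIV" "compact K" "K \<subseteq> \<Omega>" "\<And>x. x \<notin> K \<Longrightarrow> f x = 0"
    using f by (rule test_functionsE) blast
  obtain L where L: "smooth_on g UNIV" "compact L" "L \<subseteq> \<Omega>" "\<And>x. x \<notin> L \<Longrightarrow> g x = 0"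
    using g by (rule test_functionsE) blast
  show ?thesis
  proof (rule test_functionsI)
    show "smooth_on (smooth_power_mean r e f g) UNIV" by (rule smooth_smooth_power_mean) fact+
    show "compact (K \<union> L)" "K \<union> L \<subseteq> \<Omega>" using K L by auto
    \<comment> \<open>Off both supports the two arguments of the mean equal
      \<open>e powr (1/2)\<close>, and so does their mean.\<close>
    show "smooth_power_mean r e f g x = 0" if "x \<notin> K \<union> L" for x
      using that K L r by (simp add: smooth_power_mean_def smooth_abs_def power_mean_same)
  qed
qed

lemma smooth_power_mean_tendsto:
  assumes f: "(\<lambda>n. f n x) \<longlonglongrightarrow> u" and g: "(\<lambda>n. g n x) \<longlonglongrightarrow> w" and e: "e \<longlonglongrightarrow> 0" and r: "1 \<le> r"
    and ep: "\<And>n. e n > 0"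
  shows "(\<lambda>n. smooth_power_mean r (e n) (f n) (g n) x) \<longlonglongrightarrow> power_mean r \<bar>u\<bar> \<bar>w\<bar>"
proof -
  have a: "(\<lambda>n. smooth_abs (e n) (h n) x) \<longlonglongrightarrow> \<bar>v\<bar>" if h: "(\<lambda>n. h n x) \<longlonglongrightarrow> v" for h v
  proof -
    have "(\<lambda>n. (h n x * h n x + e n) powr (1 / 2)) \<longlonglongrightarrow> (v * v + 0) powr (1 / 2)"
      using h e ep by (intro tendsto_powr' tendsto_intros) (auto simp: less_imp_le intro!: always_eventually)
    then show ?thesis by (simp add: smooth_abs_def powr_half_sqrt)
  qed
  have "(\<lambda>n. power_mean r (smooth_abs (e n) (f n) x) (smooth_abs (e n) (g n) x)) \<longlonglongrightarrow> power_mean r \<bar>u\<bar> \<bar>w\<bar>"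
    unfolding power_mean_def using r less_imp_le[OF smooth_abs_pos[OF ep]] a[of f, OF f] a[of g, OF g]
    by (intro tendsto_powr' tendsto_intros) (auto simp: less_imp_le intro!: always_eventually)
  moreover have "(\<lambda>n. e n powr (1 / 2)) \<longlonglongrightarrow> 0 powr (1 / 2)"
    using e ep by (intro tendsto_powr' tendsto_intros) (auto simp: less_imp_le intro!: always_eventually)
  ultimately have "(\<lambda>n. power_mean r (smooth_abs (e n) (f n) x) (smooth_abs (e n) (g n) x) - e n powr (1 / 2)) \<longlonglongrightarrow> power_mean r \<bar>u\<bar> \<bar>w\<bar> - 0 powr (1 / 2)"
    by (rule tendsto_diff)
  then show ?thesis by (simp add: smooth_power_mean_def)
qed

section \<open>The functionals on test functions and on the sphere\<close>

lemma test_functions_cmult: "f \<in> test_functions \<Omega> \<Longrightarrow> (\<lambda>x. c * f x) \<in> test_functions \<Omega>"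
  by (rule test_functionsE, assumption) (rule test_functionsI, auto intro: smooth_mult smooth_const)

text \<open>The number \<open>r\<close> is the exponent of the power means; the theorem takes p^-
  for it. It also serves as the uniform upper bound of \<open>q\<close>.\<close>

locale eigen_setting = exponent_domain \<Omega> p P
  for \<Omega> :: "'a::euclidean_space set" and p P +
  fixes q V :: "'a \<Rightarrow> real" and r \<alpha> :: real
  assumes nonempty: "\<Omega> \<noteq> {}"
    and q_measurable [measurable]: "q \<in> borel_measurable (lebesgue_on \<Omega>)"
    and q_bounds: "\<And>x. x \<in> \<Omega> \<Longrightarrow> 1 \<le> q x \<and> q x \<le> r"
    and r_le_p: "\<And>x. x \<in> \<Omega> \<Longrightarrow> r \<le> p x"
    and V_integrable: "integrable (lebesgue_on \<Omega>) V"
    and V_pos: "AE x in lebesgue_on \<Omega>. 0 < V x"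
    and alpha_pos: "0 < \<alpha>"
begin

lemma r_ge_1: "1 \<le> r" and P_ge_1: "1 \<le> P"
  using nonempty q_bounds p_bounds by force+

lemma V_measurable [measurable]: "V \<in> borel_measurable M"
  using V_integrable by (rule borel_measurable_integrable)

section \<open>Integrability and positivity on test functions\<close>

lemma integrable_bounded_mult:
  fixes w g :: "'a \<Rightarrow> real"
  assumes g: "integrable M g" and w: "w \<in> borel_measurable M" "\<And>x. x \<in> \<Omega> \<Longrightarrow> \<bar>w x\<bar> \<le> B"
  shows "integrable M (\<lambda>x. w x * g x)"
proof (rule Bochner_Integration.integrable_bound)
  show "integrable M (\<lambda>x. B * g x)" using g by simp
  show "(\<lambda>x. w x * g x) \<in> borel_measurable M"
    using w borel_measurable_integrable[OF g] by simp
  show "AE x in M. norm (w x * g x) \<le> norm (B * g x)"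
    using w(2) by (intro AE_I2) (fastforce simp: abs_mult intro!: mult_right_mono)
qed

lemma integrable_F_bounded:
  fixes f :: "'a \<Rightarrow> real"
  assumes [measurable]: "f \<in> borel_measurable M" and B: "\<And>x. \<bar>f x\<bar> \<le> B"
  shows "integrable M (\<lambda>x. V x / q x * \<bar>f x\<bar> powr q x)"
proof -
  have "integrable M (\<lambda>x. (1 / q x * \<bar>f x\<bar> powr q x) * V x)"
  proof (rule integrable_bounded_mult[OF V_integrable])
    fix x assume x: "x \<in> \<Omega>"
    have "\<bar>f x\<bar> powr q x \<le> (max 1 B) powr q x"
      using B[of x] q_bounds[OF x] by (intro powr_mono2) auto
    also have "\<dots> \<le> (max 1 B) powr r"
      using q_bounds[OF x] by (intro powr_mono) auto
    finally have "1 / q x * \<bar>f x\<bar> powr q x \<le> 1 * (max 1 B) powr r"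
      using q_bounds[OF x] by (intro mult_mono) auto
    then show "\<bar>1 / q x * \<bar>f x\<bar> powr q x\<bar> \<le> (max 1 B) powr r"
      using q_bounds[OF x] by simp
  qed measurable
  then show ?thesis by (simp add: mult_ac)
qed

lemma integrable_F_test:
  "f \<in> test_functions \<Omega> \<Longrightarrow> integrable M (\<lambda>x. V x / q x * \<bar>f x\<bar> powr q x)"
  using integrable_F_bounded test_function_bounded by blast

lemma F_nonneg_AE: "AE x in M. 0 \<le> V x / q x * \<bar>u x\<bar> powr q x"
  using V_pos AE_space
proof eventually_elim
  case (elim x) then show ?case using q_bounds[of x] by simp
qed

lemma F_fun_nonneg: "0 \<le> F_fun \<Omega> q V u"
  unfolding F_fun_def by (rule integral_nonneg_AE) (rule F_nonneg_AE)

lemma G_fun_test: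
  assumes f: "f \<in> test_functions \<Omega>"
  shows "G_fun \<Omega> p f = (LINT x|M. 1 / p x * norm (grad f x) powr p x)"
proof -
  have [measurable]: "grad f \<in> borel_measurable M" "weak_gradient \<Omega> f \<in> borel_measurable M"
    using test_function_bounded[OF f] var_SobolevD(3)[of f] test_function_var_Sobolev0[OF f]
    by (auto simp: var_Sobolev0_def var_Lebesgue_def)
  show ?thesis
    unfolding G_fun_def
    by (rule integral_cong_AE) (measurable, use test_function_var_Sobolev0(2)[OF f] in \<open>eventually_elim, simp\<close>)
qed

text \<open>The weight is what \<open>1 / p x\<close> in the integrand of \<open>G\<close> becomes
  when the function is multiplied by \<open>a\<close>.\<close>

lemma integrable_weighted_powr:
  fixes g :: "'a \<Rightarrow> 'a"
  assumes g: "g \<in> var_Lebesgue \<Omega> p" and a: "0 \<le> a"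
  shows "integrable M (\<lambda>x. a powr p x / p x * norm (g x) powr p x)"
proof (rule integrable_bounded_mult[OF integrable_powr[OF g]])
  fix x assume x: "x \<in> \<Omega>"
  have "a powr p x \<le> (max 1 a) powr p x"
    using p_bounds[OF x] a by (intro powr_mono2) auto
  also have "\<dots> \<le> (max 1 a) powr P"
    using p_bounds[OF x] by (intro powr_mono) auto
  finally have "1 / p x * a powr p x \<le> 1 * (max 1 a) powr P"
    using p_bounds[OF x] by (intro mult_mono) auto
  then show "\<bar>a powr p x / p x\<bar> \<le> (max 1 a) powr P"
    using p_bounds[OF x] by simp
qed measurable

lemma test_function_zero_gradient:
  assumes f: "f \<in> test_functions \<Omega>" and 0: "\<And>x. x \<in> \<Omega> \<Longrightarrow> grad f x = 0"
  shows "f x = 0"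
proof -
  obtain K where K: "smooth_on f UNIV" "compact K" "K \<subseteq> \<Omega>" "\<And>x. x \<notin> K \<Longrightarrow> f x = 0" "\<And>x. x \<notin> K \<Longrightarrow> grad f x = 0"
    using f by (rule test_functionsE) blast
  have "grad f x = 0" for x using K(3,5) 0 by blast
  then have "(f has_derivative (\<lambda>v. 0)) (at x within UNIV)" for x
    using smooth_has_derivative[OF K(1), of x] by simp
  then obtain c where c: "\<And>x. f x = c"
    using has_derivative_zero_constant[of UNIV f] by auto
  have "K \<noteq> UNIV"
    using compact_imp_bounded[OF K(2)] not_bounded_UNIV by auto
  then obtain y where "y \<notin> K" by blast
  then show ?thesis using c K(4) by metis
qed

text \<open>If \<open>G\<close> vanishes, the gradient vanishes a.e.; it is continuous, and an open
  null set is empty, so it vanishes everywhere. Then \<open>f\<close> is constant with compact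
  support, hence 0, contrary to \<open>F > 0\<close>.\<close>

lemma G_fun_test_pos:
  assumes f: "f \<in> test_functions \<Omega>" and F: "F_fun \<Omega> q V f > 0"
  shows "G_fun \<Omega> p f > 0"
proof (rule ccontr)
  have fr: "integrable M (\<lambda>x. 1 / p x * norm (grad f x) powr p x)"
    using integrable_weighted_powr[OF test_function_var_Lebesgue(2)[OF f], of 1] by simp
  have nn: "AE x in M. 0 \<le> 1 / p x * norm (grad f x) powr p x"
  proof (rule AE_I2)
    fix x assume "x \<in> space M"
    then show "0 \<le> 1 / p x * norm (grad f x) powr p x" using p_bounds[of x] by simp
  qed
  assume "\<not> G_fun \<Omega> p f > 0"
  moreover have "G_fun \<Omega> p f \<ge> 0"
    unfolding G_fun_test[OF f] by (rule integral_nonneg_AE) (rule nn)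
  ultimately have "AE x in M. 1 / p x * norm (grad f x) powr p x = 0"
    using integral_nonneg_eq_0_iff_AE[OF fr nn] G_fun_test[OF f] by simp
  then have "AE x in M. grad f x = 0"
    using AE_space
  proof eventually_elim
    case (elim x) then show ?case using p_bounds[of x] by simp
  qed
  then have ae: "AE x in lebesgue. x \<in> \<Omega> \<longrightarrow> grad f x = 0"
    by (subst (asm) AE_restrict_space_iff) auto
  define U where "U = \<Omega> \<inter> {x. grad f x \<noteq> 0}"
  have "smooth_on f UNIV" using f by (simp add: test_functions_def)
  then have "open U"
    unfolding U_def using open_domain continuous_on_grad
    by (intro open_Int open_Collect_neq) auto
  moreover have "negligible U"
  proof -
    have "AE x in lebesgue. x \<notin> U" using ae by eventually_elim (auto simp: U_def)
    then have "U \<in> null_sets lebesgue"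
      using AE_iff_null_sets[of U lebesgue] \<open>open U\<close> by auto
    then show ?thesis by (simp add: negligible_iff_null_sets)
  qed
  ultimately have "U = {}" using open_not_negligible by blast
  then have "f x = 0" for x
    by (intro test_function_zero_gradient[OF f]) (auto simp: U_def)
  then have "f = (\<lambda>x. 0)" by auto
  then show False using F by (simp add: F_fun_def)
qed

lemma G_fun_test_cmult:
  assumes f: "f \<in> test_functions \<Omega>" and t: "0 \<le> t"
  shows "G_fun \<Omega> p (\<lambda>x. t * f x) = (LINT x|M. t powr p x / p x * norm (grad f x) powr p x)"
proof -
  have "smooth_on f UNIV" using f by (simp add: test_functions_def)
  then show ?thesis
    using t by (simp add: G_fun_test[OF test_functions_cmult[OF f]] grad_cmult powr_mult)
qed

text \<open>Multiplying by a factor \<open>t >= 1\<close> does not decrease \<open>F\<close>, and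
  \<open>G\<close> depends continuously on \<open>t\<close>; the intermediate value theorem supplies
  the factor that reaches the sphere.\<close>

lemma test_function_scaling:
  assumes f: "f \<in> test_functions \<Omega>" and F: "F_fun \<Omega> q V f > 0" and G: "G_fun \<Omega> p f \<le> \<alpha>"
  shows "\<exists>v\<in>sphere_M \<Omega> p \<alpha>. F_fun \<Omega> q V f \<le> F_fun \<Omega> q V v"
proof -
  define K where "K t = (LINT x|M. t powr p x / p x * norm (grad f x) powr p x)" for t
  note gL = test_function_var_Lebesgue(2)[OF f]
  have [measurable]: "grad f \<in> borel_measurable M" using gL by (simp add: var_Lebesgue_def)
  have K1: "K 1 = G_fun \<Omega> p f" by (simp add: K_def G_fun_test[OF f])
  have Gp: "G_fun \<Omega> p f > 0" by (rule G_fun_test_pos[OF f F])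
  \<comment> \<open>As \<open>T >= 1\<close> and \<open>p >= 1\<close>, the value of
    \<open>G\<close> at \<open>T f\<close> is at least \<open>T\<close> times that at
    \<open>f\<close>, which is \<open>\<alpha>\<close>.\<close>
  define T where "T = \<alpha> / G_fun \<Omega> p f"
  have T: "T \<ge> 1" using G Gp by (simp add: T_def)
  have "T * K 1 = (LINT x|M. T * (1 / p x * norm (grad f x) powr p x))"
    unfolding K_def powr_one_eq_one by (rule integral_mult_right_zero[symmetric])
  also have "\<dots> \<le> K T"
    unfolding K_def
  proof (rule integral_mono)
    show "integrable M (\<lambda>x. T * (1 / p x * norm (grad f x) powr p x))"
      by (rule integrable_mult_right) (use integrable_weighted_powr[OF gL, of 1] in simp)
    show "integrable M (\<lambda>x. T powr p x / p x * norm (grad f x) powr p x)"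
      using integrable_weighted_powr[OF gL, of T] T by simp
    fix x assume "x \<in> space M"
    then have x: "1 \<le> p x" using p_bounds by simp
    then have "T powr 1 \<le> T powr p x" using T by (intro powr_mono) auto
    then have "T * (1 / p x * norm (grad f x) powr p x) \<le> T powr p x * (1 / p x * norm (grad f x) powr p x)"
      using T x by (intro mult_right_mono) auto
    then show "T * (1 / p x * norm (grad f x) powr p x) \<le> T powr p x / p x * norm (grad f x) powr p x"
      by simp
  qed
  finally have "\<alpha> \<le> K T" using K1 Gp by (simp add: T_def)
  moreover have "K 1 \<le> \<alpha>" using G K1 by simp
  moreover have "continuous_on {1..T} K"
  proof (rule continuous_on_sequentiallyI)
    fix s t assume s: "\<forall>n. s n \<in> {1..T}" and t: "t \<in> {1..T}" and st: "s \<longlonglongrightarrow> t"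
    show "(\<lambda>n. K (s n)) \<longlonglongrightarrow> K t"
      unfolding K_def
    proof (rule integral_dominated_convergence[where w = "\<lambda>x. T powr p x / p x * norm (grad f x) powr p x"])
      show "integrable M (\<lambda>x. T powr p x / p x * norm (grad f x) powr p x)"
        using integrable_weighted_powr[OF gL, of T] T by simp
      show "AE x in M. (\<lambda>n. s n powr p x / p x * norm (grad f x) powr p x) \<longlonglongrightarrow> t powr p x / p x * norm (grad f x) powr p x"
      proof (rule AE_I2)
        fix x assume "x \<in> space M"
        then have "p x > 0" using p_bounds[of x] by simp
        then show "(\<lambda>n. s n powr p x / p x * norm (grad f x) powr p x) \<longlonglongrightarrow> t powr p x / p x * norm (grad f x) powr p x"
          using st t by (intro tendsto_intros) auto
      qed
      show "AE x in M. norm (s n powr p x / p x * norm (grad f x) powr p x) \<le> T powr p x / p x * norm (grad f x) powr p x" for n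
      proof (rule AE_I2)
        fix x assume "x \<in> space M"
        then have x: "1 \<le> p x" using p_bounds by simp
        have "s n powr p x \<le> T powr p x"
          using s[rule_format, of n] x by (intro powr_mono2) auto
        then have "s n powr p x / p x * norm (grad f x) powr p x \<le> T powr p x / p x * norm (grad f x) powr p x"
          using x by (intro mult_right_mono divide_right_mono) auto
        then show "norm (s n powr p x / p x * norm (grad f x) powr p x) \<le> T powr p x / p x * norm (grad f x) powr p x"
          using x by simp
      qed
    qed measurable
  qed
  ultimately obtain t where t: "1 \<le> t" "t \<le> T" "K t = \<alpha>"
    using IVT'[of K 1 \<alpha> T] T by blast
  define v where "v = (\<lambda>x. t * f x)"
  have v: "v \<in> test_functions \<Omega>" unfolding v_def by (rule test_functions_cmult[OF f])
  have "G_fun \<Omega> p v = \<alpha>"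
    using t G_fun_test_cmult[OF f, of t] by (simp add: v_def K_def)
  then have "v \<in> sphere_M \<Omega> p \<alpha>"
    using test_function_var_Sobolev0(1)[OF v] by (simp add: sphere_M_def)
  moreover have "F_fun \<Omega> q V f \<le> F_fun \<Omega> q V v"
    unfolding F_fun_def
  proof (rule integral_mono_AE[OF integrable_F_test[OF f] integrable_F_test[OF v]])
    show "AE x in M. V x / q x * \<bar>f x\<bar> powr q x \<le> V x / q x * \<bar>v x\<bar> powr q x"
      using V_pos AE_space
    proof eventually_elim
      case (elim x)
      then have x: "1 \<le> q x" using q_bounds by simp
      have "\<bar>f x\<bar> \<le> \<bar>v x\<bar>"
        using t mult_right_mono[of 1 t "\<bar>f x\<bar>"] by (simp add: v_def abs_mult)
      then show ?case using x elim by (intro mult_left_mono powr_mono2) auto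
    qed
  qed
  ultimately show ?thesis by blast
qed

text \<open>A bound for \<open>F\<close> on the sphere is also one for test functions inside it.
  \<open>0 <= m\<close> handles those with \<open>F f = 0\<close>, to which the scaling does not
  apply.\<close>

lemma F_fun_test_le:
  assumes f: "f \<in> test_functions \<Omega>" and G: "G_fun \<Omega> p f \<le> \<alpha>"
    and F: "\<And>v. v \<in> sphere_M \<Omega> p \<alpha> \<Longrightarrow> F_fun \<Omega> q V v \<le> m" "0 \<le> m"
  shows "F_fun \<Omega> q V f \<le> m"
  using test_function_scaling[OF f _ G] F by (meson le_less_linear order_trans)

text \<open>Makes the maximum of \<open>F\<close> positive. A bump on a small box has positive
  \<open>F\<close> since \<open>V > 0\<close> a.e.; it is first shrunk into the region
  \<open>G <= \<alpha>\<close>, then scaled to the sphere.\<close>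

lemma exists_positive_on_sphere: "\<exists>v\<in>sphere_M \<Omega> p \<alpha>. F_fun \<Omega> q V v > 0"
proof -
  obtain x0 where "x0 \<in> \<Omega>" using nonempty by blast
  then obtain c d where cd: "x0 \<in> box c d" "cbox c d \<subseteq> \<Omega>"
    using open_contains_cbox[OF open_domain] by metis
  define f where "f = box_bump 0 c d"
  have f: "f \<in> test_functions \<Omega>" unfolding f_def by (rule box_bump_test[OF cd(2)])
  have Fp: "F_fun \<Omega> q V (\<lambda>x. t * f x) > 0" if t: "t > 0" for t
  proof (rule ccontr)
    assume "\<not> ?thesis"
    then have "F_fun \<Omega> q V (\<lambda>x. t * f x) = 0" using F_fun_nonneg[of "\<lambda>x. t * f x"] by simp
    then have "AE x in M. V x / q x * \<bar>t * f x\<bar> powr q x = 0"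
      using integral_nonneg_eq_0_iff_AE[OF integrable_F_test[OF test_functions_cmult[OF f, of t]] F_nonneg_AE]
      by (simp add: F_fun_def)
    then have "AE x in M. x \<notin> box c d"
      using V_pos AE_space
    proof eventually_elim
      case (elim x)
      have "x \<in> \<Omega>" "V x > 0" using elim by auto
      then have "\<bar>t * f x\<bar> powr q x = 0" using elim(1) q_bounds[of x] by simp
      then show ?case using box_bump_pos[of x c d 0] t by (auto simp: f_def)
    qed
    then have "AE x in lebesgue. x \<in> \<Omega> \<longrightarrow> x \<notin> box c d"
      by (subst (asm) AE_restrict_space_iff) auto
    then have "AE x in lebesgue. x \<notin> box c d"
      by eventually_elim (use cd(2) box_subset_cbox[of c d] in blast)
    then have "negligible (box c d)"
      using AE_iff_null_sets[of "box c d" lebesgue] by (simp add: negligible_iff_null_sets)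
    then show False using open_not_negligible[OF open_box] cd(1) by blast
  qed
  \<comment> \<open>For \<open>t <= 1\<close> one has \<open>t powr p x <= t\<close>, so
    \<open>G\<close> at \<open>t f\<close> is at most \<open>t\<close> times \<open>G f\<close>,
    hence at most \<open>\<alpha>\<close>.\<close>
  define t where "t = 1 / max 1 (G_fun \<Omega> p f / \<alpha>)"
  have t: "0 < t" "t \<le> 1" by (auto simp: t_def)
  have gL: "grad f \<in> var_Lebesgue \<Omega> p" by (rule test_function_var_Lebesgue(2)[OF f])
  have "G_fun \<Omega> p (\<lambda>x. t * f x) \<le> (LINT x|M. t * (1 / p x * norm (grad f x) powr p x))"
    unfolding G_fun_test_cmult[OF f less_imp_le[OF t(1)]]
  proof (rule integral_mono)
    show "integrable M (\<lambda>x. t * (1 / p x * norm (grad f x) powr p x))"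
      by (rule integrable_mult_right) (use integrable_weighted_powr[OF gL, of 1] in simp)
    show "integrable M (\<lambda>x. t powr p x / p x * norm (grad f x) powr p x)"
      using integrable_weighted_powr[OF gL, of t] t by simp
    fix x assume "x \<in> space M"
    then have x: "1 \<le> p x" using p_bounds by simp
    then have "t powr p x \<le> t powr 1" using t by (intro powr_mono') auto
    then have "t powr p x * (1 / p x * norm (grad f x) powr p x) \<le> t * (1 / p x * norm (grad f x) powr p x)"
      using t x by (intro mult_right_mono) auto
    then show "t powr p x / p x * norm (grad f x) powr p x \<le> t * (1 / p x * norm (grad f x) powr p x)"
      by simp
  qed
  also have "\<dots> = t * G_fun \<Omega> p f"
    unfolding G_fun_test[OF f] by (rule integral_mult_right_zero)
  also have "\<dots> \<le> \<alpha>"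
    using alpha_pos by (simp add: t_def field_simps max_def)
  finally have "G_fun \<Omega> p (\<lambda>x. t * f x) \<le> \<alpha>" .
  then obtain v where "v \<in> sphere_M \<Omega> p \<alpha>" "F_fun \<Omega> q V (\<lambda>x. t * f x) \<le> F_fun \<Omega> q V v"
    using test_function_scaling[OF test_functions_cmult[OF f] Fp[OF t(1)]] by blast
  then show ?thesis using Fp[OF t(1)] by (meson less_le_trans)
qed

text \<open>Hidden convexity for \<open>a u\<close> and \<open>b w\<close>, whose factors are kept
  as weights under the integrals. Smoothed power means \<open>N n\<close> of approximating test
  functions eventually have \<open>G\<close> below \<open>\<alpha>\<close>, hence \<open>F\<close>
  at most \<open>m\<close>, and this bound survives the limit.\<close>

lemma midpoint_inequality:
  assumes u: "u \<in> var_Sobolev0 \<Omega> p" and w: "w \<in> var_Sobolev0 \<Omega> p" and ab: "0 < a" "0 < b"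
    and iu: "integrable M (\<lambda>x. V x / q x * \<bar>u x\<bar> powr q x)" and iw: "integrable M (\<lambda>x. V x / q x * \<bar>w x\<bar> powr q x)"
    and G: "(LINT x|M. a powr p x / p x * norm (weak_gradient \<Omega> u x) powr p x) +
      (LINT x|M. b powr p x / p x * norm (weak_gradient \<Omega> w x) powr p x) < 2 * \<alpha>"
    and F: "\<And>v. v \<in> sphere_M \<Omega> p \<alpha> \<Longrightarrow> F_fun \<Omega> q V v \<le> m" "0 \<le> m"
  shows "(LINT x|M. a powr q x * (V x / q x * \<bar>u x\<bar> powr q x)) + (LINT x|M. b powr q x * (V x / q x * \<bar>w x\<bar> powr q x)) \<le> 2 * m"
proof -
  have um [measurable]: "u \<in> borel_measurable M" "w \<in> borel_measurable M"
    using u w by (auto simp: var_Sobolev0_def var_Sobolev_def var_Lebesgue_def)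
  obtain f where f: "\<And>n. f n \<in> test_functions \<Omega>" "AE x in M. (\<lambda>n. f n x) \<longlonglongrightarrow> u x"
    "\<And>h B. h \<in> borel_measurable M \<Longrightarrow> (\<And>x. x \<in> \<Omega> \<Longrightarrow> \<bar>h x\<bar> \<le> B) \<Longrightarrow>
      (\<lambda>n. LINT x|M. h x * norm (grad (f n) x) powr p x) \<longlonglongrightarrow> (LINT x|M. h x * norm (weak_gradient \<Omega> u x) powr p x)"
    using var_Sobolev0_sequence[OF u] by blast
  obtain g where g: "\<And>n. g n \<in> test_functions \<Omega>" "AE x in M. (\<lambda>n. g n x) \<longlonglongrightarrow> w x"
    "\<And>h B. h \<in> borel_measurable M \<Longrightarrow> (\<And>x. x \<in> \<Omega> \<Longrightarrow> \<bar>h x\<bar> \<le> B) \<Longrightarrow>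
      (\<lambda>n. LINT x|M. h x * norm (grad (g n) x) powr p x) \<longlonglongrightarrow> (LINT x|M. h x * norm (weak_gradient \<Omega> w x) powr p x)"
    using var_Sobolev0_sequence[OF w] by blast
  have weight: "\<bar>c powr p x / p x\<bar> \<le> (max 1 c) powr P" if x: "x \<in> \<Omega>" and c: "c > 0" for c x
  proof -
    have "c powr p x \<le> (max 1 c) powr p x"
      using p_bounds[OF x] c by (intro powr_mono2) auto
    also have "\<dots> \<le> (max 1 c) powr P"
      using p_bounds[OF x] by (intro powr_mono) auto
    finally have "1 / p x * c powr p x \<le> 1 * (max 1 c) powr P"
      using p_bounds[OF x] by (intro mult_mono) auto
    then show ?thesis using p_bounds[OF x] by simp
  qed
  have wm: "(\<lambda>x. c powr p x / p x) \<in> borel_measurable M" for c by measurable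
  \<comment> \<open>The smoothing disappears along the same index as the approximation
    error.\<close>
  define e where "e n = inverse (real (Suc n))" for n
  have e: "e \<longlonglongrightarrow> 0" "e n > 0" for n
    unfolding e_def by (rule LIMSEQ_inverse_real_of_nat) simp
  define N where "N n = smooth_power_mean r (e n) (\<lambda>x. a * f n x) (\<lambda>x. b * g n x)" for n
  have N: "N n \<in> test_functions \<Omega>" for n
    unfolding N_def by (rule smooth_power_mean_test[OF test_functions_cmult[OF f(1)] test_functions_cmult[OF g(1)] e(2) r_ge_1])
  have Nm [measurable]: "N n \<in> borel_measurable M" for n using test_function_bounded(1)[OF N] .
  define \<gamma> where "\<gamma> n = (LINT x|M. a powr p x / p x * norm (grad (f n) x) powr p x) / 2 +
      (LINT x|M. b powr p x / p x * norm (grad (g n) x) powr p x) / 2" for n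
  have "\<gamma> \<longlonglongrightarrow> (LINT x|M. a powr p x / p x * norm (weak_gradient \<Omega> u x) powr p x) / 2 +
      (LINT x|M. b powr p x / p x * norm (weak_gradient \<Omega> w x) powr p x) / 2"
    unfolding \<gamma>_def
    by (intro tendsto_add tendsto_divide tendsto_const f(3)[where B = "(max 1 a) powr P"] g(3)[where B = "(max 1 b) powr P"] weight ab wm)
      auto
  \<comment> \<open>The hypothesis on \<open>G\<close> is strict so that it persists for the
    approximating functions.\<close>
  then have ev: "\<forall>\<^sub>F n in sequentially. \<gamma> n < \<alpha>"
    by (rule order_tendstoD) (use G in simp)
  have GN: "G_fun \<Omega> p (N n) \<le> \<gamma> n" for n
  proof -
    note gf = test_function_var_Lebesgue(2)[OF f(1)] and gg = test_function_var_Lebesgue(2)[OF g(1)]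
    have sf: "smooth_on (f n) UNIV" "smooth_on (g n) UNIV" for n using f(1) g(1) by (auto simp: test_functions_def)
    have i: "integrable M (\<lambda>x. a powr p x / p x * norm (grad (f n) x) powr p x)"
      "integrable M (\<lambda>x. b powr p x / p x * norm (grad (g n) x) powr p x)"
      using integrable_weighted_powr[OF gf] integrable_weighted_powr[OF gg] ab by auto
    have "G_fun \<Omega> p (N n) \<le> (LINT x|M. (a powr p x / p x * norm (grad (f n) x) powr p x) / 2 + (b powr p x / p x * norm (grad (g n) x) powr p x) / 2)"
      unfolding G_fun_test[OF N]
    proof (rule integral_mono)
      show "integrable M (\<lambda>x. 1 / p x * norm (grad (N n) x) powr p x)"
        using integrable_weighted_powr[OF test_function_var_Lebesgue(2)[OF N], of 1] by simp
      show "integrable M (\<lambda>x. (a powr p x / p x * norm (grad (f n) x) powr p x) / 2 + (b powr p x / p x * norm (grad (g n) x) powr p x) / 2)"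
        using i by (simp del: times_divide_eq_left times_divide_eq_right divide_divide_eq_left)
      fix x assume "x \<in> space M"
      then have x: "x \<in> \<Omega>" by simp
      have "norm (grad (N n) x) powr p x \<le> norm (grad (\<lambda>x. a * f n x) x) powr p x / 2 + norm (grad (\<lambda>x. b * g n x) x) powr p x / 2"
        unfolding N_def using sf by (intro norm_grad_smooth_power_mean_le smooth_mult smooth_const e r_ge_1 r_le_p x)
      also have "\<dots> = a powr p x * norm (grad (f n) x) powr p x / 2 + b powr p x * norm (grad (g n) x) powr p x / 2"
        using ab by (simp add: grad_cmult sf powr_mult)
      finally have "1 / p x * norm (grad (N n) x) powr p x \<le> 1 / p x * (a powr p x * norm (grad (f n) x) powr p x / 2 + b powr p x * norm (grad (g n) x) powr p x / 2)"
        using p_bounds[OF x] by (intro mult_left_mono) auto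
      then show "1 / p x * norm (grad (N n) x) powr p x \<le> (a powr p x / p x * norm (grad (f n) x) powr p x) / 2 + (b powr p x / p x * norm (grad (g n) x) powr p x) / 2"
        by (simp add: distrib_left)
    qed
    also have "\<dots> = \<gamma> n" using i by (simp add: \<gamma>_def del: times_divide_eq_left times_divide_eq_right divide_divide_eq_left)
    finally show ?thesis .
  qed
  have evF: "\<forall>\<^sub>F n in sequentially. (\<integral>\<^sup>+ x. ennreal (V x / q x * \<bar>N n x\<bar> powr q x) \<partial>M) \<le> ennreal m"
    using ev
  proof eventually_elim
    case (elim n)
    then have "G_fun \<Omega> p (N n) \<le> \<alpha>" using GN[of n] by simp
    then have "F_fun \<Omega> q V (N n) \<le> m" by (rule F_fun_test_le[OF N _ F])
    moreover have "(\<integral>\<^sup>+ x. ennreal (V x / q x * \<bar>N n x\<bar> powr q x) \<partial>M) = ennreal (F_fun \<Omega> q V (N n))"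
      unfolding F_fun_def by (rule nn_integral_eq_integral[OF integrable_F_test[OF N] F_nonneg_AE])
    ultimately show ?case by (simp add: ennreal_leI)
  qed
  define s where "s x = power_mean r (a * \<bar>u x\<bar>) (b * \<bar>w x\<bar>)" for x
  have lim: "AE x in M. (\<lambda>n. N n x) \<longlonglongrightarrow> s x"
    using f(2) g(2)
  proof eventually_elim
    case (elim x)
    have "(\<lambda>n. N n x) \<longlonglongrightarrow> power_mean r \<bar>a * u x\<bar> \<bar>b * w x\<bar>"
      unfolding N_def by (rule smooth_power_mean_tendsto) (use elim e r_ge_1 in \<open>auto intro: tendsto_mult\<close>)
    then show ?case using ab by (simp add: s_def abs_mult)
  qed
  have iu': "integrable M (\<lambda>x. a powr q x * (V x / q x * \<bar>u x\<bar> powr q x))"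
    and iw': "integrable M (\<lambda>x. b powr q x * (V x / q x * \<bar>w x\<bar> powr q x))"
  proof -
    have bd: "\<bar>c powr q x\<bar> \<le> (max 1 c) powr r" if x: "x \<in> \<Omega>" and c: "c > 0" for c x
    proof -
      have "c powr q x \<le> (max 1 c) powr q x" using c q_bounds[OF x] by (intro powr_mono2) auto
      also have "\<dots> \<le> (max 1 c) powr r" using q_bounds[OF x] by (intro powr_mono) auto
      finally show ?thesis by simp
    qed
    show "integrable M (\<lambda>x. a powr q x * (V x / q x * \<bar>u x\<bar> powr q x))"
      by (rule integrable_bounded_mult[OF iu _ bd[OF _ ab(1)]]) measurable
    show "integrable M (\<lambda>x. b powr q x * (V x / q x * \<bar>w x\<bar> powr q x))"
      by (rule integrable_bounded_mult[OF iw _ bd[OF _ ab(2)]]) measurable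
  qed
  define h where "h x = (a powr q x * (V x / q x * \<bar>u x\<bar> powr q x)) / 2 + (b powr q x * (V x / q x * \<bar>w x\<bar> powr q x)) / 2" for x
  have hi: "integrable M h" unfolding h_def using iu' iw' by (simp del: times_divide_eq_left times_divide_eq_right divide_divide_eq_left)
  have h0: "AE x in M. 0 \<le> h x"
    using F_nonneg_AE[of u] F_nonneg_AE[of w] by eventually_elim (simp add: h_def del: times_divide_eq_left times_divide_eq_right divide_divide_eq_left)
  have "ennreal (LINT x|M. h x) = (\<integral>\<^sup>+ x. ennreal (h x) \<partial>M)"
    by (rule nn_integral_eq_integral[OF hi h0, symmetric])
  also have "\<dots> \<le> (\<integral>\<^sup>+ x. liminf (\<lambda>n. ennreal (V x / q x * \<bar>N n x\<bar> powr q x)) \<partial>M)"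
  proof (rule nn_integral_mono_AE)
    \<comment> \<open>The limit of \<open>N n\<close> is the power mean of the moduli of
      \<open>a u\<close> and \<open>b w\<close>; by \<open>power_mean_ge\<close> its
      \<open>F\<close> integrand dominates the average \<open>h\<close> of the two separate
      ones.\<close>
    show "AE x in M. ennreal (h x) \<le> liminf (\<lambda>n. ennreal (V x / q x * \<bar>N n x\<bar> powr q x))"
      using lim V_pos AE_space
    proof eventually_elim
      case (elim x)
      then have x: "x \<in> \<Omega>" "V x > 0" and qx: "1 \<le> q x" "q x \<le> r" using q_bounds by auto
      have "s x \<ge> 0" by (simp add: s_def power_mean_def)
      have "(\<lambda>n. V x / q x * \<bar>N n x\<bar> powr q x) \<longlonglongrightarrow> V x / q x * \<bar>s x\<bar> powr q x"
        using elim(1) qx by (intro tendsto_mult tendsto_const tendsto_powr' tendsto_rabs) auto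
      then have "(\<lambda>n. ennreal (V x / q x * \<bar>N n x\<bar> powr q x)) \<longlonglongrightarrow> ennreal (V x / q x * \<bar>s x\<bar> powr q x)"
        by (rule tendsto_ennrealI)
      then have "liminf (\<lambda>n. ennreal (V x / q x * \<bar>N n x\<bar> powr q x)) = ennreal (V x / q x * \<bar>s x\<bar> powr q x)"
        by (intro lim_imp_Liminf) auto
      moreover have "h x = V x / q x * ((a * \<bar>u x\<bar>) powr q x / 2 + (b * \<bar>w x\<bar>) powr q x / 2)"
        using ab by (simp add: h_def powr_mult add_divide_distrib distrib_left mult.left_commute)
      moreover have "(a * \<bar>u x\<bar>) powr q x / 2 + (b * \<bar>w x\<bar>) powr q x / 2 \<le> \<bar>s x\<bar> powr q x"
        using power_mean_ge[OF qx, of "a * \<bar>u x\<bar>" "b * \<bar>w x\<bar>"] ab \<open>s x \<ge> 0\<close> by (simp add: s_def)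
      ultimately show ?case
        using x qx by (simp add: ennreal_leI mult_left_mono del: times_divide_eq_left)
    qed
  qed
  \<comment> \<open>Fatou's lemma: only lower semicontinuity of \<open>F\<close> along
    \<open>N n\<close> is required.\<close>
  also have "\<dots> \<le> liminf (\<lambda>n. \<integral>\<^sup>+ x. ennreal (V x / q x * \<bar>N n x\<bar> powr q x) \<partial>M)"
    by (rule nn_integral_liminf) measurable
  also have "\<dots> \<le> ennreal m" by (rule Liminf_le[OF _ evF]) simp
  finally have "(LINT x|M. h x) \<le> m" using F(2) by (simp add: ennreal_le_iff)
  then show ?thesis using iu' iw' by (simp add: h_def del: times_divide_eq_left times_divide_eq_right divide_divide_eq_left)
qed

end

section \<open>Equality of the multipliers\<close>

lemma exp_le_quadratic:
  fixes y :: real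
  assumes "\<bar>y\<bar> \<le> 1"
  shows "exp y \<le> 1 + y + y\<^sup>2"
proof (cases "y \<ge> 0")
  case True then show ?thesis using exp_bound assms by auto
next
  case False
  define z where "z = - y"
  have z: "0 < z" "z \<le> 1" using False assms by (auto simp: z_def)
  \<comment> \<open>The product equals 1 + z^3.\<close>
  have "1 \<le> (1 + z) * (1 - z + z\<^sup>2)"
    using z by (simp add: algebra_simps power2_eq_square)
  also have "\<dots> \<le> exp z * (1 - z + z\<^sup>2)"
    using z by (intro mult_right_mono) (auto simp: exp_ge_add_one_self)
  finally have "exp (- z) * 1 \<le> exp (- z) * (exp z * (1 - z + z\<^sup>2))"
    by (intro mult_left_mono) auto
  also have "\<dots> = 1 - z + z\<^sup>2" by (simp add: exp_minus)
  finally show ?thesis by (simp add: z_def)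
qed

text \<open>An explicit second order remainder, uniform over bounded exponents, stands in for
  differentiation of \<open>G\<close> under the integral.\<close>

lemma powr_le_quadratic:
  fixes t p :: real
  assumes "1 \<le> p" "\<bar>p * t\<bar> \<le> 1" "-1 < t"
  shows "(1 + t) powr p \<le> 1 + p * t + (p * t)\<^sup>2"
proof -
  have "(1 + t) powr p = exp (p * ln (1 + t))" using assms by (simp add: powr_def)
  also have "\<dots> \<le> exp (p * t)" using assms ln_add_one_self_le_self2[of t] by (simp add: mult_left_mono)
  also have "\<dots> \<le> 1 + p * t + (p * t)\<^sup>2" using assms by (intro exp_le_quadratic)
  finally show ?thesis .
qed

text \<open>Bernoulli's inequality: the graph lies above its tangent at 1. For \<open>F\<close> a
  lower bound is wanted, so there is no remainder.\<close>

lemma powr_ge_linear: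
  fixes t q :: real
  assumes "1 \<le> q" "-1 < t"
  shows "1 + q * t \<le> (1 + t) powr q"
proof -
  have "((\<lambda>x. x powr q) has_real_derivative q * 1 powr (q - 1)) (at 1 within {0<..})"
    by (rule has_field_derivative_at_within, rule has_real_derivative_powr) simp
  then have "q * (1 + t - 1) \<le> (1 + t) powr q - 1 powr q"
    using powr_convex[OF assms(1)] assms
    by (intro convex_on_imp_above_tangent[where A = "{0<..}"]) (auto simp: interior_open)
  then show ?thesis by simp
qed

context eigen_setting
begin

section \<open>First variations along rays\<close>

lemma sphere_weak_gradient:
  assumes "u \<in> sphere_M \<Omega> p \<alpha>"
  shows "weak_gradient \<Omega> u \<in> var_Lebesgue \<Omega> p"
  using assms var_SobolevD(3) by (auto simp: sphere_M_def var_Sobolev0_def)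

lemma integrable_G:
  assumes u: "u \<in> sphere_M \<Omega> p \<alpha>"
  shows "integrable M (\<lambda>x. 1 / p x * norm (weak_gradient \<Omega> u x) powr p x)"
  using integrable_weighted_powr[OF sphere_weak_gradient[OF u], of 1] by simp

lemma psi_fun_pos:
  assumes u: "u \<in> sphere_M \<Omega> p \<alpha>"
  shows "0 < psi_fun \<Omega> p u"
proof -
  have "\<alpha> = (LINT x|M. 1 / p x * norm (weak_gradient \<Omega> u x) powr p x)"
    using u by (simp add: sphere_M_def G_fun_def)
  also have "\<dots> \<le> psi_fun \<Omega> p u"
    unfolding psi_fun_def
  proof (rule integral_mono[OF integrable_G[OF u] integrable_powr[OF sphere_weak_gradient[OF u]]])
    fix x assume "x \<in> space M"
    then have "1 / p x \<le> 1" using p_bounds[of x] by simp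
    then have "1 / p x * norm (weak_gradient \<Omega> u x) powr p x \<le> 1 * norm (weak_gradient \<Omega> u x) powr p x"
      by (rule mult_right_mono) simp
    then show "1 / p x * norm (weak_gradient \<Omega> u x) powr p x \<le> norm (weak_gradient \<Omega> u x) powr p x"
      by simp
  qed
  finally show ?thesis using alpha_pos by simp
qed

lemma integrable_phi:
  assumes "integrable M (\<lambda>x. V x / q x * \<bar>u x\<bar> powr q x)"
  shows "integrable M (\<lambda>x. V x * \<bar>u x\<bar> powr q x)"
proof -
  have "integrable M (\<lambda>x. q x * (V x / q x * \<bar>u x\<bar> powr q x))"
  proof (rule integrable_bounded_mult[OF assms])
    show "\<bar>q x\<bar> \<le> r" if "x \<in> \<Omega>" for x using q_bounds[OF that] by simp
  qed measurable
  moreover have "q x * (V x / q x * \<bar>u x\<bar> powr q x) = V x * \<bar>u x\<bar> powr q x" if "x \<in> space M" for x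
    using q_bounds[of x] that by simp
  ultimately show ?thesis
    by (subst Bochner_Integration.integrable_cong[where g = "\<lambda>x. q x * (V x / q x * \<bar>u x\<bar> powr q x)", OF refl]) simp_all
qed

lemma phi_fun_pos:
  assumes i: "integrable M (\<lambda>x. V x / q x * \<bar>u x\<bar> powr q x)" and F: "0 < F_fun \<Omega> q V u"
  shows "0 < phi_fun \<Omega> q V u"
proof -
  have "F_fun \<Omega> q V u \<le> phi_fun \<Omega> q V u"
    unfolding F_fun_def phi_fun_def
  proof (rule integral_mono_AE[OF i integrable_phi[OF i]])
    show "AE x in M. V x / q x * \<bar>u x\<bar> powr q x \<le> V x * \<bar>u x\<bar> powr q x"
      using V_pos AE_space
    proof eventually_elim
      case (elim x)
      then have "V x / q x \<le> V x" using q_bounds[of x] by (simp add: divide_le_eq)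
      then show ?case by (rule mult_right_mono) simp
    qed
  qed
  then show ?thesis using F by simp
qed

text \<open>The slope is \<open>psi\<close> since the factor \<open>p x\<close> of the linear term
  cancels \<open>1 / p x\<close>; the quadratic term becomes \<open>p x\<close> times t^2, whence
  the constant \<open>P\<close>.\<close>

lemma G_perturbation:
  assumes u: "u \<in> sphere_M \<Omega> p \<alpha>" and t: "\<bar>t\<bar> \<le> 1 / (2 * P)"
  shows "(LINT x|M. (1 + t) powr p x / p x * norm (weak_gradient \<Omega> u x) powr p x) \<le>
    \<alpha> + t * psi_fun \<Omega> p u + P * t\<^sup>2 * psi_fun \<Omega> p u"
proof -
  let ?n = "\<lambda>x. norm (weak_gradient \<Omega> u x) powr p x"
  have ipsi: "integrable M ?n" by (rule integrable_powr[OF sphere_weak_gradient[OF u]])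
  have "1 / (2 * P) \<le> 1 / 2" using P_ge_1 by (simp add: field_simps)
  then have t1: "- 1 < t" "0 \<le> 1 + t" using t by auto
  have "(LINT x|M. (1 + t) powr p x / p x * ?n x) \<le> (LINT x|M. 1 / p x * ?n x + (t + P * t\<^sup>2) * ?n x)"
  proof (rule integral_mono)
    show "integrable M (\<lambda>x. (1 + t) powr p x / p x * ?n x)"
      by (rule integrable_weighted_powr[OF sphere_weak_gradient[OF u] t1(2)])
    show "integrable M (\<lambda>x. 1 / p x * ?n x + (t + P * t\<^sup>2) * ?n x)"
      by (intro Bochner_Integration.integrable_add integrable_G[OF u] integrable_mult_right ipsi)
    fix x assume "x \<in> space M"
    then have x: "1 \<le> p x" "p x \<le> P" using p_bounds by auto
    \<comment> \<open>The restriction on \<open>t\<close> is chosen so that \<open>p x * t\<close>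
      stays in the range of the quadratic bound for all \<open>x\<close> at once.\<close>
    have "\<bar>p x * t\<bar> \<le> P * (1 / (2 * P))"
      unfolding abs_mult using x t by (intro mult_mono) auto
    then have "\<bar>p x * t\<bar> \<le> 1" using P_ge_1 by simp
    then have "(1 + t) powr p x \<le> 1 + p x * t + (p x * t)\<^sup>2"
      using x t1 by (intro powr_le_quadratic)
    then have "(1 + t) powr p x / p x \<le> (1 + p x * t + (p x * t)\<^sup>2) / p x"
      using x by (intro divide_right_mono) auto
    also have "\<dots> = 1 / p x + t + p x * t\<^sup>2"
      using x by (simp add: field_simps power2_eq_square)
    also have "\<dots> \<le> 1 / p x + (t + P * t\<^sup>2)"
      using x by (simp add: mult_right_mono)
    finally have "(1 + t) powr p x / p x * ?n x \<le> (1 / p x + (t + P * t\<^sup>2)) * ?n x"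
      by (rule mult_right_mono) simp
    then show "(1 + t) powr p x / p x * ?n x \<le> 1 / p x * ?n x + (t + P * t\<^sup>2) * ?n x"
      by (simp add: distrib_right)
  qed
  also have "\<dots> = (LINT x|M. 1 / p x * ?n x) + (LINT x|M. (t + P * t\<^sup>2) * ?n x)"
    by (intro Bochner_Integration.integral_add integrable_G[OF u] integrable_mult_right ipsi)
  also have "(LINT x|M. 1 / p x * ?n x) = \<alpha>"
    using u by (simp add: sphere_M_def G_fun_def)
  also have "(LINT x|M. (t + P * t\<^sup>2) * ?n x) = (t + P * t\<^sup>2) * psi_fun \<Omega> p u"
    unfolding psi_fun_def by (rule integral_mult_right_zero)
  finally show ?thesis by (simp add: algebra_simps)
qed

text \<open>Bernoulli's inequality under the integral; the factor \<open>q x\<close> cancels the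
  denominator, so the slope is \<open>phi\<close>.\<close>

lemma F_perturbation:
  assumes i: "integrable M (\<lambda>x. V x / q x * \<bar>u x\<bar> powr q x)" and t: "\<bar>t\<bar> < 1"
  shows "F_fun \<Omega> q V u + t * phi_fun \<Omega> q V u \<le> (LINT x|M. (1 + t) powr q x * (V x / q x * \<bar>u x\<bar> powr q x))"
proof -
  have "F_fun \<Omega> q V u + t * phi_fun \<Omega> q V u =
      (LINT x|M. V x / q x * \<bar>u x\<bar> powr q x) + (LINT x|M. t * (V x * \<bar>u x\<bar> powr q x))"
    unfolding F_fun_def phi_fun_def by (subst integral_mult_right_zero) simp
  also have "\<dots> = (LINT x|M. V x / q x * \<bar>u x\<bar> powr q x + t * (V x * \<bar>u x\<bar> powr q x))"
    by (intro Bochner_Integration.integral_add[symmetric] i integrable_mult_right integrable_phi[OF i])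
  also have "\<dots> \<le> (LINT x|M. (1 + t) powr q x * (V x / q x * \<bar>u x\<bar> powr q x))"
  proof (rule integral_mono_AE)
    show "integrable M (\<lambda>x. V x / q x * \<bar>u x\<bar> powr q x + t * (V x * \<bar>u x\<bar> powr q x))"
      by (intro Bochner_Integration.integrable_add i integrable_mult_right integrable_phi[OF i])
    show "integrable M (\<lambda>x. (1 + t) powr q x * (V x / q x * \<bar>u x\<bar> powr q x))"
    proof (rule integrable_bounded_mult[OF i])
      fix x assume x: "x \<in> \<Omega>"
      have "(1 + t) powr q x \<le> 2 powr q x" using t q_bounds[OF x] by (intro powr_mono2) auto
      also have "\<dots> \<le> 2 powr r" using q_bounds[OF x] by (intro powr_mono) auto
      finally show "\<bar>(1 + t) powr q x\<bar> \<le> 2 powr r" by simp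
    qed measurable
    show "AE x in M. V x / q x * \<bar>u x\<bar> powr q x + t * (V x * \<bar>u x\<bar> powr q x) \<le> (1 + t) powr q x * (V x / q x * \<bar>u x\<bar> powr q x)"
      using F_nonneg_AE[of u] AE_space
    proof eventually_elim
      case (elim x)
      then have x: "1 \<le> q x" using q_bounds by simp
      then have "(1 + q x * t) * (V x / q x * \<bar>u x\<bar> powr q x) \<le> (1 + t) powr q x * (V x / q x * \<bar>u x\<bar> powr q x)"
        using t elim(1) by (intro mult_right_mono powr_ge_linear) auto
      then show ?case using x by (simp add: field_simps)
    qed
  qed
  finally show ?thesis .
qed

text \<open>If the multipliers differed, moving from \<open>u\<close> outwards and from \<open>w\<close> inwards at suitable rates
  would decrease the mean of \<open>G\<close> and increase that of \<open>F\<close>, contradicting the midpoint inequality.\<close>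

lemma maximizer_multiplier_le:
  assumes u: "u \<in> sphere_M \<Omega> p \<alpha>" and w: "w \<in> sphere_M \<Omega> p \<alpha>"
    and Fu: "F_fun \<Omega> q V u = m" and Fw: "F_fun \<Omega> q V w = m" and m: "0 < m"
    and max: "\<And>v. v \<in> sphere_M \<Omega> p \<alpha> \<Longrightarrow> F_fun \<Omega> q V v \<le> m"
  shows "phi_fun \<Omega> q V u * psi_fun \<Omega> p w \<le> phi_fun \<Omega> q V w * psi_fun \<Omega> p u"
proof (rule ccontr)
  define fu where "fu = phi_fun \<Omega> q V u"
  define fw where "fw = phi_fun \<Omega> q V w"
  define gu where "gu = psi_fun \<Omega> p u"
  define gw where "gw = psi_fun \<Omega> p w"
  \<comment> \<open>A non-integrable function has Bochner integral 0, so a positive value of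
    \<open>F\<close> forces integrability.\<close>
  have i: "integrable M (\<lambda>x. V x / q x * \<bar>u x\<bar> powr q x)" "integrable M (\<lambda>x. V x / q x * \<bar>w x\<bar> powr q x)"
    using Fu Fw m not_integrable_integral_eq unfolding F_fun_def by fastforce+
  have pos: "fu > 0" "fw > 0" "gu > 0" "gw > 0"
    using phi_fun_pos[OF i(1)] phi_fun_pos[OF i(2)] Fu Fw m psi_fun_pos[OF u] psi_fun_pos[OF w]
    by (auto simp: fu_def fw_def gu_def gw_def)
  assume "\<not> ?thesis"
  then have "gu / gw < fu / fw"
    using pos by (simp add: fu_def fw_def gu_def gw_def field_simps)
  \<comment> \<open>The number \<open>c\<close> is the rate at which \<open>w\<close> shrinks
    relative to the growth of \<open>u\<close>.\<close>
  then obtain c where c: "gu / gw < c" "c < fu / fw" using dense by blast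
  have c0: "c > 0" using c(1) pos by (meson divide_pos_pos less_trans)
  have cd: "0 < c * gw - gu" "0 < fu - c * fw"
    using c pos by (simp_all add: divide_less_eq less_divide_eq)
  \<comment> \<open>The first order decrease of the sum of the \<open>G\<close> values is
    \<open>h d\<close>; the quadratic remainders add up to \<open>P k\<close> times h^2.\<close>
  define d where "d = c * gw - gu"
  define k where "k = gu + c\<^sup>2 * gw"
  have k: "k > 0" using pos c0 by (simp add: k_def add_pos_pos)
  \<comment> \<open>The first two bounds make \<open>G_perturbation\<close> applicable to
    \<open>h\<close> and to \<open>- (c * h)\<close>; the third keeps the remainder below half of
    the linear decrease.\<close>
  define h where "h = min (1 / (2 * P)) (min (1 / (2 * P * c)) (d / (2 * P * k)))"
  have h0: "h > 0" using P_ge_1 c0 cd k by (simp add: h_def d_def)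
  have h1: "h \<le> 1 / (2 * P)" by (simp add: h_def)
  have h2: "c * h \<le> 1 / (2 * P)"
  proof -
    have "h \<le> 1 / (2 * P * c)" by (simp add: h_def)
    then have "c * h \<le> c * (1 / (2 * P * c))" using c0 by (intro mult_left_mono) auto
    then show ?thesis using c0 by simp
  qed
  have h3: "P * h * k \<le> d / 2"
  proof -
    have "h \<le> d / (2 * P * k)" by (simp add: h_def)
    then have "P * k * h \<le> P * k * (d / (2 * P * k))" using P_ge_1 k by (intro mult_left_mono) auto
    then show ?thesis using P_ge_1 k by (simp add: mult_ac)
  qed
  have P2: "1 / (2 * P) \<le> 1 / 2" using P_ge_1 by (simp add: field_simps)
  have ab: "0 < 1 + h" "0 < 1 + - (c * h)" using h0 h2 P2 by auto
  have ch: "c * h > 0" using c0 h0 by simp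
  have "(LINT x|M. (1 + h) powr p x / p x * norm (weak_gradient \<Omega> u x) powr p x) +
      (LINT x|M. (1 + - (c * h)) powr p x / p x * norm (weak_gradient \<Omega> w x) powr p x) \<le>
      (\<alpha> + h * gu + P * h\<^sup>2 * gu) + (\<alpha> + - (c * h) * gw + P * (- (c * h))\<^sup>2 * gw)"
    unfolding gu_def gw_def using h0 h1 h2 ch by (intro add_mono G_perturbation u w) auto
  also have "\<dots> = 2 * \<alpha> - h * d + h * (P * h * k)"
    by (simp add: d_def k_def algebra_simps power2_eq_square)
  also have "\<dots> \<le> 2 * \<alpha> - h * d + h * (d / 2)"
    using mult_left_mono[OF h3, of h] h0 by linarith
  also have "\<dots> < 2 * \<alpha>" using h0 cd by (simp add: d_def)
  finally have "(LINT x|M. (1 + h) powr q x * (V x / q x * \<bar>u x\<bar> powr q x)) +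
      (LINT x|M. (1 + - (c * h)) powr q x * (V x / q x * \<bar>w x\<bar> powr q x)) \<le> 2 * m"
    using u w m by (intro midpoint_inequality ab i max) (auto simp: sphere_M_def)
  moreover have "(m + h * fu) + (m + - (c * h) * fw) \<le> (LINT x|M. (1 + h) powr q x * (V x / q x * \<bar>u x\<bar> powr q x)) +
      (LINT x|M. (1 + - (c * h)) powr q x * (V x / q x * \<bar>w x\<bar> powr q x))"
    using F_perturbation[OF i(1), of h] F_perturbation[OF i(2), of "- (c * h)"] h0 h1 h2 ch P2
    unfolding Fu Fw fu_def fw_def by (intro add_mono) auto
  ultimately have "h * (fu - c * fw) \<le> 0" by (simp add: algebra_simps)
  then show False using h0 cd by (simp add: mult_le_0_iff)
qed

lemma maximizer_multiplier_eq:
  assumes "u \<in> sphere_M \<Omega> p \<alpha>" "w \<in> sphere_M \<Omega> p \<alpha>" "F_fun \<Omega> q V u = m" "F_fun \<Omega> q V w = m" "0 < m"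
    and "\<And>v. v \<in> sphere_M \<Omega> p \<alpha> \<Longrightarrow> F_fun \<Omega> q V v \<le> m"
  shows "phi_fun \<Omega> q V u * psi_fun \<Omega> p w = phi_fun \<Omega> q V w * psi_fun \<Omega> p u"
  using maximizer_multiplier_le[OF assms] maximizer_multiplier_le[OF assms(2,1,4,3,5,6)] by simp

section \<open>Testing the equations with the function itself, and the first Ljusternik-Schnirelman
  value\<close>

lemma F_deriv_self: "F_deriv \<Omega> q V u u = phi_fun \<Omega> q V u"
proof -
  have "\<bar>y\<bar> powr (k - 2) * y * y = \<bar>y\<bar> powr k" for y k :: real
    \<comment> \<open>At \<open>y = 0\<close> both sides vanish whatever the sign of
      \<open>k - 2\<close>, as \<open>0 powr\<close> anything is 0.\<close>
    by (cases "y = 0") (simp_all add: powr_diff powr_numeral power2_eq_square abs_mult_self_eq)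
  then show ?thesis
    unfolding F_deriv_def phi_fun_def by (metis (no_types, lifting) mult.assoc)
qed

lemma G_deriv_self: "G_deriv \<Omega> p u u = psi_fun \<Omega> p u"
proof -
  have "norm y powr (k - 2) * (y \<bullet> y) = norm y powr k" for y :: 'a and k :: real
    by (cases "y = 0") (simp_all add: powr_diff powr_numeral power2_norm_eq_inner)
  then show ?thesis
    unfolding G_deriv_def psi_fun_def by simp
qed

lemma sphere_uminus:
  assumes u: "u \<in> sphere_M \<Omega> p \<alpha>"
  shows "(\<lambda>x. - u x) \<in> sphere_M \<Omega> p \<alpha>"
proof -
  have uX: "u \<in> var_Sobolev0 \<Omega> p" using u by (simp add: sphere_M_def)
  note n = var_Sobolev0_uminus[OF uX]
  have [measurable]: "weak_gradient \<Omega> (\<lambda>x. - u x) \<in> borel_measurable M" "weak_gradient \<Omega> u \<in> borel_measurable M"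
    using n(1) uX var_SobolevD(3) by (auto simp: var_Sobolev0_def var_Lebesgue_def)
  have "G_fun \<Omega> p (\<lambda>x. - u x) = G_fun \<Omega> p u"
    unfolding G_fun_def
    by (rule integral_cong_AE) (measurable, use n(2) in \<open>eventually_elim, simp\<close>)
  then show ?thesis using n(1) u by (simp add: sphere_M_def)
qed

text \<open>Keeps the empty set, over which the infimum of \<open>F\<close> is infinite, out of the
  families with \<open>n >= 1\<close>.\<close>

lemma genus_empty: "genus \<Omega> p {} = 0"
proof -
  have "genus \<Omega> p {} \<le> enat 0"
    unfolding genus_def by (rule Inf_lower) (auto simp: continuous_map_on_empty intro!: exI[of _ 0])
  then show ?thesis by (simp add: zero_enat_def[symmetric])
qed

lemma genus_nonempty:
  assumes H: "H \<noteq> {}" "H \<subseteq> var_Sobolev0 \<Omega> p"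
  shows "enat 1 \<le> genus \<Omega> p H"
  unfolding genus_def
proof (rule Inf_greatest, clarify)
  fix k h
  assume h: "continuous_map (subtopology (Sobolev0_topology \<Omega> p) H) (subtopology (Euclidean_space k) (- {\<lambda>i. 0})) h"
  obtain u where u: "u \<in> H" using H by blast
  have "u \<in> topspace (subtopology (Sobolev0_topology \<Omega> p) H)"
    using u H by (auto simp: topspace_Sobolev0_topology)
  then have "h u \<in> topspace (subtopology (Euclidean_space k) (- {\<lambda>i. 0}))"
    using h by (auto simp: continuous_map_def)
  then have "h u \<in> topspace (Euclidean_space k)" "h u \<noteq> (\<lambda>i. 0)" by auto
  \<comment> \<open>In dimension 0 the only point is the zero sequence, which has been
    removed.\<close>
  then have "k \<noteq> 0" by (auto simp: topspace_Euclidean_space fun_eq_iff)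
  then show "enat 1 \<le> enat k" by simp
qed

text \<open>Pairs \<open>{v, -v}\<close> have genus 1.\<close>

lemma LS_value_1: "LS_value \<Omega> p q V 1 \<alpha> = (SUP v\<in>sphere_M \<Omega> p \<alpha>. ereal (F_fun \<Omega> q V v))"
proof (rule antisym)
  show "LS_value \<Omega> p q V 1 \<alpha> \<le> (SUP v\<in>sphere_M \<Omega> p \<alpha>. ereal (F_fun \<Omega> q V v))"
    unfolding LS_value_def
  proof (rule SUP_least)
    fix H assume H: "H \<in> LS_family \<Omega> p 1 \<alpha>"
    then have "enat 1 \<le> genus \<Omega> p H" "H \<subseteq> sphere_M \<Omega> p \<alpha>" by (auto simp: LS_family_def)
    moreover from this have "H \<noteq> {}" by (auto simp: genus_empty zero_enat_def)
    ultimately obtain v where v: "v \<in> H" "v \<in> sphere_M \<Omega> p \<alpha>" by blast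
    have "(INF u\<in>H. ereal (F_fun \<Omega> q V u)) \<le> ereal (F_fun \<Omega> q V v)" by (rule INF_lower[OF v(1)])
    also have "\<dots> \<le> (SUP v\<in>sphere_M \<Omega> p \<alpha>. ereal (F_fun \<Omega> q V v))" by (rule SUP_upper[OF v(2)])
    finally show "(INF u\<in>H. ereal (F_fun \<Omega> q V u)) \<le> (SUP v\<in>sphere_M \<Omega> p \<alpha>. ereal (F_fun \<Omega> q V v))" .
  qed
  show "(SUP v\<in>sphere_M \<Omega> p \<alpha>. ereal (F_fun \<Omega> q V v)) \<le> LS_value \<Omega> p q V 1 \<alpha>"
  proof (rule SUP_least)
    fix v assume v: "v \<in> sphere_M \<Omega> p \<alpha>"
    \<comment> \<open>Since \<open>F\<close> is even, its infimum over this pair is its value at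
      \<open>v\<close>.\<close>
    define H where "H = {v, \<lambda>x. - v x}"
    have sub: "H \<subseteq> sphere_M \<Omega> p \<alpha>" using v sphere_uminus[OF v] by (simp add: H_def)
    then have subX: "H \<subseteq> var_Sobolev0 \<Omega> p" by (auto simp: sphere_M_def)
    have "compactin (Sobolev0_topology \<Omega> p) H"
      by (rule finite_imp_compactin) (use subX in \<open>auto simp: topspace_Sobolev0_topology H_def\<close>)
    moreover have "(\<lambda>u x. - u x) ` H = H" by (auto simp: H_def)
    moreover have "enat 1 \<le> genus \<Omega> p H" by (rule genus_nonempty[OF _ subX]) (simp add: H_def)
    ultimately have "H \<in> LS_family \<Omega> p 1 \<alpha>" using sub by (simp add: LS_family_def)
    moreover have "(INF u\<in>H. ereal (F_fun \<Omega> q V u)) = ereal (F_fun \<Omega> q V v)"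
      by (simp add: H_def F_fun_def)
    ultimately show "ereal (F_fun \<Omega> q V v) \<le> LS_value \<Omega> p q V 1 \<alpha>"
      unfolding LS_value_def by (metis (no_types, lifting) SUP_upper)
  qed
qed

end

text \<open>For \<open>s >= 1\<close> the modulus of \<open>V\<close> is at most 1 plus its power,
  and \<open>\<Omega>\<close> has finite measure.\<close>

lemma var_Lebesgue_integrable:
  fixes V s :: "'a::euclidean_space \<Rightarrow> real"
  assumes V: "V \<in> var_Lebesgue \<Omega> s" and "open \<Omega>" "bounded \<Omega>"
    and [measurable]: "s \<in> borel_measurable (lebesgue_on \<Omega>)" and s: "\<And>x. x \<in> \<Omega> \<Longrightarrow> 1 \<le> s x"
  shows "integrable (lebesgue_on \<Omega>) V"
proof -
  have Vm [measurable]: "V \<in> borel_measurable (lebesgue_on \<Omega>)" and fin: "modular \<Omega> s V < \<infinity>"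
    using V by (auto simp: var_Lebesgue_def)
  interpret finite_measure "lebesgue_on \<Omega>"
    using assms(2,3) by (intro finite_measure_lebesgue_on bounded_set_imp_lmeasurable) auto
  have i: "integrable (lebesgue_on \<Omega>) (\<lambda>x. norm (V x) powr s x)"
    using fin by (intro integrableI_bounded) (auto simp: modular_def)
  show ?thesis
  proof (rule Bochner_Integration.integrable_bound)
    show "integrable (lebesgue_on \<Omega>) (\<lambda>x. 1 + norm (V x) powr s x)" using i by simp
    show "AE x in lebesgue_on \<Omega>. norm (V x) \<le> norm (1 + norm (V x) powr s x)"
    proof (rule AE_I2)
      fix x assume "x \<in> space (lebesgue_on \<Omega>)"
      then have x: "1 \<le> s x" using s by simp
      have "norm (V x) \<le> 1 + norm (V x) powr s x"
      proof (cases "norm (V x) \<le> 1")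
        case False
        then have "norm (V x) powr 1 \<le> norm (V x) powr s x" using x by (intro powr_mono) auto
        then show ?thesis by simp
      qed (simp add: add_increasing2)
      then show "norm (V x) \<le> norm (1 + norm (V x) powr s x)" by simp
    qed
  qed measurable
qed

theorem theorem3p3:
  fixes \<Omega> :: "'a::euclidean_space set"
    and p q s V :: "'a \<Rightarrow> real"
    and \<alpha> lam \<mu>\<^sub>1 :: real
    and u_lam u\<^sub>1 :: "'a \<Rightarrow> real"
  assumes "DIM('a) \<ge> 2"
    and "bounded_smooth_domain \<Omega>"
    and "continuous_on (closure \<Omega>) p"
    and "continuous_on (closure \<Omega>) q"
    and "continuous_on (closure \<Omega>) s"
    and "\<And>x. x \<in> closure \<Omega> \<Longrightarrow> 1 < p x \<and> p x < real DIM('a)"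
    and "\<And>x. x \<in> closure \<Omega> \<Longrightarrow> 1 < q x \<and> q x < real DIM('a)"
    and "\<And>x. x \<in> closure \<Omega> \<Longrightarrow> real DIM('a) < s x"
    and "\<And>x. x \<in> closure \<Omega> \<Longrightarrow> s x * q x / (s x - 1) < critical_exp p x"
    and "V \<in> var_Lebesgue \<Omega> s"
    and "AE x in lebesgue_on \<Omega>. 0 < V x"
    and "upper_exp \<Omega> q < lower_exp \<Omega> p"
    and "0 < \<alpha>"
    and "lagrange_eigenpair \<Omega> p q V \<alpha> lam u_lam"
    and "LS_eigenpair \<Omega> p q V 1 \<alpha> u\<^sub>1 \<mu>\<^sub>1"
  shows "ereal (I_fun \<Omega> p q V lam u\<^sub>1) = (INF u\<in>sphere_M \<Omega> p \<alpha>. ereal (I_fun \<Omega> p q V lam u)) \<and>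
         (INF u\<in>sphere_M \<Omega> p \<alpha>. ereal (I_fun \<Omega> p q V lam u)) = ereal (I_fun \<Omega> p q V lam u_lam) \<and>
         eigenpair \<Omega> p q V lam u\<^sub>1 \<and>
         lam = 1 / \<mu>\<^sub>1"
proof -
  have \<Omega>: "open \<Omega>" "bounded \<Omega>" "\<Omega> \<noteq> {}" "\<Omega> \<in> sets lebesgue"
    using assms(2) by (auto simp: bounded_smooth_domain_def)
  have meas: "h \<in> borel_measurable (lebesgue_on \<Omega>)" if "continuous_on (closure \<Omega>) h" for h :: "'a \<Rightarrow> real"
    using continuous_on_subset[OF that closure_subset] \<Omega>(4) by (rule continuous_imp_measurable_on_sets_lebesgue)
  have cl: "x \<in> closure \<Omega>" if "x \<in> \<Omega>" for x using that closure_subset by blast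
  have sub: "q x \<le> upper_exp \<Omega> q" "lower_exp \<Omega> p \<le> p x" if "x \<in> \<Omega>" for x
    unfolding upper_exp_def lower_exp_def using assms(6,7) cl[OF that]
    by (force intro!: cSUP_upper cINF_lower bdd_aboveI2[of _ _ "real DIM('a)"] bdd_belowI2[of _ 1])+
  have sN: "1 \<le> s x" if "x \<in> \<Omega>" for x
    using assms(8)[OF cl[OF that]] assms(1) by simp
  \<comment> \<open>The exponent of the power means is p^-: q <= q^+ < p^- <= p.\<close>
  interpret eigen_setting \<Omega> p "real DIM('a)" q V "lower_exp \<Omega> p" \<alpha>
  proof
    show "1 \<le> p x \<and> p x \<le> real DIM('a)" if "x \<in> \<Omega>" for x
      using assms(6)[OF cl[OF that]] by simp
    show "1 \<le> q x \<and> q x \<le> lower_exp \<Omega> p" if "x \<in> \<Omega>" for x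
      using assms(7)[OF cl[OF that]] assms(12) sub[OF that] by simp
    show "integrable (lebesgue_on \<Omega>) V"
      by (rule var_Lebesgue_integrable[OF assms(10) \<Omega>(1,2) meas[OF assms(5)] sN])
  qed (use \<Omega> assms meas sub in auto)
  define m where "m = F_fun \<Omega> q V u_lam"
  have L: "u_lam \<in> sphere_M \<Omega> p \<alpha>" "ereal m = (SUP w\<in>sphere_M \<Omega> p \<alpha>. ereal (F_fun \<Omega> q V w))"
    "lam = psi_fun \<Omega> p u_lam / phi_fun \<Omega> q V u_lam"
    using assms(14) by (auto simp: lagrange_eigenpair_def m_def)
  \<comment> \<open>\<open>LS_value_1\<close> and the maximality of \<open>u_lam\<close> identify
    the first Ljusternik-Schnirelman value with \<open>m\<close>.\<close>
  have S: "u\<^sub>1 \<in> sphere_M \<Omega> p \<alpha>" "F_fun \<Omega> q V u\<^sub>1 = m" "\<mu>\<^sub>1 \<noteq> 0"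
    "\<And>v. v \<in> var_Sobolev0 \<Omega> p \<Longrightarrow> F_deriv \<Omega> q V u\<^sub>1 v = \<mu>\<^sub>1 * G_deriv \<Omega> p u\<^sub>1 v"
    using assms(15)[unfolded LS_eigenpair_def LS_value_1 L(2)[symmetric]] by auto
  have max: "F_fun \<Omega> q V v \<le> m" if "v \<in> sphere_M \<Omega> p \<alpha>" for v
    using SUP_upper[OF that, of "\<lambda>w. ereal (F_fun \<Omega> q V w)"] by (simp add: L(2)[symmetric])
  have m: "m > 0" using exists_positive_on_sphere max by force
  have i: "integrable (lebesgue_on \<Omega>) (\<lambda>x. V x / q x * \<bar>v x\<bar> powr q x)" if "F_fun \<Omega> q V v = m" for v
    using that m not_integrable_integral_eq unfolding F_fun_def by fastforce
  have Fl: "F_fun \<Omega> q V u_lam = m" by (simp add: m_def)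
  have pos: "psi_fun \<Omega> p u_lam > 0" "psi_fun \<Omega> p u\<^sub>1 > 0" "phi_fun \<Omega> q V u_lam > 0" "phi_fun \<Omega> q V u\<^sub>1 > 0"
    using psi_fun_pos[OF L(1)] psi_fun_pos[OF S(1)] phi_fun_pos[OF i[OF Fl]] phi_fun_pos[OF i[OF S(2)]] Fl S(2) m by auto
  have lam0: "lam > 0" using pos by (simp add: L(3))
  have u1X: "u\<^sub>1 \<in> var_Sobolev0 \<Omega> p" using S(1) by (simp add: sphere_M_def)
  \<comment> \<open>Testing the equation of \<open>u\<^sub>1\<close> with \<open>u\<^sub>1\<close>
    itself identifies \<open>\<mu>\<^sub>1\<close> as \<open>phi / psi\<close> there.\<close>
  have "phi_fun \<Omega> q V u\<^sub>1 = \<mu>\<^sub>1 * psi_fun \<Omega> p u\<^sub>1"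
    using S(4)[OF u1X] by (simp add: F_deriv_self G_deriv_self)
  moreover have "phi_fun \<Omega> q V u\<^sub>1 * psi_fun \<Omega> p u_lam = phi_fun \<Omega> q V u_lam * psi_fun \<Omega> p u\<^sub>1"
    by (rule maximizer_multiplier_eq[OF S(1) L(1) S(2) Fl m max])
  ultimately have "\<mu>\<^sub>1 * psi_fun \<Omega> p u_lam = phi_fun \<Omega> q V u_lam"
    using pos by simp
  then have lam: "lam = 1 / \<mu>\<^sub>1"
    using pos S(3) by (simp add: L(3) field_simps)
  have I: "I_fun \<Omega> p q V lam v = \<alpha> - lam * F_fun \<Omega> q V v" if "v \<in> sphere_M \<Omega> p \<alpha>" for v
    using that by (simp add: I_fun_def sphere_M_def)
  \<comment> \<open>On the sphere \<open>G\<close> is constant and \<open>lam > 0\<close>, so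
    minimizing \<open>I_fun\<close> means maximizing \<open>F\<close>.\<close>
  have inf: "(INF u\<in>sphere_M \<Omega> p \<alpha>. ereal (I_fun \<Omega> p q V lam u)) = ereal (\<alpha> - lam * m)"
  proof (rule antisym)
    show "(INF u\<in>sphere_M \<Omega> p \<alpha>. ereal (I_fun \<Omega> p q V lam u)) \<le> ereal (\<alpha> - lam * m)"
      using INF_lower[OF L(1), of "\<lambda>u. ereal (I_fun \<Omega> p q V lam u)"] I[OF L(1)] Fl by simp
    show "ereal (\<alpha> - lam * m) \<le> (INF u\<in>sphere_M \<Omega> p \<alpha>. ereal (I_fun \<Omega> p q V lam u))"
      by (rule INF_greatest) (use I max lam0 in \<open>auto simp: mult_left_mono\<close>)
  qed
  have "\<not> (AE x in lebesgue_on \<Omega>. u\<^sub>1 x = 0)"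
  proof
    assume "AE x in lebesgue_on \<Omega>. u\<^sub>1 x = 0"
    then have "F_fun \<Omega> q V u\<^sub>1 = 0"
      unfolding F_fun_def by (intro integral_eq_zero_AE) (auto elim: eventually_mono)
    then show False using S(2) m by simp
  qed
  then have "eigenpair \<Omega> p q V lam u\<^sub>1"
    using u1X S(3,4) by (simp add: eigenpair_def lam)
  then show ?thesis
    using inf I[OF L(1)] I[OF S(1)] Fl S(2) lam by simp
qed

end
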